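(* Let $\mathfrak{g}$ be a (finite dimensional, complex) semisimple Lie algebra with a non degenerate symmetric invariant bilinear form $B$ (not necessarily the Killing form), and let $F\in\mathcal{M}_a^{2k}(\mathfrak{g})$ ($k\ge1$) be an invariant even cyclic cochain, with associated derivation $D$ of $\bigwedge\mathfrak{g}$ and cohomology $H^\star(F)=\ker(D)/\mathrm{Im}(D)$. Then $(\bigwedge\mathfrak{g})^{\mathfrak{g}}\subset H^\star(F)$; that is, $(\bigwedge\mathfrak{g})^{\mathfrak{g}}\subset\ker(D)$ and the canonical map $(\bigwedge\mathfrak{g})^{\mathfrak{g}}\to H^\star(F)$ is injective.
   Context: $\mathcal{M}_a^{k}(\mathfrak{g})$ is the space of skew symmetric $k$-linear maps $\mathfrak{g}^{k}\to\mathfrak{g}$. For $C\in\mathcal{M}_a^k(\mathfrak{g})$, $\hat C(Y_1,\dots,Y_{k+1})=B(C(Y_1,\dots,Y_k),Y_{k+1})$, and $C$ is a cyclic cochain if $\hat C(Y_1,\dots,Y_{k+1})=(-1)^k\hat C(Y_{k+1},Y_1,\dots,Y_k)$ for all $Y_i\in\mathfrak{g}$. $C$ is invariant if $[X,C(Y_1,\dots,Y_k)]=\sum_iC(Y_1,\dots,[X,Y_i],\dots,Y_k)$ for all $X,Y_i\in\mathfrak{g}$. $\bigwedge\mathfrak{g}=\sum_p\bigwedge^p\mathfrak{g}$ is the algebra of skew symmetric multilinear forms on $\mathfrak{g}$ with the wedge product; $\iota_X\Omega=\Omega(X,\cdot,\dots,\cdot)$, $\iota_X(1)=0$. $(\bigwedge\mathfrak{g})^{\mathfrak{g}}$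 is the space of forms with $\sum_i\Omega(Y_1,\dots,[X,Y_i],\dots,Y_p)=0$ for all $X,Y_i\in\mathfrak{g}$. The super Poisson bracket is $\{\Omega,\Omega'\}=2(-1)^{w+1}\sum_{j=1}^n\iota_{X_j}(\Omega)\wedge\iota_{X_j}(\Omega')$ for $\Omega\in\bigwedge^w\mathfrak{g}$, $\{X_1,\dots,X_n\}$ any $B$-orthonormal basis of $\mathfrak{g}$; $\mathrm{ad}_P(\Omega)=\{\Omega,\cdot\}$. To $F$ one associates $I\in\bigwedge^{2k+1}\mathfrak{g}$, $I(Y_1,\dots,Y_{2k+1})=B(F(Y_1,\dots,Y_{2k}),Y_{2k+1})$, and the derivation $D=-\frac12\mathrm{ad}_P(I)$ of $\bigwedge\mathfrak{g}$, which satisfies $D^2=0$. *)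

theory Defs
  imports Complex_Main "HOL-Combinatorics.Permutations"
begin

section \<open>Semisimple complex Lie algebras\<close>

locale lie_algebra = vector_space scale
  for scale :: "complex \<Rightarrow> 'a::ab_group_add \<Rightarrow> 'a" +
  fixes bracket :: "'a \<Rightarrow> 'a \<Rightarrow> 'a"
  assumes linear_bracket_left: "Vector_Spaces.linear scale scale (\<lambda>x. bracket x y)"
    and linear_bracket_right: "Vector_Spaces.linear scale scale (\<lambda>y. bracket x y)"
    and bracket_self: "bracket x x = 0"
    and jacobi: "bracket x (bracket y z) + bracket y (bracket z x) + bracket z (bracket x y) = 0"

definition finite_dimensional :: "(complex \<Rightarrow> 'a::ab_group_add \<Rightarrow> 'a) \<Rightarrow> bool" where
  "finite_dimensional scale \<longleftrightarrow> (\<exists>A. finite A \<and> module.span scale A = UNIV)"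

definition lie_ideal ::
  "(complex \<Rightarrow> 'a::ab_group_add \<Rightarrow> 'a) \<Rightarrow> ('a \<Rightarrow> 'a \<Rightarrow> 'a) \<Rightarrow> 'a set \<Rightarrow> bool" where
  "lie_ideal scale bracket J \<longleftrightarrow>
     module.subspace scale J \<and> (\<forall>x. \<forall>y\<in>J. bracket x y \<in> J)"

primrec derived_series ::
  "(complex \<Rightarrow> 'a::ab_group_add \<Rightarrow> 'a) \<Rightarrow> ('a \<Rightarrow> 'a \<Rightarrow> 'a) \<Rightarrow> 'a set \<Rightarrow> nat \<Rightarrow> 'a set" where
  "derived_series scale bracket J 0 = J"
| "derived_series scale bracket J (Suc m) =
     module.span scale {bracket x y |x y.
       x \<in> derived_series scale bracket J m \<and> y \<in> derived_series scale bracket J m}"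

definition solvable_ideal ::
  "(complex \<Rightarrow> 'a::ab_group_add \<Rightarrow> 'a) \<Rightarrow> ('a \<Rightarrow> 'a \<Rightarrow> 'a) \<Rightarrow> 'a set \<Rightarrow> bool" where
  "solvable_ideal scale bracket J \<longleftrightarrow> (\<exists>m. derived_series scale bracket J m = {0})"

definition semisimple ::
  "(complex \<Rightarrow> 'a::ab_group_add \<Rightarrow> 'a) \<Rightarrow> ('a \<Rightarrow> 'a \<Rightarrow> 'a) \<Rightarrow> bool" where
  "semisimple scale bracket \<longleftrightarrow>
     (\<forall>J. lie_ideal scale bracket J \<and> solvable_ideal scale bracket J \<longrightarrow> J = {0})"


section \<open>Bilinear forms\<close>

definition bilinear_form ::
  "(complex \<Rightarrow> 'a::ab_group_add \<Rightarrow> 'a) \<Rightarrow> ('a \<Rightarrow> 'a \<Rightarrow> complex) \<Rightarrow> bool" where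
  "bilinear_form scale B \<longleftrightarrow>
     (\<forall>y. Vector_Spaces.linear scale (*) (\<lambda>x. B x y)) \<and>
     (\<forall>x. Vector_Spaces.linear scale (*) (\<lambda>y. B x y))"

definition symmetric_form :: "('a \<Rightarrow> 'a \<Rightarrow> complex) \<Rightarrow> bool" where
  "symmetric_form B \<longleftrightarrow> (\<forall>x y. B x y = B y x)"

definition nondegenerate_form :: "('a::zero \<Rightarrow> 'a \<Rightarrow> complex) \<Rightarrow> bool" where
  "nondegenerate_form B \<longleftrightarrow> (\<forall>x. (\<forall>y. B x y = 0) \<longrightarrow> x = 0)"

definition invariant_form ::
  "('a \<Rightarrow> 'a \<Rightarrow> 'a) \<Rightarrow> ('a \<Rightarrow> 'a \<Rightarrow> complex) \<Rightarrow> bool" where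
  "invariant_form bracket B \<longleftrightarrow> (\<forall>x y z. B (bracket x y) z = B x (bracket y z))"

definition orthonormal_basis ::
  "(complex \<Rightarrow> 'a::ab_group_add \<Rightarrow> 'a) \<Rightarrow> ('a \<Rightarrow> 'a \<Rightarrow> complex) \<Rightarrow> 'a set \<Rightarrow> bool" where
  "orthonormal_basis scale B E \<longleftrightarrow>
     finite E \<and> \<not> module.dependent scale E \<and> module.span scale E = UNIV \<and>
     (\<forall>x\<in>E. \<forall>y\<in>E. B x y = (if x = y then 1 else 0))"


section \<open>Skew symmetric multilinear maps and cyclic cochains\<close>

text \<open>
  A map of \<open>p\<close> vector arguments is a function on lists, of which only the values on lists
  of length \<open>p\<close> matter.
\<close>

definition skew_multilinear ::
  "(complex \<Rightarrow> 'a::ab_group_add \<Rightarrow> 'a) \<Rightarrow> (complex \<Rightarrow> 'b::ab_group_add \<Rightarrow> 'b) \<Rightarrow>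
   nat \<Rightarrow> ('a list \<Rightarrow> 'b) \<Rightarrow> bool" where
  "skew_multilinear scale scale' p f \<longleftrightarrow>
     (\<forall>ys i. length ys = p \<and> i < p \<longrightarrow>
        Vector_Spaces.linear scale scale' (\<lambda>y. f (ys[i := y]))) \<and>
     (\<forall>ys i j. length ys = p \<and> i < j \<and> j < p \<longrightarrow>
        f (ys[i := ys ! j, j := ys ! i]) = - f ys)"

definition hat :: "('a \<Rightarrow> 'a \<Rightarrow> complex) \<Rightarrow> ('a list \<Rightarrow> 'a) \<Rightarrow> 'a list \<Rightarrow> complex" where
  "hat B C ys = B (C (butlast ys)) (last ys)"

definition cyclic_cochain ::
  "(complex \<Rightarrow> 'a::ab_group_add \<Rightarrow> 'a) \<Rightarrow> ('a \<Rightarrow> 'a \<Rightarrow> complex) \<Rightarrow>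
   nat \<Rightarrow> ('a list \<Rightarrow> 'a) \<Rightarrow> bool" where
  "cyclic_cochain scale B p C \<longleftrightarrow>
     skew_multilinear scale scale p C \<and>
     (\<forall>ys. length ys = p + 1 \<longrightarrow> hat B C ys = (-1) ^ p * hat B C (last ys # butlast ys))"

definition invariant_cochain ::
  "('a \<Rightarrow> 'a \<Rightarrow> 'a::ab_group_add) \<Rightarrow> nat \<Rightarrow> ('a list \<Rightarrow> 'a) \<Rightarrow> bool" where
  "invariant_cochain bracket p C \<longleftrightarrow>
     (\<forall>x ys. length ys = p \<longrightarrow>
        bracket x (C ys) = (\<Sum>i<p. C (ys[i := bracket x (ys ! i)])))"


section \<open>The algebra of skew symmetric multilinear forms\<close>

text \<open>
  An element of the direct sum of the spaces of skew symmetric \<open>p\<close>-forms is one function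
  on lists: its component of degree \<open>p\<close> is its restriction to the lists of length \<open>p\<close>.
\<close>

definition ext_forms ::
  "(complex \<Rightarrow> 'a::ab_group_add \<Rightarrow> 'a) \<Rightarrow> ('a list \<Rightarrow> complex) set" where
  "ext_forms scale =
     {\<Omega>. (\<forall>p. skew_multilinear scale (*) p \<Omega>) \<and>
         (\<exists>N. \<forall>ys. N < length ys \<longrightarrow> \<Omega> ys = 0)}"

definition invariant_forms ::
  "(complex \<Rightarrow> 'a::ab_group_add \<Rightarrow> 'a) \<Rightarrow> ('a \<Rightarrow> 'a \<Rightarrow> 'a) \<Rightarrow> ('a list \<Rightarrow> complex) set" where
  "invariant_forms scale bracket =
     {\<Omega> \<in> ext_forms scale.
        \<forall>x ys. (\<Sum>i<length ys. \<Omega> (ys[i := bracket x (ys ! i)])) = 0}"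

definition interior_product :: "'a \<Rightarrow> ('a list \<Rightarrow> complex) \<Rightarrow> 'a list \<Rightarrow> complex" where
  "interior_product x \<Omega> = (\<lambda>ys. \<Omega> (x # ys))"

text \<open>
  The factor \<open>1 / (p! q!)\<close> makes the sum over all permutations equal to the sum over
  \<open>(p, q)\<close>-shuffles; with this normalisation \<open>interior_product x\<close> is a superderivation of degree
  \<open>-1\<close>.
\<close>

definition wedge ::
  "('a list \<Rightarrow> complex) \<Rightarrow> ('a list \<Rightarrow> complex) \<Rightarrow> 'a list \<Rightarrow> complex" where
  "wedge \<Omega> \<Omega>' = (\<lambda>ys.
     let n = length ys in
     \<Sum>p\<le>n. (\<Sum>\<sigma> | \<sigma> permutes {..<n}.
        of_int (sign \<sigma>) * \<Omega> (map (\<lambda>i. ys ! \<sigma> i) [0..<p]) * \<Omega>' (map (\<lambda>i. ys ! \<sigma> i) [p..<n]))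
        / (fact p * fact (n - p)))"

text \<open>
  The sign \<open>(-1) ^ (w + 1)\<close> depends on the degree \<open>w\<close> of the first argument. It is put
  inside, on the component of each degree, which extends the bracket linearly to arguments
  that are not homogeneous.
\<close>

definition super_poisson ::
  "'a set \<Rightarrow> ('a list \<Rightarrow> complex) \<Rightarrow> ('a list \<Rightarrow> complex) \<Rightarrow> 'a list \<Rightarrow> complex" where
  "super_poisson E \<Omega> \<Omega>' = (\<lambda>ys.
     2 * (\<Sum>x\<in>E. wedge (interior_product x (\<lambda>zs. (-1) ^ (length zs + 1) * \<Omega> zs)) (interior_product x \<Omega>') ys))"


section \<open>The differential of an even cyclic cochain and its cohomology\<close>

definition associated_form ::
  "('a \<Rightarrow> 'a \<Rightarrow> complex) \<Rightarrow> nat \<Rightarrow> ('a list \<Rightarrow> 'a) \<Rightarrow> 'a list \<Rightarrow> complex" where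
  "associated_form B k F = (\<lambda>ys. if length ys = 2 * k + 1 then hat B F ys else 0)"

definition cochain_diff ::
  "('a \<Rightarrow> 'a \<Rightarrow> complex) \<Rightarrow> 'a set \<Rightarrow> nat \<Rightarrow> ('a list \<Rightarrow> 'a) \<Rightarrow>
   ('a list \<Rightarrow> complex) \<Rightarrow> 'a list \<Rightarrow> complex" where
  "cochain_diff B E k F \<Omega> = (\<lambda>ys. - (1 / 2) * super_poisson E (associated_form B k F) \<Omega> ys)"

definition form_kernel ::
  "(complex \<Rightarrow> 'a::ab_group_add \<Rightarrow> 'a) \<Rightarrow> (('a list \<Rightarrow> complex) \<Rightarrow> 'a list \<Rightarrow> complex) \<Rightarrow>
   ('a list \<Rightarrow> complex) set" where
  "form_kernel scale D = {\<Omega> \<in> ext_forms scale. D \<Omega> = (\<lambda>ys. 0)}"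

definition form_image ::
  "(complex \<Rightarrow> 'a::ab_group_add \<Rightarrow> 'a) \<Rightarrow> (('a list \<Rightarrow> complex) \<Rightarrow> 'a list \<Rightarrow> complex) \<Rightarrow>
   ('a list \<Rightarrow> complex) set" where
  "form_image scale D = D ` ext_forms scale"

definition cohomology_class ::
  "(complex \<Rightarrow> 'a::ab_group_add \<Rightarrow> 'a) \<Rightarrow> (('a list \<Rightarrow> complex) \<Rightarrow> 'a list \<Rightarrow> complex) \<Rightarrow>
   ('a list \<Rightarrow> complex) \<Rightarrow> ('a list \<Rightarrow> complex) set" where
  "cohomology_class scale D \<Omega> = {\<lambda>ys. \<Omega> ys + \<eta> ys |\<eta>. \<eta> \<in> form_image scale D}"

definition cohomology ::
  "(complex \<Rightarrow> 'a::ab_group_add \<Rightarrow> 'a) \<Rightarrow> (('a list \<Rightarrow> complex) \<Rightarrow> 'a list \<Rightarrow> complex) \<Rightarrow>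
   ('a list \<Rightarrow> complex) set set" where
  "cohomology scale D = cohomology_class scale D ` form_kernel scale D"


section \<open>Existence of orthonormal bases\<close>

lemma ex_orthonormal_basis:
  fixes scale :: "complex \<Rightarrow> 'a::ab_group_add \<Rightarrow> 'a"
  assumes vs: "vector_space scale" and fd: "finite_dimensional scale"
    and bil: "bilinear_form scale B" and sym: "symmetric_form B"
    and nondeg: "nondegenerate_form B"
  shows "\<exists>E. orthonormal_basis scale B E"
proof -
  interpret vector_space scale by (rule vs)
  obtain A where A: "finite A" "span A = UNIV"
    using fd unfolding finite_dimensional_def by blast
  have l: "module_hom scale (*) (\<lambda>x. B x y)" and r: "module_hom scale (*) (\<lambda>y. B x y)" for x y
    using bil unfolding bilinear_form_def Vector_Spaces.linear_def by auto
  have addl: "B (a + b) y = B a y + B b y" and scl: "B (scale c a) y = c * B a y"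
    and addr: "B y (a + b) = B y a + B y b" and scr: "B y (scale c a) = c * B y a"
    and subl: "B (a - b) y = B a y - B b y"
    and suml: "B (sum g S) y = (\<Sum>s\<in>S. B (g s) y)" for a b c y and g :: "'a \<Rightarrow> 'a" and S
    using module_hom.add[OF l] module_hom.scale[OF l] module_hom.add[OF r]
      module_hom.scale[OF r] module_hom.diff[OF l] module_hom.sum[OF l] by auto
  have symB: "B x y = B y x" for x y using sym by (simp add: symmetric_form_def)
  define on where "on E \<longleftrightarrow> finite E \<and> (\<forall>x\<in>E. \<forall>y\<in>E. B x y = (if x = y then 1 else 0))" for E
  define pr where "pr E v = (\<Sum>e\<in>E. scale (B v e) e)" for E v
  have Bpr: "B (pr E v) e = B v e" if "on E" "e \<in> E" for E v e
  proof -
    have "B (pr E v) e = (\<Sum>e'\<in>E. if e' = e then B v e else 0)"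
      unfolding pr_def suml scl by (rule sum.cong) (use that in \<open>auto simp: on_def\<close>)
    then show ?thesis using that by (simp add: on_def)
  qed
  have ind: "independent E" if E: "on E" for E
  proof
    assume "dependent E"
    then obtain u v where u: "(\<Sum>e\<in>E. scale (u e) e) = 0" "v \<in> E" "u v \<noteq> 0"
      using E dependent_finite[of E] by (auto simp: on_def)
    have "B (\<Sum>e\<in>E. scale (u e) e) v = (\<Sum>e\<in>E. if e = v then u v else 0)"
      unfolding suml scl by (rule sum.cong) (use E u(2) in \<open>auto simp: on_def\<close>)
    moreover have "B 0 v = 0" using scl[of 0 0 v] by simp
    ultimately show False using u E by (simp add: on_def)
  qed
  have bound: "card E \<le> card A" if "on E" for E
    using independent_span_bound[OF A(1) ind[OF that]] A(2) by simp
  have "on {}" by (simp add: on_def)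
  then obtain E where E: "on E" and max: "\<And>E'. on E' \<Longrightarrow> card E' \<le> card E"
    using ex_has_greatest_nat[of on "{}" card "Suc (card A)"] by (metis bound le_imp_less_Suc)
  have "span E = UNIV"
  proof (rule ccontr)
    assume "span E \<noteq> UNIV"
    then obtain v where v: "v \<notin> span E" by auto
    define W where "W = {w. \<forall>e\<in>E. B w e = 0}"
    have res: "x - pr E x \<in> W" for x using Bpr[OF E] by (simp add: W_def subl)
    have noniso: "\<exists>w\<in>W. B w w \<noteq> 0"
    proof (rule ccontr)
      assume "\<not> (\<exists>w\<in>W. B w w \<noteq> 0)"
      then have iso: "B w w = 0" if "w \<in> W" for w using that by blast
      have zero: "B w w' = 0" if "w \<in> W" "w' \<in> W" for w w'
      proof -
        have "w + w' \<in> W" using that by (simp add: W_def addl)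
        then have "B w w + B w' w + (B w w' + B w' w') = 0"
          using iso[of "w + w'"] by (simp add: addl addr)
        then have "2 * B w w' = 0" using iso that symB[of w' w] by simp
        then show ?thesis by simp
      qed
      have "B (v - pr E v) y = 0" for y
      proof -
        have "B (pr E y) (v - pr E v) = 0"
        proof -
          have "B e (v - pr E v) = 0" if "e \<in> E" for e
            using that res[of v] symB[of e] by (simp add: W_def)
          then show ?thesis unfolding pr_def[of E y] suml scl by simp
        qed
        moreover have "B (y - pr E y) (v - pr E v) = 0" using zero res by blast
        ultimately show ?thesis using symB[of y] by (simp add: subl)
      qed
      then have "v - pr E v = 0" using nondeg unfolding nondegenerate_form_def by blast
      then have "v = pr E v" by simp
      moreover have "pr E v \<in> span E"
        unfolding pr_def by (intro span_sum span_scale span_base)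
      ultimately show False using v by simp
    qed
    then obtain w where w: "w \<in> W" "B w w \<noteq> 0" by blast
    define u where "u = scale (1 / csqrt (B w w)) w"
    have "csqrt (B w w) * csqrt (B w w) = B w w"
      using power2_csqrt[of "B w w"] by (simp add: power2_eq_square)
    then have uu: "B u u = 1" using w by (simp add: u_def scl scr field_simps)
    have ue: "B u e = 0" "B e u = 0" if "e \<in> E" for e
      using that w symB[of e u] by (auto simp: u_def scl W_def)
    have "u \<notin> E" using uu ue by force
    moreover have "on (insert u E)" using E uu ue \<open>u \<notin> E\<close> by (auto simp: on_def)
    ultimately show False using max[of "insert u E"] E by (simp add: on_def)
  qed
  then show ?thesis using E ind[OF E] by (auto simp: orthonormal_basis_def on_def)
qed

end

theory Submission
  imports Defs "HOL-Computational_Algebra.Computational_Algebra"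
    "HOL-Computational_Algebra.Field_as_Ring" "HOL-Library.Function_Algebras"
begin

text \<open>
  Write \<open>M\<close> for the space of forms. The Lie algebra acts on \<open>M\<close>, and complete reducibility gives
  \<open>M = M^g \<oplus> gM\<close>. Up to sign \<open>D\<close> is the contraction \<open>\<Omega> \<mapsto> \<Sum>e. \<iota> e I \<and> \<iota> e \<Omega>\<close>,
  which commutes with the action since \<open>I\<close> is invariant.
  For an invariant \<open>\<Omega>\<close> every \<open>\<iota> e I\<close> is closed for the Chevalley--Eilenberg differential \<open>d\<close>, and
  \<open>\<iota> e \<Omega>\<close> is exact, because \<open>e\<close> is a sum of brackets and \<open>\<iota> [a, b] \<Omega>\<close> is a multiple of
  \<open>d (\<iota> a (\<iota> b \<Omega>))\<close>. So \<open>D \<Omega>\<close> is exact; exact forms lie in \<open>gM\<close>, hence \<open>D \<Omega> \<in> M^g \<inter> gM = 0\<close>.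
  If an invariant form equals \<open>D \<Xi>\<close>, the invariant part of \<open>\<Xi>\<close> is killed by \<open>D\<close>, so
  \<open>D \<Xi> \<in> M^g \<inter> gM = 0\<close> again.

  Complete reducibility is proved from the vanishing of the solvable radical: the form \<open>B\<close> turns the
  trace form of a representation into an endomorphism \<open>T\<close> of the Lie algebra commuting with the
  adjoint action. \<open>T\<close> is not nilpotent, by Cartan's criterion and Engel's theorem, so a Casimir
  element with non-zero trace exists, and a polynomial in it is a central idempotent.
\<close>

section \<open>Polynomials in an endomorphism\<close>

text \<open>The obstacle is that the trace form of a representation may be degenerate, so that it
  offers no dual basis for a Casimir element, while the Casimir element of \<open>B\<close> itself
  has the same trace as \<open>T\<close>, which may be zero. The Fitting projection
  \<open>f = T S\<close> of \<open>T\<close>, with \<open>S\<close> a polynomial in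
  \<open>T\<close>, removes both difficulties: the element formed with the pairs \<open>e\<close>,
  \<open>S e\<close> still commutes with the representation, and its trace is the rank of
  \<open>f\<close>. The rank is positive because a non-zero \<open>T\<close> cannot be nilpotent:
  the range of its last non-zero power would be a \<open>B\<close>-isotropic ideal, and such ideals
  are abelian. One Casimir element need not see the whole representation, so idempotents are
  accumulated until one of them acts as a unit on all operators of the Lie algebra;
  \<open>gM\<close> is then its image and \<open>M^g\<close> its kernel.

  On the side of forms everything rests on \<open>\<iota> y\<close> being a superderivation of the
  wedge product. Read as a recursion along the argument list, this rule replaces the sum over
  permutations, and the operator \<open>grade_sign\<close> carries the degree signs of inhomogeneous
  forms.\<close>

lemma coprime_linear_power:
  fixes x y :: complex
  assumes "x \<noteq> y"
  shows "coprime ([:- x, 1:] ^ m) ([:- y, 1:] ^ n)"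
proof -
  have eq: "[:inverse (y - x):] * [:- x, 1:] - [:inverse (y - x):] * [:- y, 1:] = 1"
    using assms by (simp add: one_pCons left_diff_distrib[symmetric] right_diff_distrib[symmetric])
  have "coprime [:- x, 1:] [:- y, 1:]"
  proof (rule coprimeI)
    fix d assume "d dvd [:- x, 1:]" "d dvd [:- y, 1:]"
    then have "d dvd [:inverse (y - x):] * [:- x, 1:] - [:inverse (y - x):] * [:- y, 1:]"
      by (intro dvd_diff dvd_mult)
    then show "is_unit d" unfolding eq .
  qed
  then show ?thesis unfolding coprime_power_left_iff coprime_power_right_iff by blast
qed

lemma coprime_prod_linear_power:
  fixes x :: complex
  assumes "finite Z" "x \<notin> Z"
  shows "coprime ([:- x, 1:] ^ m) (\<Prod>z\<in>Z. [:- z, 1:] ^ m)"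
  using assms
proof (induction Z)
  case (insert y Z)
  then have "coprime ([:- x, 1:] ^ m) ([:- y, 1:] ^ m)" by (intro coprime_linear_power) simp
  with insert show ?case
    by (simp del: coprime_power_left_iff coprime_power_right_iff)
qed simp

lemma prod_linear_power_dvd:
  fixes p :: "complex poly"
  assumes "finite Z" "\<And>z. z \<in> Z \<Longrightarrow> [:- z, 1:] ^ m dvd p"
  shows "(\<Prod>z\<in>Z. [:- z, 1:] ^ m) dvd p"
  using assms
proof (induction Z)
  case (insert x Z)
  then show ?case
    by (simp del: coprime_power_left_iff add: divides_mult coprime_prod_linear_power)
qed simp

text \<open>Chinese remainder theorem for the coprime moduli \<open>[:- z, 1:] ^ m\<close>.
  Prescribing constants modulo powers, and not merely values, makes the result usable for operators
  that are not diagonalisable.\<close>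

lemma poly_interpolation:
  fixes a :: "complex \<Rightarrow> complex"
  assumes "finite Z"
  shows "\<exists>p. \<forall>z\<in>Z. [:- z, 1:] ^ m dvd p - [:a z:]"
  using assms
proof (induction Z)
  case (insert x Z)
  then obtain p where p: "\<And>z. z \<in> Z \<Longrightarrow> [:- z, 1:] ^ m dvd p - [:a z:]" by blast
  define M where "M = (\<Prod>z\<in>Z. [:- z, 1:] ^ m)"
  have "coprime ([:- x, 1:] ^ m) M"
    unfolding M_def using insert by (intro coprime_prod_linear_power)
  then obtain u v where uv: "u * [:- x, 1:] ^ m + v * M = 1"
    using bezout_coefficients_fst_snd[of "[:- x, 1:] ^ m" M] unfolding coprime_iff_gcd_eq_1 by metis
  \<comment> \<open>The correction is a multiple of \<open>M\<close>, hence invisible modulo the old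
    moduli, and \<open>v * M\<close> is 1 modulo the new one.\<close>
  define q where "q = p + ([:a x:] - p) * v * M"
  have "q - [:a x:] = (p - [:a x:]) * (1 - v * M)" by (simp add: q_def algebra_simps)
  also have "1 - v * M = u * [:- x, 1:] ^ m" using uv by (simp add: algebra_simps)
  finally have "[:- x, 1:] ^ m dvd q - [:a x:]" by simp
  moreover have "[:- z, 1:] ^ m dvd q - [:a z:]" if "z \<in> Z" for z
  proof -
    have "[:- z, 1:] ^ m dvd M" unfolding M_def using insert.hyps that by (intro dvd_prodI)
    moreover have "q - [:a z:] = (p - [:a z:]) + ([:a x:] - p) * v * M" by (simp add: q_def)
    ultimately show ?thesis using p[OF that] by (metis dvd_add dvd_mult)
  qed
  ultimately show ?case by blast
qed auto

text \<open>A complex polynomial splits, and one exponent above its degree bounds all root orders.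
  The point 0 is put into \<open>Z\<close> even if it is no root, since interpolation at 0 is what
  yields polynomials without constant term.\<close>

lemma dvd_prod_root_power:
  fixes p :: "complex poly"
  assumes "p \<noteq> 0"
  shows "\<exists>Z m. finite Z \<and> 0 \<in> Z \<and> 0 < m \<and> p dvd (\<Prod>z\<in>Z. [:- z, 1:] ^ m)"
proof -
  define Z where "Z = insert 0 {z. poly p z = 0}"
  define m where "m = Suc (degree p)"
  have fin: "finite {z. poly p z = 0}" using assms by (rule poly_roots_finite)
  have "(\<Prod>z | poly p z = 0. [:- z, 1:] ^ order z p) dvd (\<Prod>z | poly p z = 0. [:- z, 1:] ^ m)"
    by (intro prod_dvd_prod le_imp_power_dvd) (use order_degree[OF assms] in \<open>auto simp: m_def le_SucI\<close>)
  also have "\<dots> dvd (\<Prod>z\<in>Z. [:- z, 1:] ^ m)"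
    unfolding Z_def using fin by (intro prod_dvd_prod_subset) auto
  finally have "smult (lead_coeff p) (\<Prod>z | poly p z = 0. [:- z, 1:] ^ order z p) dvd (\<Prod>z\<in>Z. [:- z, 1:] ^ m)"
    using assms by (subst smult_dvd_iff) auto
  then have "p dvd (\<Prod>z\<in>Z. [:- z, 1:] ^ m)" by (simp add: complex_poly_decompose)
  then show ?thesis using fin by (intro exI[of _ Z] exI[of _ m]) (auto simp: Z_def m_def)
qed

locale vec_endo = vector_space scale
  for scale :: "complex \<Rightarrow> 'v::ab_group_add \<Rightarrow> 'v" +
  fixes T :: "'v \<Rightarrow> 'v"
  assumes linear_T: "Vector_Spaces.linear scale scale T"
begin

sublocale T: Vector_Spaces.linear scale scale T by (rule linear_T)

text \<open>Horner's scheme for the polynomial \<open>p\<close> in the endomorphism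
  \<open>T\<close>, applied to \<open>v\<close>.\<close>

definition pev :: "complex poly \<Rightarrow> 'v \<Rightarrow> 'v" where
  "pev p v = fold_coeffs (\<lambda>c r. scale c v + T r) p 0"

lemma pev_0 [simp]: "pev 0 v = 0" by (simp add: pev_def)

lemma pev_pCons [simp]: "pev (pCons a p) v = scale a v + T (pev p v)"
  by (cases "a = 0 \<and> p = 0") (auto simp: pev_def fold_coeffs_pCons_not_0_0_eq T.zero)

lemma pev_1 [simp]: "pev 1 v = v" by (simp add: one_pCons T.zero)

lemma pev_add: "pev (p + q) v = pev p v + pev q v"
  by (induction p q rule: poly_induct2) (auto simp: scale_left_distrib T.add)

lemma pev_smult: "pev (smult c p) v = scale c (pev p v)"
  by (induction p) (auto simp: scale_right_distrib T.scale)

lemma pev_minus: "pev (- p) v = - pev p v"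
  using pev_smult[of "- 1" p v] by simp

lemma pev_diff: "pev (p - q) v = pev p v - pev q v"
  using pev_add[of p "- q" v] by (simp add: pev_minus)

lemma pev_mult: "pev (p * q) v = pev p (pev q v)"
  by (induction p) (auto simp: pev_add pev_smult T.zero)

lemma pev_sum: "pev (\<Sum>i\<in>I. f i) v = (\<Sum>i\<in>I. pev (f i) v)"
  by (induction I rule: infinite_finite_induct) (auto simp: pev_add)

lemma linear_pev: "Vector_Spaces.linear scale scale (pev p)"
proof (induction p)
  case 0
  show ?case by unfold_locales auto
next
  case (pCons a p)
  interpret p: Vector_Spaces.linear scale scale "pev p" by (rule pCons)
  show ?case
    by unfold_locales
      (auto simp: p.add p.scale T.add T.scale scale_right_distrib mult.commute)
qed

sublocale pev: Vector_Spaces.linear scale scale "pev p" for p by (rule linear_pev)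

lemma pev_in_subspace:
  assumes "subspace W" "\<And>w. w \<in> W \<Longrightarrow> T w \<in> W" "v \<in> W"
  shows "pev p v \<in> W"
  by (induction p) (use assms in \<open>auto simp: subspace_0 subspace_add subspace_scale\<close>)

lemma pev_power: "pev (p ^ n) v = (pev p ^^ n) v"
  by (induction n arbitrary: v) (auto simp: pev_mult)

lemma pev_X: "pev [:0, 1:] v = T v" by (simp add: T.zero)

lemma pev_linear_factor: "pev [:- z, 1:] v = T v - scale z v" by (simp add: T.zero)

lemma pev_dvd_zero: "p dvd q \<Longrightarrow> pev p v = 0 \<Longrightarrow> pev q v = 0"
  by (metis dvdE mult.commute pev_mult pev.zero)

lemma pev_hom:
  assumes "vec_endo scale' T'" "Vector_Spaces.linear scale scale' h" "\<And>v. h (T v) = T' (h v)"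
  shows "h (pev p v) = vec_endo.pev scale' T' p (h v)"
proof -
  interpret T': vec_endo scale' T' by fact
  interpret h: Vector_Spaces.linear scale scale' h by fact
  show ?thesis by (induction p) (auto simp: h.add h.scale h.zero assms(3))
qed

end

section \<open>Annihilating polynomials and the Fitting projection\<close>

context vector_space
begin

text \<open>One vector more than a spanning set has. Dependence is a property of sets, so a family
  with a repeated vector needs its own relation, with coefficients 1 and -1.\<close>

lemma family_dependent:
  assumes "finite b" "\<And>i. i \<le> card b \<Longrightarrow> v i \<in> span b"
  shows "\<exists>c :: nat \<Rightarrow> 'a. (\<exists>i\<le>card b. c i \<noteq> 0) \<and> (\<Sum>i\<le>card b. scale (c i) (v i)) = 0"
proof (cases "inj_on v {..card b}")
  case True
  have "dependent (v ` {..card b})"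
  proof (rule ccontr)
    assume "independent (v ` {..card b})"
    moreover have "v ` {..card b} \<subseteq> span b" using assms by auto
    ultimately have "card (v ` {..card b}) \<le> card b"
      using independent_span_bound[OF assms(1)] by blast
    then show False using card_image[OF True] by simp
  qed
  then obtain u w where u: "(\<Sum>x\<in>v ` {..card b}. scale (u x) x) = 0" "w \<in> v ` {..card b}" "u w \<noteq> 0"
    using dependent_finite[of "v ` {..card b}"] by auto
  then show ?thesis
    using True by (intro exI[of _ "u \<circ> v"]) (auto simp: sum.reindex)
next
  case False
  then obtain i j where ij: "i \<le> card b" "j \<le> card b" "i \<noteq> j" "v i = v j"
    by (auto simp: inj_on_def)
  define c :: "nat \<Rightarrow> 'a" where "c k = (if k = i then 1 else if k = j then - 1 else 0)" for k
  have "(\<Sum>k\<le>card b. scale (c k) (v k)) = (\<Sum>k\<in>{i, j}. scale (c k) (v k))"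
    by (rule sum.mono_neutral_right) (use ij in \<open>auto simp: c_def\<close>)
  also have "\<dots> = 0" using ij by (simp add: c_def)
  finally show ?thesis using ij by (intro exI[of _ c]) (auto simp: c_def)
qed

end

context vec_endo
begin

text \<open>Only the range of \<open>T\<close> is finite dimensional, not the whole space. The
  family therefore starts with \<open>T v\<close> instead of \<open>v\<close>, whence the exponents
  \<open>Suc i\<close>.\<close>

lemma ex_annihilator_vec:
  assumes "finite b" "\<And>w. T w \<in> span b"
  shows "\<exists>p. p \<noteq> 0 \<and> pev p v = 0"
proof -
  have *: "pev (monom 1 (Suc n)) v \<in> span b" for n
    using assms(2) by (simp add: monom_Suc)
  obtain c where c: "\<exists>i\<le>card b. c i \<noteq> 0"
      "(\<Sum>i\<le>card b. scale (c i) (pev (monom 1 (Suc i)) v)) = 0"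
    using family_dependent[OF assms(1), of "\<lambda>i. pev (monom 1 (Suc i)) v"] * by blast
  define p where "p = (\<Sum>i\<le>card b. monom (c i) (Suc i))"
  have "pev p v = (\<Sum>i\<le>card b. scale (c i) (pev (monom 1 (Suc i)) v))"
    unfolding p_def pev_sum by (simp flip: pev_smult add: smult_monom)
  moreover obtain i where "i \<le> card b" "c i \<noteq> 0" using c by blast
  then have "coeff p (Suc i) \<noteq> 0" by (simp add: p_def coeff_sum)
  ultimately show ?thesis using c(2) by (metis coeff_0)
qed

text \<open>The product of annihilators of the spanning vectors kills \<open>span b\<close>; one
  more factor \<open>[:0, 1:]\<close> first sends an arbitrary vector into that span.\<close>

lemma ex_annihilator:
  assumes b: "finite b" "\<And>w. T w \<in> span b"
  shows "\<exists>p. p \<noteq> 0 \<and> (\<forall>v. pev p v = 0)"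
proof -
  obtain q where q: "\<And>v. q v \<noteq> 0 \<and> pev (q v) v = 0"
    using ex_annihilator_vec[OF assms] by metis
  define p where "p = (\<Prod>u\<in>b. q u)"
  have zero: "pev p v = 0" if "v \<in> span b" for v
  proof (rule pev.eq_0_on_span[OF _ that])
    fix u assume "u \<in> b"
    then have "q u dvd p" unfolding p_def using b(1) by (rule dvd_prodI[rotated])
    then show "pev p u = 0" using pev_dvd_zero q by blast
  qed
  have "pev (p * [:0, 1:]) v = 0" for v
    unfolding pev_mult pev_X by (rule zero) (rule b)
  moreover have "p * [:0, 1:] \<noteq> 0" using q b(1) by (auto simp: p_def)
  ultimately show ?thesis by blast
qed

text \<open>In this form an identity between polynomials in \<open>T\<close> can be checked by
  divisibility at each point of \<open>Z\<close> separately.\<close>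

lemma ex_root_annihilator:
  assumes b: "finite b" "\<And>w. T w \<in> span b"
  shows "\<exists>Z m. finite Z \<and> 0 \<in> Z \<and> 0 < m \<and> (\<forall>p. (\<forall>z\<in>Z. [:- z, 1:] ^ m dvd p) \<longrightarrow> (\<forall>v. pev p v = 0))"
proof -
  obtain p where p: "p \<noteq> 0" "\<And>v. pev p v = 0" using ex_annihilator[OF assms] by blast
  obtain Z m where Z: "finite Z" "0 \<in> Z" "0 < m" "p dvd (\<Prod>z\<in>Z. [:- z, 1:] ^ m)"
    using dvd_prod_root_power[OF p(1)] by blast
  have "pev q v = 0" if "\<forall>z\<in>Z. [:- z, 1:] ^ m dvd q" for q v
  proof (rule pev_dvd_zero[OF dvd_trans[OF Z(4)] p(2)])
    show "(\<Prod>z\<in>Z. [:- z, 1:] ^ m) dvd q"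
      by (intro prod_linear_power_dvd[OF Z(1)] bspec[OF that])
  qed
  then show ?thesis using Z by blast
qed

text \<open>Take \<open>f\<close> congruent to 0 modulo the power at 0 and to 1 modulo the powers at
  the other points of \<open>Z\<close>: it evaluates to the projection onto the generalised
  eigenspaces of non-zero eigenvalues, along the part where \<open>T\<close> is nilpotent. The
  factor \<open>[:0, 1:]\<close> is displayed because the cofactor \<open>q\<close> is needed later.
  The set \<open>S\<close> admits both a whole space and the single vector 1 of an algebra.\<close>

lemma fitting_idempotent:
  assumes Z: "finite Z" "0 \<in> Z" "0 < m"
    and ann: "\<And>p v. \<forall>z\<in>Z. [:- z, 1:] ^ m dvd p \<Longrightarrow> v \<in> S \<Longrightarrow> pev p v = 0"
  shows "\<exists>q n. \<forall>v\<in>S. pev (q * [:0, 1:]) (pev (q * [:0, 1:]) v) = pev (q * [:0, 1:]) v \<and>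
    (pev (q * [:0, 1:]) v = 0 \<longrightarrow> (T ^^ n) v = 0)"
proof -
  obtain f where f: "\<And>z. z \<in> Z \<Longrightarrow> [:- z, 1:] ^ m dvd f - [:if z = 0 then 0 else 1:]"
    using poly_interpolation[OF Z(1), of m "\<lambda>z. if z = 0 then 0 else 1"] by blast
  have f0: "[:0, 1:] ^ m dvd f" using f[OF Z(2)] by simp
  have "[:0, 1:] dvd f" using f0 Z(3) by (metis dvd_power dvd_trans)
  then obtain q where q: "f = q * [:0, 1:]" by (metis dvdE mult.commute)
  have "[:- z, 1:] ^ m dvd f * f - f" if "z \<in> Z" for z
  proof (cases "z = 0")
    case False
    have "[:- z, 1:] ^ m dvd f - [:1:]" using f[OF that] False by (simp only: if_False)
    then have "[:- z, 1:] ^ m dvd f * (f - [:1:])" by (rule dvd_mult)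
    also have "f * (f - [:1:]) = f * f - f" by (simp add: right_diff_distrib)
    finally show ?thesis .
  next
    case True
    have "[:0, 1:] ^ m dvd f * (f - 1)" using f0 by (rule dvd_mult2)
    then show ?thesis using True by (simp only: right_diff_distrib mult_1_right minus_zero)
  qed
  then have "pev (f * f - f) v = 0" if "v \<in> S" for v by (intro ann that) blast
  then have "\<forall>v\<in>S. pev f (pev f v) = pev f v" by (simp add: pev_diff pev_mult)
  moreover have "(T ^^ m) v = 0" if v: "v \<in> S" and z: "pev f v = 0" for v
  proof -
    have "[:- z, 1:] ^ m dvd [:0, 1:] ^ m * (1 - f)" if "z \<in> Z" for z
    proof (cases "z = 0")
      case False
      have "[:- z, 1:] ^ m dvd f - 1" using f[OF that] False by (simp only: if_False one_pCons)
      then have "[:- z, 1:] ^ m dvd 1 - f" by (simp only: dvd_diff_commute)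
      then show ?thesis by (rule dvd_mult)
    next
      case True
      then show ?thesis by (simp only: minus_zero dvd_triv_left)
    qed
    then have "pev ([:0, 1:] ^ m * (1 - f)) v = 0" by (intro ann v) blast
    then have "pev ([:0, 1:] ^ m) v = 0"
      using z by (simp add: pev_mult pev_diff)
    moreover have "pev [:0, 1:] = T" by (rule ext) (rule pev_X)
    ultimately show ?thesis by (simp add: pev_power)
  qed
  ultimately show ?thesis unfolding q by blast
qed

end

section \<open>Traces\<close>

locale complex_space = vector_space scale
  for scale :: "complex \<Rightarrow> 'v::ab_group_add \<Rightarrow> 'v"
begin

text \<open>The trace of the endomorphism that \<open>f\<close> induces on \<open>span b\<close>.
  The ambient space need not be finite dimensional, so the basis is an argument.\<close>

definition trace_on :: "'v set \<Rightarrow> ('v \<Rightarrow> 'v) \<Rightarrow> complex" where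
  "trace_on b f = (\<Sum>u\<in>b. representation b (f u) u)"

lemma representation_linear_sum:
  assumes "independent b" "\<And>i. i \<in> I \<Longrightarrow> v i \<in> span b"
  shows "representation b (\<Sum>i\<in>I. scale (c i) (v i)) u = (\<Sum>i\<in>I. c i * representation b (v i) u)"
  using assms
  by (subst representation_sum) (auto simp: representation_scale span_scale)

lemma trace_on_add:
  assumes "independent b" "\<And>u. u \<in> b \<Longrightarrow> f u \<in> span b" "\<And>u. u \<in> b \<Longrightarrow> g u \<in> span b"
  shows "trace_on b (\<lambda>x. f x + g x) = trace_on b f + trace_on b g"
  using assms by (simp add: trace_on_def representation_add sum.distrib)

lemma trace_on_scale:
  assumes "independent b" "\<And>u. u \<in> b \<Longrightarrow> f u \<in> span b"
  shows "trace_on b (\<lambda>x. scale c (f x)) = c * trace_on b f"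
  using assms by (simp add: trace_on_def representation_scale sum_distrib_left)

text \<open>Both traces are the same double sum of products of matrix coefficients. Allowing two
  different spaces also covers restriction to an image, where one of the maps is an
  inclusion.\<close>

lemma trace_on_rectangular:
  assumes b: "finite b" "independent b" and b': "finite b'" "independent b'"
    and f: "Vector_Spaces.linear scale scale f" "\<And>u. u \<in> b \<Longrightarrow> f u \<in> span b'"
    and g: "Vector_Spaces.linear scale scale g" "\<And>u. u \<in> b' \<Longrightarrow> g u \<in> span b"
  shows "trace_on b (\<lambda>x. g (f x)) = trace_on b' (\<lambda>x. f (g x))"
proof -
  interpret f: Vector_Spaces.linear scale scale f by (rule f)
  interpret g: Vector_Spaces.linear scale scale g by (rule g)
  have f_eq: "f x = (\<Sum>u\<in>b'. scale (representation b' (f x) u) u)" if "x \<in> b" for x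
    using sum_representation_eq[OF b'(2) f(2)[OF that] b'(1)] by simp
  have g_eq: "g x = (\<Sum>u\<in>b. scale (representation b (g x) u) u)" if "x \<in> b'" for x
    using sum_representation_eq[OF b(2) g(2)[OF that] b(1)] by simp
  have "representation b (g (f x)) x = (\<Sum>u\<in>b'. representation b' (f x) u * representation b (g u) x)"
    if "x \<in> b" for x
    by (subst f_eq[OF that]) (simp add: g.sum g.scale representation_linear_sum b g)
  moreover have "representation b' (f (g x)) x = (\<Sum>u\<in>b. representation b (g x) u * representation b' (f u) x)"
    if "x \<in> b'" for x
    by (subst g_eq[OF that]) (simp add: f.sum f.scale representation_linear_sum b' f)
  ultimately show ?thesis
    by (simp add: trace_on_def) (subst sum.swap, simp add: mult.commute)
qed

lemma basis_image_exists:
  assumes b: "finite b" and f: "Vector_Spaces.linear scale scale f" "\<And>v. v \<in> span b \<Longrightarrow> f v \<in> span b"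
  shows "\<exists>b'. finite b' \<and> independent b' \<and> span b' = f ` span b \<and> card b' \<le> card b"
proof -
  interpret f: Vector_Spaces.linear scale scale f by (rule f)
  obtain b' where b': "b' \<subseteq> f ` span b" "independent b'" "f ` span b \<subseteq> span b'"
    by (rule maximal_independent_subset)
  have "finite b' \<and> card b' \<le> card b"
    using b' f(2) by (intro independent_span_bound[OF b]) auto
  moreover have "span b' = f ` span b"
    using b' f.subspace_image[OF subspace_span] by (simp add: span_minimal subset_antisym)
  ultimately show ?thesis using b' by blast
qed

text \<open>Factor \<open>f\<close> as a map onto its image followed by the inclusion, and exchange
  the two factors.\<close>

lemma trace_on_image:
  assumes b: "finite b" "independent b"
    and f: "Vector_Spaces.linear scale scale f" "\<And>v. v \<in> span b \<Longrightarrow> f v \<in> span b"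
    and b': "finite b'" "independent b'" "span b' = f ` span b"
  shows "trace_on b f = trace_on b' f"
proof -
  have "trace_on b (\<lambda>x. (\<lambda>y. y) (f x)) = trace_on b' (\<lambda>x. f ((\<lambda>y. y) x))"
  proof (rule trace_on_rectangular[OF b b'(1,2) f(1)])
    show "f u \<in> span b'" if "u \<in> b" for u unfolding b'(3) using span_base[OF that] by (rule imageI)
    show "u \<in> span b" if "u \<in> b'" for u using span_base[OF that] f(2) unfolding b'(3) by auto
    show "Vector_Spaces.linear scale scale (\<lambda>y. y)" by unfold_locales auto
  qed
  then show ?thesis by simp
qed

text \<open>Passing to the image keeps the trace and lowers the nilpotency exponent by one.\<close>

lemma trace_on_nilpotent:
  assumes "finite b" "independent b"
    and "Vector_Spaces.linear scale scale f" "\<And>v. v \<in> span b \<Longrightarrow> f v \<in> span b"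
    and "\<And>v. v \<in> span b \<Longrightarrow> (f ^^ n) v = 0"
  shows "trace_on b f = 0"
  using assms
proof (induction n arbitrary: b)
  case 0
  then have "b \<subseteq> {0}" using span_base by auto
  then have "b = {}" using 0 dependent_zero by auto
  then show ?case by (simp add: trace_on_def)
next
  case (Suc n)
  obtain b' where b': "finite b'" "independent b'" "span b' = f ` span b"
    using basis_image_exists[OF Suc.prems(1,3,4)] by blast
  have "trace_on b' f = 0"
    using Suc.prems b' by (intro Suc.IH) (auto simp del: funpow.simps simp: funpow_Suc_right)
  then show ?case using trace_on_image[OF Suc.prems(1-4) b'] by simp
qed

text \<open>On its image an idempotent is the identity, so \<open>n\<close> is the dimension of the
  image. Characteristic 0 lets the trace detect whether it vanishes.\<close>

lemma trace_on_idempotent: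
  assumes b: "finite b" "independent b"
    and f: "Vector_Spaces.linear scale scale f" "\<And>v. v \<in> span b \<Longrightarrow> f v \<in> span b"
    and idem: "\<And>v. v \<in> span b \<Longrightarrow> f (f v) = f v"
  shows "\<exists>n\<le>card b. trace_on b f = of_nat n \<and> (n = 0 \<longrightarrow> (\<forall>v\<in>span b. f v = 0))"
proof -
  obtain b' where b': "finite b'" "independent b'" "span b' = f ` span b" "card b' \<le> card b"
    using basis_image_exists[OF b(1) f] by blast
  have "f u = u" if "u \<in> b'" for u
    using that b'(3) idem span_base[OF that] by auto
  then have "trace_on b' f = of_nat (card b')"
    using b' by (simp add: trace_on_def representation_basis)
  moreover have "\<forall>v\<in>span b. f v = 0" if "card b' = 0"
    using that b' by auto
  ultimately show ?thesis using trace_on_image[OF b f b'(1-3)] b'(4) by auto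
qed

end

section \<open>Algebras with a trace\<close>

text \<open>Both \<open>A w\<close> and \<open>C w\<close> satisfy the hypotheses with one exponent
  lowered, so an induction on \<open>i + j\<close> replaces the binomial expansion.\<close>

lemma commuting_difference_power:
  fixes A C :: "'v::ab_group_add \<Rightarrow> 'v"
  assumes add: "\<And>u v. A (u - v) = A u - A v" "\<And>u v. C (u - v) = C u - C v"
    and comm: "\<And>u. A (C u) = C (A u)"
    and "(A ^^ i) w = 0" "(C ^^ j) w = 0"
  shows "((\<lambda>u. A u - C u) ^^ (i + j)) w = 0"
proof -
  define D where "D u = A u - C u" for u
  have D_diff: "(D ^^ n) (u - v) = (D ^^ n) u - (D ^^ n) v" for n u v
    by (induction n) (auto simp: D_def add)
  have D0: "(D ^^ n) 0 = 0" for n using D_diff[of n 0 0] by simp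
  have AC: "(A ^^ n) (C u) = C ((A ^^ n) u)" and CA: "(C ^^ n) (A u) = A ((C ^^ n) u)" for n u
    by (induction n) (auto simp: comm)
  have zero: "A 0 = 0" "C 0 = 0" using add[of 0 0] by auto
  have "(D ^^ k) w = 0" if "i + j = k" "(A ^^ i) w = 0" "(C ^^ j) w = 0" for k
    using that
  proof (induction k arbitrary: i j w)
    case (Suc k)
    show ?case
    proof (cases "i = 0 \<or> j = 0")
      case True
      then have "w = 0" using Suc.prems by auto
      then show ?thesis by (simp only: D0)
    next
      case False
      then obtain i' j' where ij: "i = Suc i'" "j = Suc j'" by (auto simp: gr0_conv_Suc)
      have "(D ^^ k) (A w) = 0"
        using Suc.prems ij by (intro Suc.IH[of i' j]) (auto simp: CA zero comm[symmetric] simp del: funpow.simps(2) simp: funpow_Suc_right)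
      moreover have "(D ^^ k) (C w) = 0"
        using Suc.prems ij by (intro Suc.IH[of i j']) (auto simp: AC zero comm simp del: funpow.simps(2) simp: funpow_Suc_right)
      ultimately have "(D ^^ k) (A w - C w) = 0" by (simp add: D_diff)
      then show ?thesis by (simp add: funpow_Suc_right D_def[of w] del: funpow.simps(2))
    qed
  qed auto
  then show ?thesis using assms(4,5) by (simp add: D_def[abs_def])
qed

locale complex_algebra = complex_space smult
  for smult :: "complex \<Rightarrow> 'r::ring_1 \<Rightarrow> 'r" +
  assumes smult_mult_left [simp]: "smult c a * b = smult c (a * b)"
    and smult_mult_right [simp]: "a * smult c b = smult c (a * b)"
begin

lemma vec_endo_left: "vec_endo smult ((*) a)"
  by unfold_locales (auto simp: algebra_simps)

lemma vec_endo_ad: "vec_endo smult (\<lambda>b. X * b - b * X)"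
  by unfold_locales (auto simp: algebra_simps scale_right_diff_distrib)

end

text \<open>An abstract version of the endomorphisms of a space of dimension \<open>N\<close>, as a
  subalgebra \<open>K\<close> that need not contain the unit of the ring. Only polynomials without
  constant term are therefore sure to stay in \<open>K\<close>.\<close>

locale trace_algebra = complex_algebra smult
  for smult :: "complex \<Rightarrow> 'r::ring_1 \<Rightarrow> 'r" +
  fixes K :: "'r set" and tr :: "'r \<Rightarrow> complex" and N :: nat
  assumes K_subspace: "subspace K"
    and K_mult: "a \<in> K \<Longrightarrow> b \<in> K \<Longrightarrow> a * b \<in> K"
    and K_algebraic: "a \<in> K \<Longrightarrow> \<exists>Z m. finite Z \<and> 0 \<in> Z \<and> 0 < m \<and>
          (\<forall>p. (\<forall>z\<in>Z. [:- z, 1:] ^ m dvd p) \<longrightarrow> vec_endo.pev smult ((*) a) p 1 = 0)"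
    and tr_add: "a \<in> K \<Longrightarrow> b \<in> K \<Longrightarrow> tr (a + b) = tr a + tr b"
    and tr_smult: "a \<in> K \<Longrightarrow> tr (smult c a) = c * tr a"
    and tr_comm: "a \<in> K \<Longrightarrow> b \<in> K \<Longrightarrow> tr (a * b) = tr (b * a)"
    and tr_nilpotent: "a \<in> K \<Longrightarrow> a ^ n = 0 \<Longrightarrow> tr a = 0"
    and tr_idempotent: "a \<in> K \<Longrightarrow> a * a = a \<Longrightarrow> \<exists>n\<le>N. tr a = of_nat n \<and> (n = 0 \<longrightarrow> a = 0)"
begin

sublocale left: vec_endo smult "(*) a" for a by (rule vec_endo_left)

abbreviation rp :: "complex poly \<Rightarrow> 'r \<Rightarrow> 'r" where
  "rp p a \<equiv> left.pev a p 1"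

lemma left_pev: "left.pev a p b = rp p a * b"
  by (induction p) (auto simp: algebra_simps)

lemma rp_mult: "rp (p * q) a = rp p a * rp q a"
  by (simp add: left.pev_mult left_pev[of a p "left.pev a q 1"])

lemma rp_power: "rp (p ^ n) a = rp p a ^ n"
  by (induction n) (simp_all add: rp_mult)

lemma rp_commutes:
  assumes "a * b = b * a"
  shows "rp p a * b = b * rp p a"
proof (induction p)
  case (pCons c p)
  have "a * rp p a * b = b * (a * rp p a)"
    by (metis assms mult.assoc pCons.IH)
  then show ?case by (simp add: distrib_left distrib_right)
qed simp

lemma rp_in_K:
  assumes "a \<in> K" "[:0, 1:] dvd p"
  shows "rp p a \<in> K"
proof -
  have "a * rp q a \<in> K" for q
  proof (induction q)
    case 0
    show ?case using K_subspace subspace_0 by simp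
  next
    case (pCons c q)
    have "smult c a + a * (a * rp q a) \<in> K"
      using assms(1) pCons.IH K_mult K_subspace by (intro subspace_add subspace_scale) auto
    then show ?case by (simp add: distrib_left)
  qed
  moreover obtain q where "p = [:0, 1:] * q" using assms(2) by (elim dvdE)
  ultimately show ?thesis by simp
qed

lemma K_fitting:
  assumes "a \<in> K"
  shows "\<exists>q. rp (q * [:0, 1:]) a * rp (q * [:0, 1:]) a = rp (q * [:0, 1:]) a \<and>
    (rp (q * [:0, 1:]) a = 0 \<longrightarrow> (\<exists>n. a ^ n = 0))"
proof -
  obtain Z m where Z: "finite Z" "0 \<in> Z" "0 < m"
    and ann: "\<forall>p. (\<forall>z\<in>Z. [:- z, 1:] ^ m dvd p) \<longrightarrow> rp p a = 0"
    using K_algebraic[OF assms] by (elim exE conjE) (rule that)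
  have "((*) a ^^ n) 1 = a ^ n" for n by (induction n) auto
  moreover have "\<exists>q n. \<forall>v\<in>{1}. left.pev a (q * [:0, 1:]) (left.pev a (q * [:0, 1:]) v) = left.pev a (q * [:0, 1:]) v \<and>
      (left.pev a (q * [:0, 1:]) v = 0 \<longrightarrow> ((*) a ^^ n) v = 0)"
    by (rule left.fitting_idempotent[OF Z]) (use ann in \<open>simp only: singleton_iff\<close>)
  ultimately show ?thesis using left_pev by (metis singletonI)
qed

lemma tr_0 [simp]: "tr 0 = 0"
  using tr_nilpotent[of 0 1] K_subspace subspace_0 by simp

lemma tr_diff: "a \<in> K \<Longrightarrow> b \<in> K \<Longrightarrow> tr (a - b) = tr a - tr b"
  using tr_add[of a "smult (-1) b"] tr_smult[of b "-1"] K_subspace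
  by (simp add: subspace_neg)

lemma tr_sum: "(\<And>i. i \<in> I \<Longrightarrow> f i \<in> K) \<Longrightarrow> tr (\<Sum>i\<in>I. f i) = (\<Sum>i\<in>I. tr (f i))"
proof (induction I rule: infinite_finite_induct)
  case (insert i I)
  then show ?case using K_subspace by (simp add: tr_add subspace_sum)
qed auto

text \<open>
  The element \<open>Y\<close> with the complex conjugates of the eigenvalues of \<open>X\<close> normalises \<open>L\<close>, because
  \<open>ad Y\<close> is a polynomial in \<open>ad X\<close>; and \<open>tr (X * Y)\<close> is the sum of the squared absolute values of
  the eigenvalues.
\<close>

lemma nilpotent_if_orthogonal_to_normaliser:
  assumes L: "subspace L" and XK: "X \<in> K"
    and XL: "\<And>b. b \<in> L \<Longrightarrow> X * b - b * X \<in> L"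
    and orth: "\<And>Y. Y \<in> K \<Longrightarrow> (\<And>b. b \<in> L \<Longrightarrow> Y * b - b * Y \<in> L) \<Longrightarrow> tr (X * Y) = 0"
  shows "\<exists>n. X ^ n = 0"
proof -
  obtain Z m where Z: "finite Z" "0 \<in> Z" "0 < m"
    and ann': "\<forall>p. (\<forall>z\<in>Z. [:- z, 1:] ^ m dvd p) \<longrightarrow> rp p X = 0"
    using K_algebraic[OF XK] by (elim exE conjE) (rule that)
  have ann: "rp p X = 0" if "\<And>z. z \<in> Z \<Longrightarrow> [:- z, 1:] ^ m dvd p" for p
    using that by (intro ann'[rule_format])
  have "\<forall>w :: complex. \<exists>e. \<forall>z\<in>Z. [:- z, 1:] ^ m dvd e - [:if z = w then 1 else 0:]"
    by (intro allI poly_interpolation[OF Z(1)])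
  from choice[OF this] obtain e :: "complex \<Rightarrow> complex poly"
    where e: "\<And>w z. z \<in> Z \<Longrightarrow> [:- z, 1:] ^ m dvd e w - [:if z = w then 1 else 0:]" by blast
  obtain y where y: "\<And>z. z \<in> Z \<Longrightarrow> [:- z, 1:] ^ m dvd y - [:cnj z:]"
    using poly_interpolation[OF Z(1), of m cnj] by blast
  \<comment> \<open>\<open>E w\<close> is the projection onto the generalised eigenspace of
    \<open>X\<close> for \<open>w\<close>; \<open>Y\<close> acts on it as the scalar
    \<open>cnj w\<close>.\<close>
  define E where "E w = rp (e w) X" for w
  define Y where "Y = rp y X"
  have e1: "[:- z, 1:] ^ m dvd e z - 1" if "z \<in> Z" for z
    using e[OF that, of z] by (simp add: one_pCons)
  have e0: "[:- z, 1:] ^ m dvd e w" if "z \<in> Z" "z \<noteq> w" for z w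
    using e[OF that(1), of w] that(2) by simp
  have factor: "[:- z, 1:] dvd p" if "[:- z, 1:] ^ m dvd p" for z :: complex and p
    using that Z(3) dvd_power dvd_trans by blast
  have E_sum: "(\<Sum>w\<in>Z. E w) = 1"
  proof -
    have "rp ((\<Sum>w\<in>Z. e w) - 1) X = 0"
    proof (rule ann)
      fix z assume z: "z \<in> Z"
      have "(\<Sum>w\<in>Z. e w) - 1 = (e z - 1) + (\<Sum>w\<in>Z - {z}. e w)"
        using Z(1) z by (simp add: sum.remove)
      moreover have "[:- z, 1:] ^ m dvd (\<Sum>w\<in>Z - {z}. e w)" using e0 z by (intro dvd_sum) auto
      ultimately show "[:- z, 1:] ^ m dvd (\<Sum>w\<in>Z. e w) - 1" using e1[OF z] by (metis dvd_add)
    qed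
    then show ?thesis by (simp add: E_def left.pev_diff left.pev_sum)
  qed
  have E_nil: "(X - smult w 1) ^ m * E w = 0" if "w \<in> Z" for w
  proof -
    have "rp ([:- w, 1:] ^ m * e w) X = 0"
      using e0 by (intro ann) (metis dvd_mult dvd_triv_left)
    then show ?thesis by (simp add: rp_mult rp_power E_def left.pev_linear_factor)
  qed
  have E_idem: "E w * E w = E w" if "w \<in> Z" for w
  proof -
    have "rp (e w * (e w - 1)) X = 0"
      using e0 e1 by (intro ann) (metis dvd_mult dvd_mult2)
    then show ?thesis by (simp add: rp_mult E_def left.pev_diff algebra_simps)
  qed
  have YE: "Y * E w = smult (cnj w) (E w)" if "w \<in> Z" for w
  proof -
    have "rp ((y - [:cnj w:]) * e w) X = 0"
      using e0 y by (intro ann) (metis dvd_mult dvd_mult2)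
    then show ?thesis by (simp add: rp_mult E_def Y_def left.pev_diff left.pev_smult algebra_simps)
  qed
  have comm: "rp p X * X = X * rp p X" for p by (rule rp_commutes) simp
  have EY: "E w * Y = Y * E w" for w
    unfolding E_def Y_def by (intro rp_commutes comm[symmetric])
  have EXm: "E w * (X - smult w 1) ^ m = (X - smult w 1) ^ m * E w" for w
  proof -
    have "E w * (X - smult w 1) = (X - smult w 1) * E w"
      by (simp add: algebra_simps E_def comm)
    then show ?thesis by (induction m) (simp_all, metis mult.assoc)
  qed
  \<comment> \<open>As \<open>cnj 0 = 0\<close>, the polynomial \<open>y\<close> has no constant
    term.\<close>
  have YK: "Y \<in> K"
  proof -
    have "[:- 0, 1:] dvd y - [:cnj 0:]" by (intro factor y Z)
    then show ?thesis unfolding Y_def by (intro rp_in_K XK) simp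
  qed
  have EK: "E w \<in> K" if "w \<noteq> 0" for w
    using factor[OF e0[OF Z(2), of w]] that unfolding E_def by (intro rp_in_K XK) auto
  interpret ad: vec_endo smult "\<lambda>b. X * b - b * X" by (rule vec_endo_ad)
  \<comment> \<open>\<open>V\<close> contains the eigenvalues of \<open>ad X\<close>. Conjugation is
    additive, so \<open>cnj z - cnj w\<close> depends only on \<open>z - w\<close>, and one
    polynomial \<open>p\<close> turns \<open>ad X\<close> into \<open>ad Y\<close>. The exponent
    \<open>m + m\<close> collects the nilpotent parts of left and right multiplication.\<close>
  define V where "V = (\<lambda>(z, w). z - w) ` (Z \<times> Z)"
  obtain p where p: "\<And>v. v \<in> V \<Longrightarrow> [:- v, 1:] ^ (m + m) dvd p - [:cnj v:]"
    using poly_interpolation[of V "m + m" cnj] Z(1) unfolding V_def by blast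
  have pev_E: "ad.pev p (E z * b * E w) = smult (cnj (z - w)) (E z * b * E w)"
    if zw: "z \<in> Z" "w \<in> Z" for z w b
  proof -
    let ?u = "E z * b * E w"
    define A where "A = (\<lambda>u. (X - smult z 1) * u)"
    define C where "C = (\<lambda>u. u * (X - smult w 1))"
    have "(A ^^ n) u = (X - smult z 1) ^ n * u" for n u
      by (induction n) (auto simp: A_def mult.assoc)
    moreover have "(C ^^ n) u = u * (X - smult w 1) ^ n" for n u
      by (induction n) (auto simp: C_def mult.assoc power_commutes)
    ultimately have "(A ^^ m) ?u = 0" "(C ^^ m) ?u = 0"
      using E_nil zw EXm[of w] by (auto simp: mult.assoc) (simp flip: mult.assoc)
    then have "((\<lambda>u. A u - C u) ^^ (m + m)) ?u = 0"
      by (intro commuting_difference_power) (auto simp: A_def C_def algebra_simps)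
    moreover have "(\<lambda>u. A u - C u) = ad.pev [:- (z - w), 1:]"
      by (rule ext) (simp add: ad.pev_linear_factor A_def C_def algebra_simps scale_left_diff_distrib)
    ultimately have "ad.pev ([:- (z - w), 1:] ^ (m + m)) ?u = 0" by (simp add: ad.pev_power)
    then have "ad.pev (p - [:cnj (z - w):]) ?u = 0"
      by (rule ad.pev_dvd_zero[rotated]) (use zw in \<open>intro p, auto simp: V_def\<close>)
    then show ?thesis by (simp add: ad.pev_diff)
  qed
  have "Y * b - b * Y \<in> L" if b: "b \<in> L" for b
  proof -
    have b_eq: "b = (\<Sum>z\<in>Z. \<Sum>w\<in>Z. E z * b * E w)"
      by (simp flip: sum_distrib_left sum_distrib_right add: E_sum)
    have "ad.pev p b = (\<Sum>z\<in>Z. \<Sum>w\<in>Z. smult (cnj (z - w)) (E z * b * E w))"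
      by (subst b_eq) (simp add: ad.pev.sum pev_E)
    also have "\<dots> = (\<Sum>z\<in>Z. \<Sum>w\<in>Z. Y * E z * b * E w - E z * b * (E w * Y))"
      by (intro sum.cong refl) (simp add: YE EY scale_left_diff_distrib)
    also have "\<dots> = Y * (\<Sum>z\<in>Z. \<Sum>w\<in>Z. E z * b * E w) - (\<Sum>z\<in>Z. \<Sum>w\<in>Z. E z * b * E w) * Y"
      by (simp add: sum_subtractf sum_distrib_left sum_distrib_right mult.assoc)
    also have "\<dots> = Y * b - b * Y" by (simp flip: b_eq)
    finally show ?thesis
      using ad.pev_in_subspace[OF L XL b, of p] by simp
  qed
  then have XY: "tr (X * Y) = 0" using YK by (intro orth)
  \<comment> \<open>\<open>S\<close> is the semisimple part of \<open>X * Y\<close>, with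
    eigenvalues \<open>w * cnj w\<close>. The index 0 contributes nothing and is left out because
    \<open>E 0\<close> need not lie in \<open>K\<close>.\<close>
  define S where "S = (\<Sum>w\<in>Z - {0}. smult (w * cnj w) (E w))"
  have SK: "S \<in> K" unfolding S_def
    using K_subspace EK by (intro subspace_sum subspace_scale) auto
  have "(X * Y - S) ^ m = 0"
  proof -
    define r where "r = [:0, 1:] * y - (\<Sum>w\<in>Z - {0}. Polynomial.smult (w * cnj w) (e w))"
    have r0: "poly r z = 0" if "z \<in> Z" for z
    proof -
      have yz: "poly y z = cnj z" using factor[OF y[OF that]] by (simp add: poly_eq_0_iff_dvd[symmetric])
      have ez: "poly (e w) z = (if z = w then 1 else 0)" for w
        using factor[OF e[OF that, of w]] by (simp add: poly_eq_0_iff_dvd[symmetric])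
      have "(\<Sum>w\<in>Z - {0}. w * cnj w * poly (e w) z) = (\<Sum>w\<in>Z - {0}. if w = z then z * cnj z else 0)"
        by (intro sum.cong) (auto simp: ez)
      also have "\<dots> = z * cnj z" using Z(1) that by (simp add: sum.delta)
      finally show ?thesis by (simp add: r_def yz poly_sum)
    qed
    have "rp (r ^ m) X = 0"
    proof (rule ann)
      fix z assume "z \<in> Z"
      then have "[:- z, 1:] dvd r" using r0 by (simp add: poly_eq_0_iff_dvd)
      then show "[:- z, 1:] ^ m dvd r ^ m" by (rule dvd_power_same)
    qed
    moreover have "rp r X = X * Y - S"
      by (simp add: r_def S_def E_def Y_def left.pev_diff left.pev_sum left.pev_smult)
    ultimately show ?thesis by (simp add: rp_power)
  qed
  then have "tr (X * Y - S) = 0"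
    using XK YK K_mult SK K_subspace by (intro tr_nilpotent[of _ m]) (auto intro: subspace_diff)
  then have "tr S = 0" using XY SK XK YK K_mult by (simp add: tr_diff)
  moreover have "tr S = (\<Sum>w\<in>Z - {0}. w * cnj w * tr (E w))"
    unfolding S_def using EK K_subspace
    by (subst tr_sum) (auto simp: tr_smult intro: subspace_scale)
  moreover have "\<exists>n. \<forall>w\<in>Z - {0}. tr (E w) = of_nat (n w) \<and> (n w = 0 \<longrightarrow> E w = 0)"
    using tr_idempotent[OF EK E_idem] by (intro bchoice) blast
  then obtain n where n: "\<And>w. w \<in> Z - {0} \<Longrightarrow> tr (E w) = of_nat (n w) \<and> (n w = 0 \<longrightarrow> E w = 0)"
    by blast
  ultimately have "(\<Sum>w\<in>Z - {0}. w * cnj w * of_nat (n w)) = 0" by simp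
  then have "complex_of_real (\<Sum>w\<in>Z - {0}. (cmod w)\<^sup>2 * real (n w)) = 0"
    by (simp add: complex_mult_cnj cmod_power2)
  then have "(\<Sum>w\<in>Z - {0}. (cmod w)\<^sup>2 * real (n w)) = 0" unfolding of_real_eq_0_iff .
  then have "\<forall>w\<in>Z - {0}. (cmod w)\<^sup>2 * real (n w) = 0"
    using Z(1) by (subst (asm) sum_nonneg_eq_0_iff) auto
  then have "E w = 0" if "w \<in> Z - {0}" for w using n[OF that] that by force
  then have "E 0 = 1" using E_sum Z(1,2) by (simp add: sum.remove)
  then have "X ^ m = 0" using E_nil[OF Z(2)] by simp
  then show ?thesis by blast
qed

end

section \<open>Engel's theorem\<close>

definition words :: "'r::monoid_mult set \<Rightarrow> nat \<Rightarrow> 'r set" where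
  "words H n = {prod_list xs |xs. set xs \<subseteq> H \<and> length xs = n}"

lemma words_0: "words H 0 = {1}"
  by (auto simp: words_def)

lemma words_Suc: "words H (Suc n) = {h * u |h u. h \<in> H \<and> u \<in> words H n}"
proof (intro set_eqI iffI)
  fix u assume "u \<in> words H (Suc n)"
  then show "u \<in> {h * u |h u. h \<in> H \<and> u \<in> words H n}"
    unfolding words_def length_Suc_conv by fastforce
next
  fix u assume "u \<in> {h * u |h u. h \<in> H \<and> u \<in> words H n}"
  then obtain h xs where "u = prod_list (h # xs)" "set (h # xs) \<subseteq> H" "length (h # xs) = Suc n"
    by (auto simp: words_def)
  then show "u \<in> words H (Suc n)" unfolding words_def by blast
qed

lemma words_mult: "u \<in> words H m \<Longrightarrow> v \<in> words H n \<Longrightarrow> u * v \<in> words H (m + n)"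
  by (auto simp: words_def) (metis Un_least length_append prod_list.append set_append)

lemma words_addE:
  assumes "u \<in> words H (m + n)"
  obtains v w where "v \<in> words H m" "w \<in> words H n" "u = v * w"
proof -
  obtain xs where xs: "u = prod_list xs" "set xs \<subseteq> H" "length xs = m + n"
    using assms by (auto simp: words_def)
  have "u = prod_list (take m xs) * prod_list (drop m xs)"
    unfolding xs(1) by (metis append_take_drop_id prod_list.append)
  moreover have "set (take m xs) \<subseteq> H" "set (drop m xs) \<subseteq> H"
    using xs(2) set_take_subset[of m xs] set_drop_subset[of m xs] by blast+
  ultimately show ?thesis using xs(3) by (intro that) (auto simp: words_def)
qed

lemma words_zero_mono:
  fixes H :: "'r::ring_1 set"
  assumes "words H m \<subseteq> {0}" "m \<le> n"
  shows "words H n \<subseteq> {0}"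
proof
  fix u assume "u \<in> words H n"
  then obtain v w where "v \<in> words H m" "u = v * w"
    using assms(2) by (metis le_add_diff_inverse words_addE)
  then show "u \<in> {0}" using assms(1) by auto
qed

context complex_algebra
begin

text \<open>Otherwise every element of \<open>L - H\<close> could be bracketed with some element of
  \<open>H\<close> without entering \<open>H\<close>. Starting from \<open>z\<close>, after
  \<open>n\<close> brackets one has a combination of products \<open>u * z * v\<close> with
  \<open>u\<close>, \<open>v\<close> words of total length \<open>n\<close>. For
  \<open>n = m + m\<close> one of the two words has length at least \<open>m\<close>, so the
  combination is 0, which lies in \<open>H\<close>.\<close>

lemma ex_outside_normaliser:
  fixes H L :: "'r set"
  assumes L: "\<And>a b. a \<in> H \<Longrightarrow> b \<in> L \<Longrightarrow> a * b - b * a \<in> L"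
    and H: "words H m \<subseteq> {0}" "0 \<in> H" and z: "z \<in> L" "z \<notin> H"
  shows "\<exists>y\<in>L - H. \<forall>h\<in>H. h * y - y * h \<in> H"
proof (rule ccontr)
  assume neg: "\<not> ?thesis"
  define S where "S n = span {u * z * v |u v i j. u \<in> words H i \<and> v \<in> words H j \<and> i + j = n}" for n
  have S_Suc: "h * y - y * h \<in> S (Suc n)" if "h \<in> H" "y \<in> S n" for h y n
    using that(2) unfolding S_def
  proof (induction rule: span_induct_alt)
    case base
    show ?case by (simp add: span_zero)
  next
    case (step c x y)
    then obtain u v i j where x: "x = u * z * v" "u \<in> words H i" "v \<in> words H j" "i + j = n" by blast
    have "h \<in> words H 1" using that(1) by (auto simp: words_Suc words_0)
    then have "h * u \<in> words H (Suc i)" "v * h \<in> words H (Suc j)"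
      using words_mult[of h H 1 u i] words_mult[of v H j h 1] x by auto
    then have "(h * u) * z * v \<in> S (Suc n)" "u * z * (v * h) \<in> S (Suc n)"
      unfolding S_def using x
      by (intro span_base CollectI exI[of _ "h * u"] exI[of _ v] exI[of _ "Suc i"] exI[of _ j],
          simp, intro span_base CollectI exI[of _ u] exI[of _ "v * h"] exI[of _ i] exI[of _ "Suc j"], simp)
    then have "smult c ((h * u) * z * v - u * z * (v * h)) + (h * y - y * h) \<in> S (Suc n)"
      using step.IH unfolding S_def by (intro span_add[OF span_scale[OF span_diff]])
    also have "smult c ((h * u) * z * v - u * z * (v * h)) + (h * y - y * h)
        = h * (smult c x + y) - (smult c x + y) * h"
      by (simp add: x algebra_simps scale_right_diff_distrib)
    finally show ?case unfolding S_def .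
  qed
  have "\<exists>y. y \<in> L - H \<and> y \<in> S n" for n
  proof (induction n)
    case 0
    have "1 * z * 1 \<in> S 0" unfolding S_def by (rule span_base) (auto simp: words_0)
    then show ?case using z by auto
  next
    case (Suc n)
    then show ?case using neg S_Suc L by blast
  qed
  then obtain y where y: "y \<in> L - H" "y \<in> S (m + m)" by blast
  have "u * z * v = 0" if "u \<in> words H i" "v \<in> words H j" "i + j = m + m" for u v i j
  proof (cases "m \<le> i")
    case True
    then show ?thesis using words_zero_mono[OF H(1)] that(1) by force
  next
    case False
    then have "m \<le> j" using that(3) by simp
    then show ?thesis using words_zero_mono[OF H(1)] that(2) by force
  qed
  then have "S (m + m) \<subseteq> {0}" unfolding S_def by (intro span_minimal) auto
  then show False using y H(2) by auto
qed

text \<open>Filter the ring by the right ideals \<open>R r\<close> generated by the words of length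
  \<open>r\<close> in \<open>H\<close>. Elements of \<open>H\<close> raise the filtration by one;
  \<open>y\<close> preserves it, because moving \<open>y\<close> past a letter only costs another
  element of \<open>H\<close>. Modulo the next step a word of length \<open>j\<close> in the
  extended set acts as a multiple of \<open>y ^ j\<close>, so \<open>s\<close> letters raise the
  filtration and \<open>s * m\<close> letters reach \<open>R m\<close>, which is zero.\<close>

lemma words_zero_extend:
  fixes H :: "'r set"
  assumes y: "y ^ s = 0" and hy: "\<And>h. h \<in> H \<Longrightarrow> h * y - y * h \<in> H" and H: "words H m \<subseteq> {0}"
  shows "words {h + smult c y |h c. h \<in> H} (s * m) \<subseteq> {0}"
proof -
  define H' where "H' = {h + smult c y |h c. h \<in> H}"
  define R where "R r = span {u * w |u w. u \<in> words H r}" for r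
  have R0: "w \<in> R 0" for w unfolding R_def by (rule span_base) (auto simp: words_0)
  have R_Suc: "h * n \<in> R (Suc r)" if "h \<in> H" "n \<in> R r" for h n r
    using that(2) unfolding R_def
  proof (induction rule: span_induct_alt)
    case base
    show ?case by (simp add: span_zero)
  next
    case (step c x n)
    then obtain u w where x: "x = u * w" "u \<in> words H r" by blast
    have "h * x \<in> R (Suc r)" unfolding R_def
      by (rule span_base) (use x that in \<open>auto simp: words_Suc mult.assoc[symmetric]\<close>)
    then show ?case using step.IH unfolding R_def by (simp add: distrib_left span_add span_scale)
  qed
  have R_dec: "R (Suc r) \<subseteq> R r" for r
    unfolding R_def
  proof (rule span_mono, safe)
    fix u w assume "u \<in> words H (Suc r)"
    then have "u \<in> words H (r + 1)" by simp
    then obtain v x where "v \<in> words H r" "u = v * x" by (rule words_addE)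
    then show "\<exists>u' w'. u * w = u' * w' \<and> u' \<in> words H r" by (metis mult.assoc)
  qed
  have y_R: "y * n \<in> R r" if "n \<in> R r" for n r
    using that
  proof (induction r arbitrary: n)
    case 0
    show ?case by (rule R0)
  next
    case (Suc r)
    show ?case using Suc.prems unfolding R_def
    proof (induction rule: span_induct_alt)
      case base
      show ?case by (simp add: span_zero)
    next
      case (step c x n)
      then obtain h u w where x: "x = h * (u * w)" "h \<in> H" "u \<in> words H r"
        by (auto simp: words_Suc mult.assoc)
      have uw: "u * w \<in> R r" unfolding R_def by (rule span_base) (use x in blast)
      have "h * (y * (u * w)) \<in> R (Suc r)" using R_Suc x(2) Suc.IH uw by blast
      moreover have "(h * y - y * h) * (u * w) \<in> R (Suc r)" using R_Suc hy x(2) uw by blast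
      ultimately have "h * (y * (u * w)) - (h * y - y * h) * (u * w) \<in> R (Suc r)"
        unfolding R_def by (rule span_diff)
      moreover have "h * (y * (u * w)) - (h * y - y * h) * (u * w) = y * x"
        by (simp add: x algebra_simps)
      ultimately show ?case using step.IH unfolding R_def by (simp add: distrib_left span_add span_scale)
    qed
  qed
  have yj_R: "y ^ j * n \<in> R r" if "n \<in> R r" for j n r
    using that by (induction j) (auto simp: mult.assoc y_R)
  have word_R: "\<exists>c. v * n - smult c (y ^ j * n) \<in> R (Suc r)" if "v \<in> words H' j" "n \<in> R r" for v n j r
    using that(1)
  proof (induction j arbitrary: v)
    case 0
    then have "v * n - smult 1 (y ^ 0 * n) = 0" by (simp add: words_0)
    also have "0 \<in> R (Suc r)" unfolding R_def by (rule span_zero)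
    finally show ?case by blast
  next
    case (Suc j)
    then obtain x v' where "v = x * v'" "x \<in> H'" "v' \<in> words H' j" unfolding words_Suc by blast
    then obtain h c where v: "v = (h + smult c y) * v'" "h \<in> H" "v' \<in> words H' j"
      unfolding H'_def by blast
    obtain c' where c': "v' * n - smult c' (y ^ j * n) \<in> R (Suc r)" using Suc.IH v(3) by blast
    define n' where "n' = v' * n - smult c' (y ^ j * n)"
    have n': "n' \<in> R (Suc r)" using c' by (simp add: n'_def)
    have "smult c' (h * (y ^ j * n)) \<in> R (Suc r)"
      using R_Suc[OF v(2) yj_R[OF that(2)]] unfolding R_def by (rule span_scale)
    moreover have "h * n' \<in> R (Suc r)" using R_Suc[OF v(2) n'] R_dec by blast
    moreover have "smult c (y * n') \<in> R (Suc r)" using y_R[OF n'] unfolding R_def by (rule span_scale)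
    ultimately have "smult c' (h * (y ^ j * n)) + h * n' + smult c (y * n') \<in> R (Suc r)"
      unfolding R_def by (intro span_add)
    also have "smult c' (h * (y ^ j * n)) + h * n' + smult c (y * n')
        = v * n - smult (c * c') (y ^ Suc j * n)"
      by (simp add: v(1) n'_def algebra_simps scale_right_diff_distrib)
    finally show ?case by blast
  qed
  have "v * n \<in> R r" if "v \<in> words H' (s * r)" for v n r
    using that
  proof (induction r arbitrary: v)
    case 0
    show ?case by (rule R0)
  next
    case (Suc r)
    then have "v \<in> words H' (s + s * r)" by simp
    then obtain v1 v2 where v: "v1 \<in> words H' s" "v2 \<in> words H' (s * r)" "v = v1 * v2"
      by (rule words_addE)
    then show ?case using word_R[OF v(1) Suc.IH[OF v(2)]] y by (simp add: mult.assoc)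
  qed
  then have "v * 1 \<in> R m" if "v \<in> words H' (s * m)" for v using that by blast
  moreover have "R m \<subseteq> {0}" unfolding R_def using H by (intro span_minimal) auto
  ultimately show ?thesis unfolding H'_def by auto
qed

text \<open>Jacobson's argument: a maximal subalgebra with vanishing long products is everything.\<close>

theorem engel:
  assumes L: "subspace L" "L \<subseteq> span b" "finite b"
    and bracket: "\<And>a b. a \<in> L \<Longrightarrow> b \<in> L \<Longrightarrow> a * b - b * a \<in> L"
    and nil: "\<And>a. a \<in> L \<Longrightarrow> \<exists>n. a ^ n = 0"
  shows "\<exists>m. words L m \<subseteq> {0}"
proof -
  define P where "P H \<longleftrightarrow> subspace H \<and> H \<subseteq> L \<and> (\<forall>a\<in>H. \<forall>b\<in>H. a * b - b * a \<in> H) \<and> (\<exists>m. words H m \<subseteq> {0})" for H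
  have fin: "finite B \<and> card B \<le> card b" if "B \<subseteq> L" "independent B" for B
    using that L by (intro independent_span_bound) auto
  have "words {0 :: 'r} 1 \<subseteq> {0}" by (auto simp: words_Suc)
  then have "P {0}" unfolding P_def using L(1) subspace_0 by (auto intro!: exI[of _ 1])
  moreover have "dim H \<le> card b" if "P H" for H
    using that L dim_le_card[of H b] by (auto simp: P_def)
  then have "\<forall>H. P H \<longrightarrow> dim H < Suc (card b)" by (auto simp: less_Suc_eq_le)
  ultimately obtain H where H: "P H" and max: "\<And>H'. P H' \<Longrightarrow> dim H' \<le> dim H"
    using ex_has_greatest_nat[of P "{0}" dim "Suc (card b)"] by blast
  have "H = L"
  proof (rule ccontr)
    assume "H \<noteq> L"
    then obtain z where z: "z \<in> L" "z \<notin> H" using H unfolding P_def by blast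
    obtain m where m: "words H m \<subseteq> {0}" using H by (auto simp: P_def)
    have "0 \<in> H" using H subspace_0 by (auto simp: P_def)
    have "\<exists>y\<in>L - H. \<forall>h\<in>H. h * y - y * h \<in> H"
      by (rule ex_outside_normaliser[OF _ m \<open>0 \<in> H\<close> z]) (use H bracket in \<open>auto simp: P_def\<close>)
    then obtain y where y: "y \<in> L" "y \<notin> H" "\<And>h. h \<in> H \<Longrightarrow> h * y - y * h \<in> H" by blast
    obtain s where s: "y ^ s = 0" using nil y(1) by blast
    define H' where "H' = {h + smult c y |h c. h \<in> H}"
    obtain B where B: "B \<subseteq> H" "independent B" "H \<subseteq> span B" by (rule maximal_independent_subset)
    have spanB: "span B = H" using B H span_minimal unfolding P_def by blast
    have "H' = span (insert y B)"
    proof -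
      have "x \<in> H' \<longleftrightarrow> (\<exists>c. x - smult c y \<in> H)" for x
      proof
        assume "\<exists>c. x - smult c y \<in> H"
        then obtain c where "x - smult c y \<in> H" ..
        then have "(x - smult c y) + smult c y \<in> H'" unfolding H'_def by blast
        then show "x \<in> H'" by simp
      next
        assume "x \<in> H'"
        then obtain h c where "x = h + smult c y" "h \<in> H" unfolding H'_def by blast
        then show "\<exists>c. x - smult c y \<in> H" by (intro exI[of _ c]) simp
      qed
      then show ?thesis unfolding span_insert spanB by auto
    qed
    then have sub: "subspace H'" by simp
    have HH': "H \<subseteq> H'" unfolding H'_def
    proof
      fix h assume "h \<in> H"
      then show "h \<in> {h + smult c y |h c. h \<in> H}" by (intro CollectI exI[of _ h] exI[of _ 0]) simp
    qed
    have "P H'" unfolding P_def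
    proof (intro conjI ballI)
      show "subspace H'" by (rule sub)
      show "H' \<subseteq> L" unfolding H'_def using H y(1) L(1)
        by (auto simp: P_def intro!: subspace_add subspace_scale)
      show "\<exists>m. words H' m \<subseteq> {0}"
        unfolding H'_def using words_zero_extend[OF s y(3) m] by blast
      fix a b assume "a \<in> H'" "b \<in> H'"
      then obtain h c h' c' where ab: "a = h + smult c y" "b = h' + smult c' y" "h \<in> H" "h' \<in> H"
        unfolding H'_def by blast
      have "(h * h' - h' * h) + smult c' (h * y - y * h) - smult c (h' * y - y * h') \<in> H"
      proof (rule subspace_diff[OF _ subspace_add])
        show "subspace H" "subspace H" "h * h' - h' * h \<in> H" using H ab by (auto simp: P_def)
        then show "smult c' (h * y - y * h) \<in> H" "smult c (h' * y - y * h') \<in> H"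
          using ab y(3) by (auto intro: subspace_scale)
      qed
      also have "(h * h' - h' * h) + smult c' (h * y - y * h) - smult c (h' * y - y * h') = a * b - b * a"
        by (simp add: ab algebra_simps scale_right_diff_distrib)
      finally show "a * b - b * a \<in> H'" using HH' by blast
    qed
    moreover have "dim H' = Suc (dim H)"
    proof -
      have "y \<notin> span B" "y \<notin> B" using y(2) B(1) spanB by auto
      moreover from this have "independent (insert y B)" using B(2) by (intro independent_insertI)
      moreover have "H \<subseteq> L" using H by (simp add: P_def)
      then have "finite B" using fin[of B] B by auto
      moreover have "dim H' = card (insert y B)"
        unfolding \<open>H' = span (insert y B)\<close> by (rule dim_span_eq_card_independent) fact
      moreover have "dim H = card B"
        unfolding spanB[symmetric] by (rule dim_span_eq_card_independent) (rule B(2))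
      ultimately show ?thesis by simp
    qed
    ultimately show False using max[of H'] by simp
  qed
  then show ?thesis using H by (auto simp: P_def)
qed

text \<open>Writing each element through brackets doubles the length of the products again and
  again, so \<open>L\<close> lies in the span of the words of length \<open>2 ^ k\<close> for every
  \<open>k\<close>, while long words vanish.\<close>

lemma perfect_words_zero:
  assumes perfect: "L \<subseteq> span {a * b - b * a |a b. a \<in> L \<and> b \<in> L}" and "words L m \<subseteq> {0}"
  shows "L \<subseteq> {0}"
proof -
  have mult: "u * v \<in> span (words L (i + j))" if "u \<in> span (words L i)" "v \<in> span (words L j)" for u v i j
    using that(1)
  proof (induction rule: span_induct_alt)
    case (step c x y)
    have "x * v \<in> span (words L (i + j))" using that(2)
    proof (induction rule: span_induct_alt)
      case (step c' x' y')
      then have "x * x' \<in> span (words L (i + j))"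
        using \<open>x \<in> words L i\<close> by (intro span_base words_mult)
      then show ?case using step.IH by (simp add: distrib_left span_add span_scale)
    qed (simp add: span_zero)
    then show ?case using step by (auto simp: distrib_right intro!: span_add span_scale)
  qed (simp add: span_zero)
  have "L \<subseteq> span (words L (2 ^ k))" for k
  proof (induction k)
    case 0
    show ?case by (auto simp: words_Suc words_0 intro: span_base)
  next
    case (Suc k)
    have "span {a * b - b * a |a b. a \<in> L \<and> b \<in> L} \<subseteq> span (words L (2 ^ k + 2 ^ k))"
      using Suc.IH by (intro span_minimal) (auto intro!: span_diff mult)
    then show ?case using perfect by (auto simp: mult_2)
  qed
  moreover have "words L (2 ^ m) \<subseteq> {0}"
    using assms(2) by (rule words_zero_mono) (simp add: less_imp_le)
  then have "span (words L (2 ^ m)) \<subseteq> {0}" by (intro span_minimal) auto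
  ultimately show ?thesis by blast
qed

end

section \<open>Semisimple Lie algebras with an invariant form\<close>

locale quadratic_lie_algebra = lie_algebra scale bracket
  for scale :: "complex \<Rightarrow> 'a::ab_group_add \<Rightarrow> 'a" and bracket :: "'a \<Rightarrow> 'a \<Rightarrow> 'a" +
  fixes B :: "'a \<Rightarrow> 'a \<Rightarrow> complex" and E :: "'a set"
  assumes semisimple: "semisimple scale bracket"
    and bilinear: "bilinear_form scale B"
    and symmetric: "symmetric_form B"
    and nondegenerate: "nondegenerate_form B"
    and invariant: "invariant_form bracket B"
    and orthonormal: "orthonormal_basis scale B E"
begin

sublocale complex_space scale by unfold_locales

sublocale bracket_left: Vector_Spaces.linear scale scale "\<lambda>x. bracket x y" for y
  by (rule linear_bracket_left)

sublocale bracket_right: Vector_Spaces.linear scale scale "\<lambda>y. bracket x y" for x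
  by (rule linear_bracket_right)

sublocale B_left: Vector_Spaces.linear scale "(*)" "\<lambda>x. B x y" for y
  using bilinear by (simp add: bilinear_form_def)

sublocale B_right: Vector_Spaces.linear scale "(*)" "\<lambda>y. B x y" for x
  using bilinear by (simp add: bilinear_form_def)

lemma B_sym: "B x y = B y x"
  using symmetric by (simp add: symmetric_form_def)

lemma B_invariant: "B (bracket x y) z = B x (bracket y z)"
  using invariant by (simp add: invariant_form_def)

lemma B_nondegenerate: "(\<And>y. B x y = 0) \<Longrightarrow> x = 0"
  using nondegenerate by (simp add: nondegenerate_form_def)

lemma B_eqI:
  assumes "\<And>y. B x y = B x' y"
  shows "x = x'"
  using B_nondegenerate[of "x - x'"] assms by (simp add: B_left.diff)

lemma bracket_skew: "bracket x y = - bracket y x"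
proof -
  have "bracket (x + y) (x + y) = bracket x x + bracket y x + (bracket x y + bracket y y)"
    by (simp only: bracket_left.add bracket_right.add)
  then have "bracket x y + bracket y x = 0" by (simp add: bracket_self add.commute)
  then show ?thesis by (rule eq_neg_iff_add_eq_0[THEN iffD2])
qed

lemma B_skew: "B (bracket x y) z = - B y (bracket x z)"
  by (subst bracket_skew) (simp add: B_left.neg B_invariant)

lemma finite_E: "finite E" and independent_E: "independent E" and span_E: "span E = UNIV"
  using orthonormal by (auto simp: orthonormal_basis_def)

lemma B_orthonormal: "x \<in> E \<Longrightarrow> y \<in> E \<Longrightarrow> B x y = (if x = y then 1 else 0)"
  using orthonormal by (auto simp: orthonormal_basis_def)

lemma B_sum_E:
  assumes "y \<in> E"
  shows "B (\<Sum>e\<in>E. scale (c e) e) y = c y"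
proof -
  have "B (\<Sum>e\<in>E. scale (c e) e) y = (\<Sum>e\<in>E. if e = y then c y else 0)"
    unfolding B_left.sum B_left.scale by (intro sum.cong) (use assms in \<open>auto simp: B_orthonormal\<close>)
  then show ?thesis using assms finite_E by simp
qed

lemma representation_E:
  assumes "e \<in> E"
  shows "representation E x e = B x e"
proof -
  have "x = (\<Sum>e\<in>E. scale (representation E x e) e)"
    using sum_representation_eq[OF independent_E _ finite_E] span_E by simp
  then show ?thesis using B_sum_E[OF assms] by metis
qed

lemma expand_E: "(\<Sum>e\<in>E. scale (B x e) e) = x"
proof -
  have "(\<Sum>e\<in>E. scale (B x e) e) = (\<Sum>e\<in>E. scale (representation E x e) e)"
    by (intro sum.cong) (simp_all add: representation_E)
  also have "\<dots> = x" using sum_representation_eq[OF independent_E _ finite_E] span_E by simp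
  finally show ?thesis .
qed

lemma linear_expand_E:
  assumes "Vector_Spaces.linear scale s h"
  shows "h x = (\<Sum>e\<in>E. s (B x e) (h e))"
proof -
  interpret h: Vector_Spaces.linear scale s h by fact
  show ?thesis by (subst expand_E[symmetric]) (simp add: h.sum h.scale)
qed

text \<open>Invariance of the tensor that sums \<open>e\<close> tensor \<open>e\<close> over
  \<open>E\<close>, tested against an arbitrary bilinear \<open>h\<close>: the matrix of
  \<open>bracket x\<close> in an orthonormal basis is skew. It serves both for Casimir elements and
  for the contraction of forms.\<close>

lemma casimir_tensor_invariant:
  assumes l: "\<And>y. Vector_Spaces.linear scale s (\<lambda>x. h x y)" and r: "\<And>x. Vector_Spaces.linear scale s (h x)"
  shows "(\<Sum>e\<in>E. h (bracket x e) e) + (\<Sum>e\<in>E. h e (bracket x e)) = 0"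
proof -
  interpret s: vector_space s using l[of 0] by (simp add: Vector_Spaces.linear_def)
  have "(\<Sum>e\<in>E. h e (bracket x e)) = (\<Sum>e\<in>E. \<Sum>e'\<in>E. s (B (bracket x e) e') (h e e'))"
    by (intro sum.cong refl linear_expand_E[OF r])
  also have "\<dots> = (\<Sum>e\<in>E. \<Sum>e'\<in>E. s (B (bracket x e') e) (h e' e))" by (rule sum.swap)
  also have "\<dots> = (\<Sum>e\<in>E. \<Sum>e'\<in>E. - s (B (bracket x e) e') (h e' e))"
  proof (intro sum.cong refl)
    fix e e'
    have "B (bracket x e') e = - B (bracket x e) e'" using B_skew B_sym by metis
    then show "s (B (bracket x e') e) (h e' e) = - s (B (bracket x e) e') (h e' e)" by simp
  qed
  also have "\<dots> = (\<Sum>e\<in>E. - h (bracket x e) e)"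
    unfolding sum_negf by (intro sum.cong refl arg_cong[of _ _ uminus] linear_expand_E[OF l, symmetric])
  finally show ?thesis by (simp add: sum_negf)
qed

lemma abelian_ideal_zero:
  assumes J: "subspace J" "\<And>x y. y \<in> J \<Longrightarrow> bracket x y \<in> J"
    and ab: "\<And>x y. x \<in> J \<Longrightarrow> y \<in> J \<Longrightarrow> bracket x y = 0"
  shows "J = {0}"
proof -
  have "derived_series scale bracket J (Suc 0) \<subseteq> {0}"
    unfolding derived_series.simps by (rule span_minimal) (use ab in auto)
  then have "derived_series scale bracket J (Suc 0) = {0}"
    using span_zero by auto
  then have "solvable_ideal scale bracket J" unfolding solvable_ideal_def by blast
  moreover have "lie_ideal scale bracket J" using J by (simp add: lie_ideal_def)
  ultimately show ?thesis using semisimple unfolding semisimple_def by blast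
qed

text \<open>Since \<open>B (bracket u v) z = B u (bracket v z)\<close>, an isotropic ideal is
  abelian by nondegeneracy.\<close>

lemma isotropic_ideal_zero:
  assumes J: "subspace J" "\<And>x y. y \<in> J \<Longrightarrow> bracket x y \<in> J"
    and iso: "\<And>x y. x \<in> J \<Longrightarrow> y \<in> J \<Longrightarrow> B x y = 0"
  shows "J = {0}"
proof (rule abelian_ideal_zero[OF J])
  fix u v assume uv: "u \<in> J" "v \<in> J"
  have "bracket v z \<in> J" for z
    using J(2)[OF uv(2), of z] J(1) bracket_skew[of v z] by (simp add: subspace_neg)
  then show "bracket u v = 0"
    by (intro B_nondegenerate) (simp add: B_invariant iso uv)
qed

lemma center_zero:
  assumes "\<And>x. bracket z x = 0"
  shows "z = 0"
proof -
  define J where "J = {z. \<forall>x. bracket z x = 0}"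
  have J0: "bracket x y = 0" if "y \<in> J" for x y
    using that bracket_skew[of x y] by (simp add: J_def)
  have "J = {0}"
  proof (rule abelian_ideal_zero)
    show "subspace J"
      by (rule subspaceI) (auto simp: J_def bracket_left.zero bracket_left.add bracket_left.scale)
    show "bracket x y \<in> J" if "y \<in> J" for x y
      using J0[OF that] by (simp add: J_def bracket_left.zero)
  qed (rule J0)
  then show ?thesis using assms by (auto simp: J_def)
qed

text \<open>A linear form that vanishes on all brackets is represented through \<open>B\<close> by a
  central element, and the centre is an abelian ideal.\<close>

lemma perfect: "span {bracket x y |x y. True} = UNIV"
proof (rule ccontr)
  define S where "S = span {bracket x y |x y. True}"
  assume "span {bracket x y |x y. True} \<noteq> UNIV"
  then obtain v where v: "v \<notin> S" unfolding S_def by blast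
  interpret vector_space_pair scale scale by unfold_locales
  obtain P where P: "range P \<subseteq> S" "Vector_Spaces.linear scale scale P" "\<And>x. x \<in> S \<Longrightarrow> P x = x"
    using linear_exists_left_inverse_on[OF linear_id, of S] subspace_span unfolding S_def by auto
  interpret P: Vector_Spaces.linear scale scale P by (rule P)
  have "v - P v \<noteq> 0" using v P(1) by auto
  then obtain u where u: "B (v - P v) u \<noteq> 0" using B_nondegenerate by blast
  \<comment> \<open>A linear form that is zero on \<open>S\<close>, because \<open>P\<close> fixes
    \<open>S\<close>, and non-zero at \<open>v\<close>.\<close>
  define h where "h x = B (x - P x) u" for x
  have lin: "Vector_Spaces.linear scale (*) h"
    by unfold_locales (auto simp: h_def P.add P.scale B_left.add B_left.diff B_left.scale algebra_simps)
  define z where "z = (\<Sum>e\<in>E. scale (h e) e)"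
  have z: "B z x = h x" for x
    using linear_expand_E[OF lin, of x] by (simp add: z_def B_left.sum B_left.scale B_sym[of x] mult.commute)
  have "B (bracket z x) y = 0" for x y
  proof -
    have "bracket x y \<in> S" unfolding S_def by (rule span_base) blast
    then show ?thesis using P(3) by (simp add: B_invariant z h_def B_left.zero)
  qed
  then have "bracket z x = 0" for x by (rule B_nondegenerate)
  then have "z = 0" by (rule center_zero)
  then show False using z[of v] u by (simp add: h_def B_left.zero)
qed

end

section \<open>Representations\<close>

locale traced_representation =
  lie: quadratic_lie_algebra scale bracket B E + trace_algebra smult K tr N
  for scale :: "complex \<Rightarrow> 'a::ab_group_add \<Rightarrow> 'a" and bracket :: "'a \<Rightarrow> 'a \<Rightarrow> 'a"
    and B :: "'a \<Rightarrow> 'a \<Rightarrow> complex" and E :: "'a set"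
    and smult :: "complex \<Rightarrow> 'r::ring_1 \<Rightarrow> 'r" and K :: "'r set" and tr :: "'r \<Rightarrow> complex" and N :: nat +
  fixes \<pi> :: "'a \<Rightarrow> 'r"
  assumes \<pi>_linear: "Vector_Spaces.linear scale smult \<pi>"
    and \<pi>_in_K: "\<pi> x \<in> K"
    and \<pi>_bracket: "\<pi> (bracket x y) = \<pi> x * \<pi> y - \<pi> y * \<pi> x"
begin

sublocale \<pi>: Vector_Spaces.linear scale smult \<pi> by (rule \<pi>_linear)

lemma range_\<pi>_subset: "range \<pi> \<subseteq> span (\<pi> ` E)"
  using \<pi>.span_image[of E] lie.span_E by simp

lemma tr_invariant: "tr (\<pi> (bracket z x) * \<pi> y) = - tr (\<pi> x * \<pi> (bracket z y))"
proof -
  have "tr (\<pi> z * (\<pi> x * \<pi> y)) = tr (\<pi> x * \<pi> y * \<pi> z)"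
    by (intro tr_comm \<pi>_in_K K_mult)
  then show ?thesis
    by (simp add: \<pi>_bracket left_diff_distrib right_diff_distrib mult.assoc tr_diff K_mult \<pi>_in_K)
qed

text \<open>Cartan's criterion. For \<open>Y\<close> normalising the range,
  \<open>tr (\<pi> (bracket a b) * Y)\<close> equals, up to sign, the trace of
  \<open>\<pi> a\<close> times the commutator of \<open>Y\<close> and \<open>\<pi> b\<close>. That
  commutator is again in the range, and brackets span the Lie algebra.\<close>

lemma \<pi>_nilpotent:
  assumes zero: "\<And>x y. tr (\<pi> x * \<pi> y) = 0"
  shows "\<exists>n. \<pi> x ^ n = 0"
proof (rule nilpotent_if_orthogonal_to_normaliser[of "range \<pi>"])
  show "subspace (range \<pi>)" using \<pi>.subspace_image[OF lie.subspace_UNIV] .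
  show "\<pi> x * b - b * \<pi> x \<in> range \<pi>" if "b \<in> range \<pi>" for b
    using that by (auto simp flip: \<pi>_bracket)
  fix Y assume Y: "Y \<in> K" and norm: "\<And>b. b \<in> range \<pi> \<Longrightarrow> Y * b - b * Y \<in> range \<pi>"
  have "x \<in> lie.span {bracket x y |x y. True}" unfolding lie.perfect by simp
  then show "tr (\<pi> x * Y) = 0"
  proof (induction rule: lie.span_induct_alt)
    case base
    show ?case by (simp add: \<pi>.zero)
  next
    case (step c z y)
    then obtain a b where z: "z = bracket a b" by blast
    obtain d where d: "Y * \<pi> b - \<pi> b * Y = \<pi> d" using norm[of "\<pi> b"] by blast
    have "tr (\<pi> b * (\<pi> a * Y)) = tr (\<pi> a * Y * \<pi> b)"
      by (intro tr_comm \<pi>_in_K K_mult Y)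
    then have "tr (\<pi> z * Y) = - tr (\<pi> a * (Y * \<pi> b - \<pi> b * Y))"
      by (simp add: z \<pi>_bracket left_diff_distrib right_diff_distrib mult.assoc tr_diff K_mult \<pi>_in_K Y)
    also have "\<dots> = 0" by (simp add: d zero)
    finally have "tr (\<pi> z * Y) = 0" .
    then show ?case
      using step.IH K_subspace
      by (simp add: \<pi>.add \<pi>.scale distrib_right tr_add tr_smult K_mult \<pi>_in_K Y subspace_scale)
  qed
qed (rule \<pi>_in_K)

text \<open>Every \<open>\<pi> x\<close> is nilpotent, so long products vanish by
  \<open>engel\<close>; the range is perfect, and \<open>perfect_words_zero\<close> leaves nothing
  of it.\<close>

lemma trace_form_zero:
  assumes zero: "\<And>x y. tr (\<pi> x * \<pi> y) = 0"
  shows "\<pi> x = 0"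
proof -
  have "\<exists>m. words (range \<pi>) m \<subseteq> {0}"
  proof (rule engel)
    show "subspace (range \<pi>)" using \<pi>.subspace_image[OF lie.subspace_UNIV] .
    show "range \<pi> \<subseteq> span (\<pi> ` E)" by (rule range_\<pi>_subset)
    show "finite (\<pi> ` E)" using lie.finite_E by simp
    show "a * b - b * a \<in> range \<pi>" if "a \<in> range \<pi>" "b \<in> range \<pi>" for a b
      using that by (auto simp flip: \<pi>_bracket)
    show "\<exists>n. a ^ n = 0" if "a \<in> range \<pi>" for a
      using that \<pi>_nilpotent[OF zero] by auto
  qed
  moreover have "range \<pi> \<subseteq> span {a * b - b * a |a b. a \<in> range \<pi> \<and> b \<in> range \<pi>}"
  proof -
    have "range \<pi> = span (\<pi> ` {bracket x y |x y. True})"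
      using \<pi>.span_image[of "{bracket x y |x y. True}"] lie.perfect by simp
    also have "\<dots> \<subseteq> span {a * b - b * a |a b. a \<in> range \<pi> \<and> b \<in> range \<pi>}"
    proof (rule span_mono, safe)
      fix x y
      show "\<exists>a b. \<pi> (bracket x y) = a * b - b * a \<and> a \<in> range \<pi> \<and> b \<in> range \<pi>"
        by (intro exI[of _ "\<pi> x"] exI[of _ "\<pi> y"]) (simp add: \<pi>_bracket)
    qed
    finally show ?thesis .
  qed
  ultimately have "range \<pi> \<subseteq> {0}" using perfect_words_zero by blast
  then show ?thesis by auto
qed

section \<open>The Casimir element and its central idempotent\<close>

definition T :: "'a \<Rightarrow> 'a" where
  "T x = (\<Sum>e\<in>E. scale (tr (\<pi> x * \<pi> e)) e)"

lemma tr_linear: "Vector_Spaces.linear scale (*) (\<lambda>y. tr (\<pi> x * \<pi> y))"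
  by unfold_locales
    (auto simp: \<pi>.add \<pi>.scale distrib_left tr_add tr_smult K_mult \<pi>_in_K algebra_simps)

lemma B_T: "B (T x) y = tr (\<pi> x * \<pi> y)"
  unfolding T_def lie.B_left.sum lie.B_left.scale
  using lie.linear_expand_E[OF tr_linear, of x y] by (simp add: lie.B_sym mult.commute)

lemma B_T_right: "B x (T y) = tr (\<pi> x * \<pi> y)"
  using B_T[of y x] lie.B_sym[of x "T y"] tr_comm[of "\<pi> x" "\<pi> y"] by (simp add: \<pi>_in_K)

lemma T_linear: "vec_endo scale T"
proof unfold_locales
  fix x y c
  show "T (x + y) = T x + T y"
    by (rule lie.B_eqI) (simp add: B_T lie.B_left.add \<pi>.add distrib_right tr_add K_mult \<pi>_in_K)
  show "T (scale c x) = scale c (T x)"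
    by (rule lie.B_eqI) (simp add: B_T lie.B_left.scale \<pi>.scale tr_smult K_mult \<pi>_in_K)
qed

sublocale T: vec_endo scale T by (rule T_linear)

lemma T_bracket: "T (bracket z x) = bracket z (T x)"
  by (rule lie.B_eqI) (simp add: B_T lie.B_skew[of z "T x"] tr_invariant)

text \<open>If \<open>T\<close> to the power \<open>k + 2\<close> vanishes, the range of the power
  \<open>k + 1\<close> is an ideal, as \<open>T\<close> commutes with brackets, and it is isotropic,
  as \<open>T\<close> is self-adjoint and \<open>2 * k + 2\<close> is at least \<open>k + 2\<close>.
  So the power \<open>k + 1\<close> vanishes already, and the descent ends at \<open>T\<close>
  itself.\<close>

lemma T_nilpotent_zero:
  assumes "\<And>v. (T ^^ n) v = 0"
  shows "T v = 0"
proof -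
  have sym: "B ((T ^^ k) x) y = B x ((T ^^ k) y)" for k x y
  proof (induction k arbitrary: x y)
    case (Suc k)
    have "B (T z) y = B z (T y)" for z y by (simp add: B_T B_T_right)
    then show ?case using Suc by (simp add: funpow_swap1)
  qed simp
  have comm: "bracket z ((T ^^ k) x) = (T ^^ k) (bracket z x)" for z k x
    by (induction k) (auto simp flip: T_bracket)
  have lin: "Vector_Spaces.linear scale scale (T ^^ k)" for k
    by (induction k; unfold_locales) (auto simp: T.T.add T.T.scale Vector_Spaces.linear_iff)
  have "T v = 0" if "\<And>v. (T ^^ Suc k) v = 0" for k v
    using that
  proof (induction k arbitrary: v)
    case (Suc k)
    have "range (T ^^ Suc k) = {0}"
    proof (rule lie.isotropic_ideal_zero)
      interpret k: Vector_Spaces.linear scale scale "T ^^ Suc k" by (rule lin)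
      interpret k': Vector_Spaces.linear scale scale "T ^^ k" by (rule lin)
      show "lie.subspace (range (T ^^ Suc k))" using k.subspace_image[OF lie.subspace_UNIV] .
      show "bracket x y \<in> range (T ^^ Suc k)" if "y \<in> range (T ^^ Suc k)" for x y
      proof -
        from that obtain a where "y = (T ^^ Suc k) a" by blast
        then have "bracket x y = (T ^^ Suc k) (bracket x a)" by (simp only: comm)
        then show ?thesis by blast
      qed
      fix x y assume "x \<in> range (T ^^ Suc k)" "y \<in> range (T ^^ Suc k)"
      then obtain a b where ab: "x = (T ^^ Suc k) a" "y = (T ^^ Suc k) b" by blast
      have "(T ^^ Suc k) ((T ^^ Suc k) b) = (T ^^ k) ((T ^^ Suc (Suc k)) b)"
        by (simp add: funpow_swap1)
      also have "\<dots> = 0" unfolding Suc.prems by (rule k'.zero)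
      finally show "B x y = 0" unfolding ab sym by (simp add: lie.B_right.zero)
    qed
    then show ?case by (intro Suc.IH) auto
  qed auto
  then show ?thesis using assms by (metis funpow_0 funpow_Suc_right comp_apply T.T.zero)
qed

text \<open>The elements \<open>e\<close> are paired with \<open>S e\<close> so that
  \<open>tr C\<close> is the sum of \<open>B (f e) e\<close> over \<open>E\<close>, the trace of the
  projection \<open>f = T S\<close>, hence a positive integer. So \<open>C\<close> is not nilpotent
  and its Fitting projection \<open>p\<close> is non-zero. As a polynomial in \<open>C\<close> it
  commutes with the representation, and having \<open>C\<close> as a left or right factor places it
  in the two spans.\<close>

lemma casimir_idempotent:
  assumes "\<pi> x0 \<noteq> 0"
  shows "\<exists>p\<in>K. p \<noteq> 0 \<and> p * p = p \<and> (\<forall>x. p * \<pi> x = \<pi> x * p) \<and>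
    p \<in> span {\<pi> x * r |x r. r \<in> K} \<and> p \<in> span {r * \<pi> x |x r. r \<in> K}"
proof -
  have "\<exists>Z m. finite Z \<and> 0 \<in> Z \<and> 0 < m \<and> (\<forall>p. (\<forall>z\<in>Z. [:- z, 1:] ^ m dvd p) \<longrightarrow> (\<forall>v. T.pev p v = 0))"
    by (rule T.ex_root_annihilator[OF lie.finite_E]) (simp add: lie.span_E)
  then obtain Z m where Z: "finite Z" "0 \<in> Z" "0 < m"
    and ann: "\<forall>p. (\<forall>z\<in>Z. [:- z, 1:] ^ m dvd p) \<longrightarrow> (\<forall>v. T.pev p v = 0)"
    by (elim exE conjE) (rule that)
  have "\<exists>q n. \<forall>v\<in>UNIV. T.pev (q * [:0, 1:]) (T.pev (q * [:0, 1:]) v) = T.pev (q * [:0, 1:]) v \<and>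
      (T.pev (q * [:0, 1:]) v = 0 \<longrightarrow> (T ^^ n) v = 0)"
    by (rule T.fitting_idempotent[OF Z]) (simp add: ann[rule_format])
  then obtain q n where q: "\<And>v. T.pev (q * [:0, 1:]) (T.pev (q * [:0, 1:]) v) = T.pev (q * [:0, 1:]) v"
      "\<And>v. T.pev (q * [:0, 1:]) v = 0 \<Longrightarrow> (T ^^ n) v = 0" by blast
  define f where "f = T.pev (q * [:0, 1:])"
  define S where "S = T.pev q"
  have f_TS: "f v = T (S v)" for v
    using T.pev_mult[of "[:0, 1:]" q v] unfolding f_def S_def by (simp add: mult.commute T.T.zero)
  have f_ne: "\<exists>v. f v \<noteq> 0"
  proof (rule ccontr)
    assume "\<not> ?thesis"
    then have "T v = 0" for v by (intro T_nilpotent_zero[of n] q(2)) (simp add: f_def)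
    then have "tr (\<pi> x * \<pi> y) = 0" for x y using B_T[of x y] by (simp add: lie.B_left.zero)
    then show False using trace_form_zero assms by blast
  qed
  have S_bracket: "S (bracket z x) = bracket z (S x)" for z x
    unfolding S_def
    by (rule T.pev_hom[OF T_linear lie.linear_bracket_right, symmetric]) (simp add: T_bracket)
  have lin_S: "Vector_Spaces.linear scale scale S" unfolding S_def by (rule T.linear_pev)
  interpret S: Vector_Spaces.linear scale scale S by (rule lin_S)
  define C where "C = (\<Sum>e\<in>E. \<pi> e * \<pi> (S e))"
  have CK: "C \<in> K" unfolding C_def using K_subspace K_mult \<pi>_in_K by (intro subspace_sum) auto
  have C_comm: "\<pi> x * C = C * \<pi> x" for x
  proof -
    have "(\<Sum>e\<in>E. \<pi> (bracket x e) * \<pi> (S e)) + (\<Sum>e\<in>E. \<pi> e * \<pi> (S (bracket x e))) = 0"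
      by (rule lie.casimir_tensor_invariant[where s = smult and h = "\<lambda>a b. \<pi> a * \<pi> (S b)"]; unfold_locales)
        (simp_all add: \<pi>.add \<pi>.scale S.add S.scale algebra_simps)
    also have "(\<Sum>e\<in>E. \<pi> (bracket x e) * \<pi> (S e)) + (\<Sum>e\<in>E. \<pi> e * \<pi> (S (bracket x e)))
        = (\<Sum>e\<in>E. \<pi> x * (\<pi> e * \<pi> (S e)) - \<pi> e * \<pi> (S e) * \<pi> x)"
      unfolding sum.distrib[symmetric] by (intro sum.cong) (auto simp: S_bracket \<pi>_bracket algebra_simps)
    also have "\<dots> = \<pi> x * C - C * \<pi> x"
      by (simp add: C_def sum_subtractf sum_distrib_left sum_distrib_right)
    finally show ?thesis by simp
  qed
  have "tr C = (\<Sum>e\<in>E. B (f e) e)"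
    unfolding C_def using K_mult \<pi>_in_K
    by (subst tr_sum) (auto simp: f_TS lie.B_sym[of _ "_"] simp flip: B_T_right)
  also have "\<dots> = lie.trace_on E f" by (simp add: lie.trace_on_def lie.representation_E)
  finally have trC: "tr C = lie.trace_on E f" .
  obtain k where k: "lie.trace_on E f = of_nat k" "k = 0 \<Longrightarrow> \<forall>v\<in>lie.span E. f v = 0"
    using lie.trace_on_idempotent[OF lie.finite_E lie.independent_E, of f] T.linear_pev q(1)
    by (auto simp: f_def lie.span_E)
  have "C ^ n \<noteq> 0" for n
    using tr_nilpotent[OF CK, of n] k f_ne trC by (auto simp: lie.span_E)
  then obtain q' where q': "rp (q' * [:0, 1:]) C * rp (q' * [:0, 1:]) C = rp (q' * [:0, 1:]) C"
      "rp (q' * [:0, 1:]) C \<noteq> 0"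
    using K_fitting[OF CK] by blast
  define p where "p = rp (q' * [:0, 1:]) C"
  define s where "s = rp q' C"
  have p_eq: "p = s * C" unfolding p_def s_def rp_mult by simp
  have comm: "s * C = C * s" unfolding s_def by (intro rp_commutes) simp
  have pK: "p \<in> K" unfolding p_def by (intro rp_in_K CK dvd_triv_right)
  \<comment> \<open>\<open>s\<close> itself may lie outside \<open>K\<close>, as \<open>q'\<close>
    can have a constant term. Replacing \<open>p\<close> by \<open>p * p\<close> supplies the
    cofactor \<open>s * p\<close>, which is in \<open>K\<close>.\<close>
  have "s * p = (s * C) * s" by (simp only: p_eq mult.assoc) (simp only: comm)
  also have "\<dots> = C * (s * s)" by (subst comm) (rule mult.assoc)
  also have "\<dots> = rp ([:0, 1:] * (q' * q')) C"
    by (simp only: rp_mult s_def left.pev_X mult_1_right)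
  finally have "s * p = rp ([:0, 1:] * (q' * q')) C" .
  then have spK: "s * p \<in> K" using rp_in_K[OF CK] dvd_triv_left by metis
  have "p * s = s * p" by (simp only: p_eq mult.assoc) (simp only: comm)
  have pp: "p * p = p" using q' by (simp add: p_def)
  have "p = (\<Sum>e\<in>E. \<pi> e * (\<pi> (S e) * (s * p)))"
  proof -
    have "p = C * (s * p)" using pp comm by (metis p_eq mult.assoc)
    then show ?thesis by (simp add: C_def sum_distrib_right mult.assoc)
  qed
  also have "\<dots> \<in> span {\<pi> x * r |x r. r \<in> K}"
    using K_mult \<pi>_in_K spK by (intro span_sum span_base) blast
  finally have span1: "p \<in> span {\<pi> x * r |x r. r \<in> K}" .
  have "p = (\<Sum>e\<in>E. (s * p) * \<pi> e * \<pi> (S e))"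
  proof -
    have "p = (s * p) * C" using pp \<open>p * s = s * p\<close> by (metis p_eq mult.assoc)
    then show ?thesis by (simp add: C_def sum_distrib_left mult.assoc)
  qed
  also have "\<dots> \<in> span {r * \<pi> x |x r. r \<in> K}"
    using K_mult \<pi>_in_K spK by (intro span_sum span_base) blast
  finally have span2: "p \<in> span {r * \<pi> x |x r. r \<in> K}" .
  have "p * \<pi> x = \<pi> x * p" for x unfolding p_def by (intro rp_commutes C_comm[symmetric])
  then show ?thesis using pK pp q'(2) span1 span2 unfolding p_def[symmetric] by blast
qed

end

text \<open>Take \<open>e\<close> of maximal rank. If it does not fix some \<open>\<pi> x\<close>,
  then \<open>\<pi> x - e * \<pi> x\<close> defines a non-zero representation, which has an
  idempotent \<open>p\<close> of its own. The two span conditions give \<open>e * p = 0\<close> and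
  \<open>p * e = 0\<close>, so \<open>e + p\<close> is a candidate of larger rank. The same
  conditions later separate image and kernel of \<open>e\<close>.\<close>

lemma (in traced_representation) range_has_unit:
  "\<exists>e\<in>K. (\<forall>x. e * \<pi> x = \<pi> x \<and> \<pi> x * e = \<pi> x) \<and>
    e \<in> span {\<pi> x * r |x r. r \<in> K} \<and> e \<in> span {r * \<pi> x |x r. r \<in> K}"
proof -
  define Q where "Q e \<longleftrightarrow> e \<in> K \<and> e * e = e \<and> (\<forall>x. e * \<pi> x = \<pi> x * e) \<and>
    e \<in> span {\<pi> x * r |x r. r \<in> K} \<and> e \<in> span {r * \<pi> x |x r. r \<in> K}" for e
  \<comment> \<open>For candidates the trace is a natural number by \<open>tr_idempotent\<close>;
    the conversion only makes a maximum available.\<close>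
  define rank where "rank e = nat \<lfloor>Re (tr e)\<rfloor>" for e
  have "Q 0" using K_subspace by (simp add: Q_def subspace_0 span_zero)
  moreover have "\<forall>e. Q e \<longrightarrow> rank e < Suc N"
  proof safe
    fix e assume "Q e"
    then show "rank e < Suc N" using tr_idempotent[of e] by (auto simp: Q_def rank_def)
  qed
  ultimately obtain e where e: "Q e" and max: "\<And>e'. Q e' \<Longrightarrow> rank e' \<le> rank e"
    using ex_has_greatest_nat[of Q 0 rank "Suc N"] by blast
  have eK: "e \<in> K" and ee: "e * e = e" and e_comm: "e * \<pi> x = \<pi> x * e" for x
    using e by (auto simp: Q_def)
  have ee': "e * (e * r) = e * r" for r by (simp add: ee flip: mult.assoc)
  have e_comm': "\<pi> x * (e * r) = e * (\<pi> x * r)" for x r by (simp add: e_comm flip: mult.assoc)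
  have "e * \<pi> x = \<pi> x" for x
  proof (rule ccontr)
    assume ne: "e * \<pi> x \<noteq> \<pi> x"
    define \<rho> where "\<rho> x = \<pi> x - e * \<pi> x" for x
    interpret \<rho>: traced_representation scale bracket B E smult K tr N \<rho>
    proof unfold_locales
      fix x y c
      show "\<rho> (x + y) = \<rho> x + \<rho> y" "\<rho> (scale c x) = smult c (\<rho> x)"
        by (simp_all add: \<rho>_def \<pi>.add \<pi>.scale algebra_simps scale_right_diff_distrib)
      show "\<rho> x \<in> K" using K_subspace eK K_mult \<pi>_in_K by (simp add: \<rho>_def subspace_diff)
      show "\<rho> (bracket x y) = \<rho> x * \<rho> y - \<rho> y * \<rho> x"
        by (simp add: \<rho>_def \<pi>_bracket algebra_simps e_comm' ee')
    qed
    obtain p where p: "p \<in> K" "p \<noteq> 0" "p * p = p" "\<And>x. p * \<rho> x = \<rho> x * p"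
      "p \<in> span {\<rho> x * r |x r. r \<in> K}" "p \<in> span {r * \<rho> x |x r. r \<in> K}"
      using \<rho>.casimir_idempotent[of x] ne by (auto simp: \<rho>_def)
    have ep: "e * p = 0" using p(5)
    proof (induction rule: span_induct_alt)
      case (step c x y)
      then obtain x' r where x: "x = \<rho> x' * r" by blast
      have "e * (\<rho> x' * r) = 0" by (simp add: \<rho>_def algebra_simps ee')
      then have "e * x = 0" by (simp only: x)
      then show ?case using step.IH by (simp add: distrib_left)
    qed simp
    have pe: "p * e = 0" using p(6)
    proof (induction rule: span_induct_alt)
      case (step c x y)
      then obtain x' r where x: "x = r * \<rho> x'" by blast
      have "r * \<rho> x' * e = 0" by (simp add: \<rho>_def algebra_simps e_comm[symmetric] ee')
      then have "x * e = 0" by (simp only: x)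
      then show ?case using step.IH by (simp add: distrib_right)
    qed simp
    have "Q (e + p)"
      unfolding Q_def
    proof (intro conjI allI)
      show "e + p \<in> K" using K_subspace eK p(1) by (rule subspace_add)
      show "(e + p) * (e + p) = e + p" by (simp add: algebra_simps ee p(3) ep pe)
      fix x
      have "p * \<pi> x = p * \<rho> x" by (simp add: \<rho>_def right_diff_distrib pe flip: mult.assoc)
      also have "\<dots> = \<rho> x * p" by (rule p(4))
      also have "\<dots> = \<pi> x * p" by (simp add: \<rho>_def left_diff_distrib e_comm mult.assoc ep)
      finally show "(e + p) * \<pi> x = \<pi> x * (e + p)" by (simp add: algebra_simps e_comm)
    next
      have "{\<rho> x * r |x r. r \<in> K} \<subseteq> {\<pi> x * r |x r. r \<in> K}"
      proof safe
        fix x r assume r: "r \<in> K"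
        have "\<rho> x * r = \<pi> x * (r - e * r)" by (simp add: \<rho>_def algebra_simps e_comm')
        moreover have "r - e * r \<in> K" using K_subspace eK r K_mult by (simp add: subspace_diff)
        ultimately show "\<exists>x' r'. \<rho> x * r = \<pi> x' * r' \<and> r' \<in> K" by blast
      qed
      then have "p \<in> span {\<pi> x * r |x r. r \<in> K}" using p(5) span_mono by blast
      then show "e + p \<in> span {\<pi> x * r |x r. r \<in> K}" using e by (simp add: Q_def span_add)
    next
      have "{r * \<rho> x |x r. r \<in> K} \<subseteq> {r * \<pi> x |x r. r \<in> K}"
      proof safe
        fix x r assume r: "r \<in> K"
        have "r * \<rho> x = (r - r * e) * \<pi> x" by (simp add: \<rho>_def algebra_simps)
        moreover have "r - r * e \<in> K" using K_subspace eK r K_mult by (simp add: subspace_diff)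
        ultimately show "\<exists>x' r'. r * \<rho> x = r' * \<pi> x' \<and> r' \<in> K" by blast
      qed
      then have "p \<in> span {r * \<pi> x |x r. r \<in> K}" using p(6) span_mono by blast
      then show "e + p \<in> span {r * \<pi> x |x r. r \<in> K}" using e by (simp add: Q_def span_add)
    qed
    then have "rank (e + p) \<le> rank e" by (rule max)
    moreover obtain n where n: "tr e = of_nat n" using tr_idempotent[OF eK ee] by blast
    moreover obtain k where k: "tr p = of_nat k" "k \<noteq> 0" using tr_idempotent[OF p(1,3)] p(2) by blast
    moreover have "rank (e + p) = n + k"
      by (simp add: rank_def tr_add eK p(1) n k(1) flip: of_nat_add)
    ultimately show False by (simp add: rank_def)
  qed
  then show ?thesis using e e_comm by (intro bexI[of _ e]) (auto simp: Q_def)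
qed

section \<open>Linear operators on spaces of functions\<close>

definition fscale :: "complex \<Rightarrow> ('i \<Rightarrow> complex) \<Rightarrow> 'i \<Rightarrow> complex" where
  "fscale c v = (\<lambda>i. c * v i)"

interpretation fscale: complex_space fscale
  by unfold_locales (auto simp: fscale_def fun_eq_iff algebra_simps)

text \<open>The locale \<open>trace_algebra\<close> lives on a type of class \<open>ring_1\<close>,
  so the operators are made into such a type.\<close>

typedef 'i lin_op = "{f :: ('i \<Rightarrow> complex) \<Rightarrow> 'i \<Rightarrow> complex. Vector_Spaces.linear fscale fscale f}"
  morphisms app Abs_lin_op
  by (rule exI[of _ id]) (simp add: fscale.linear_id)

setup_lifting type_definition_lin_op

instantiation lin_op :: (type) ring_1
begin

lift_definition zero_lin_op :: "'i lin_op" is "\<lambda>v. 0"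
  by unfold_locales (auto simp: fscale_def fun_eq_iff)

lift_definition one_lin_op :: "'i lin_op" is "\<lambda>v. v"
  by unfold_locales auto

lift_definition plus_lin_op :: "'i lin_op \<Rightarrow> 'i lin_op \<Rightarrow> 'i lin_op" is "\<lambda>f g v. f v + g v"
  by (simp add: Vector_Spaces.linear_iff algebra_simps fscale.scale_right_distrib)

lift_definition uminus_lin_op :: "'i lin_op \<Rightarrow> 'i lin_op" is "\<lambda>f v. - f v"
  by (simp add: Vector_Spaces.linear_iff)

lift_definition minus_lin_op :: "'i lin_op \<Rightarrow> 'i lin_op \<Rightarrow> 'i lin_op" is "\<lambda>f g v. f v - g v"
  by (simp add: Vector_Spaces.linear_iff algebra_simps fscale.scale_right_diff_distrib)

lift_definition times_lin_op :: "'i lin_op \<Rightarrow> 'i lin_op \<Rightarrow> 'i lin_op" is "\<lambda>f g v. f (g v)"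
  by (simp add: Vector_Spaces.linear_iff)

instance
proof
  show "(0 :: 'i lin_op) \<noteq> 1"
  proof transfer
    show "(\<lambda>v :: 'i \<Rightarrow> complex. 0) \<noteq> (\<lambda>v. v)"
    proof
      assume "(\<lambda>v :: 'i \<Rightarrow> complex. 0) = (\<lambda>v. v)"
      from fun_cong[OF this, of "\<lambda>i. 1"] show False by (simp add: fun_eq_iff)
    qed
  qed
qed (transfer; simp add: fun_eq_iff algebra_simps Vector_Spaces.linear_iff; fail)+

end

lift_definition op_smult :: "complex \<Rightarrow> 'i lin_op \<Rightarrow> 'i lin_op" is "\<lambda>c f v. fscale c (f v)"
  by (simp add: Vector_Spaces.linear_iff fscale.scale_right_distrib mult.commute)

lemma app_linear: "Vector_Spaces.linear fscale fscale (app a)"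
  using app[of a] by simp

lemma app_simps [simp]:
  "app 0 v = 0" "app 1 v = v" "app (a + b) v = app a v + app b v" "app (a - b) v = app a v - app b v"
  "app (a * b) v = app a (app b v)" "app (op_smult c a) v = fscale c (app a v)"
  by (transfer; simp)+

lemma app_scale: "app a (fscale c v) = fscale c (app a v)"
  by transfer (simp add: Vector_Spaces.linear_iff)

lemma app_power: "app (a ^ n) v = (app a ^^ n) v"
  by (induction n arbitrary: v) auto

lemma lin_op_eqI: "(\<And>v. app a v = app b v) \<Longrightarrow> a = b"
  by transfer auto

interpretation op_smult: complex_algebra op_smult
  by unfold_locales
    (auto intro!: lin_op_eqI simp: fscale.scale_right_distrib fscale.scale_left_distrib
      app_scale)

lemma app_hom: "Vector_Spaces.linear op_smult fscale (\<lambda>a. app a v)"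
  by unfold_locales auto

lemma vec_endo_app: "vec_endo fscale (app a)"
  by (simp add: vec_endo_def vec_endo_axioms_def app_linear fscale.vector_space_axioms)

lemma app_pev:
  "app (vec_endo.pev op_smult ((*) a) p 1) v = vec_endo.pev fscale (app a) p v"
proof -
  interpret left: vec_endo op_smult "(*) a" by (rule op_smult.vec_endo_left)
  show ?thesis using left.pev_hom[OF vec_endo_app[of a] app_hom[of v], of p 1] by simp
qed

text \<open>With \<open>e\<close> the unit of \<open>range_has_unit\<close>, split \<open>v\<close>
  as \<open>v - e v\<close> plus \<open>e v\<close>. The first part is invariant since
  \<open>\<pi> x * e = \<pi> x\<close>, the second is moved since \<open>e\<close> is a sum of
  products starting with some \<open>\<pi> x\<close>. Conversely \<open>e\<close> fixes what is
  moved, and kills what is invariant since it is also a sum of products ending with some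
  \<open>\<pi> x\<close>.\<close>

theorem complete_reducibility:
  fixes V :: "('i \<Rightarrow> complex) set"
  assumes lie: "quadratic_lie_algebra scale bracket B E"
    and V: "fscale.subspace V" "V \<subseteq> fscale.span b" "finite b"
    and lin: "\<And>x. Vector_Spaces.linear fscale fscale (\<rho> x)"
    and stable: "\<And>x v. v \<in> V \<Longrightarrow> \<rho> x v \<in> V"
    and add: "\<And>x y v. v \<in> V \<Longrightarrow> \<rho> (x + y) v = \<rho> x v + \<rho> y v"
    and scl: "\<And>c x v. v \<in> V \<Longrightarrow> \<rho> (scale c x) v = fscale c (\<rho> x v)"
    and brk: "\<And>x y v. v \<in> V \<Longrightarrow> \<rho> (bracket x y) v = \<rho> x (\<rho> y v) - \<rho> y (\<rho> x v)"
  shows "\<And>v. v \<in> V \<Longrightarrow> \<exists>u\<in>V. (\<forall>x. \<rho> x u = 0) \<and> v - u \<in> fscale.span {\<rho> x w |x w. w \<in> V}"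
    and "\<And>w. w \<in> fscale.span {\<rho> x v |x v. v \<in> V} \<Longrightarrow> (\<And>x. \<rho> x w = 0) \<Longrightarrow> w = 0"
proof -
  interpret lie: quadratic_lie_algebra scale bracket B E by (rule lie)
  interpret \<rho>: Vector_Spaces.linear fscale fscale "\<rho> x" for x by (rule lin)
  interpret vector_space_pair fscale fscale by unfold_locales
  obtain b0 where b0: "b0 \<subseteq> V" "fscale.independent b0" "V \<subseteq> fscale.span b0"
    by (rule fscale.maximal_independent_subset)
  have span_b0: "fscale.span b0 = V" using b0 V(1) by (simp add: fscale.span_minimal subset_antisym)
  have fin: "finite b0"
    using fscale.independent_span_bound[OF V(3) b0(2)] b0(1) V(2) by auto
  obtain P where P: "range P \<subseteq> V" "Vector_Spaces.linear fscale fscale P" "\<And>v. v \<in> V \<Longrightarrow> P v = v"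
    using linear_exists_left_inverse_on[OF fscale.linear_id V(1)] by auto
  have PV: "P v \<in> V" for v using P(1) by blast
  \<comment> \<open>A copy of the endomorphism algebra of \<open>V\<close>: values in
    \<open>V\<close>, and determined by the restriction to \<open>V\<close> through the projection
    \<open>P\<close>.\<close>
  define K where "K = {a. (\<forall>v. app a v \<in> V) \<and> (\<forall>v. app a (P v) = app a v)}"
  define tr where "tr a = fscale.trace_on b0 (app a)" for a
  have KV: "app a v \<in> V" if "a \<in> K" for a v using that by (simp add: K_def)
  interpret app: Vector_Spaces.linear fscale fscale "app a" for a by (rule app_linear)
  interpret trace_algebra op_smult K tr "card b0"
  proof unfold_locales
    show "op_smult.subspace K"
      using V(1) by (intro op_smult.subspaceI)
        (auto simp: K_def fscale.subspace_0 fscale.subspace_add fscale.subspace_scale)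
  next
    fix a b assume ab: "a \<in> K" "b \<in> K"
    show "a * b \<in> K" using ab by (simp add: K_def)
    show "tr (a + b) = tr a + tr b"
      using fscale.trace_on_add[OF b0(2), of "app a" "app b"] KV ab
      by (simp add: tr_def span_b0 plus_lin_op.rep_eq)
    show "tr (a * b) = tr (b * a)"
      using fscale.trace_on_rectangular[OF fin b0(2) fin b0(2) app_linear[of b] _ app_linear[of a]] KV ab
      by (simp add: tr_def span_b0 times_lin_op.rep_eq)
  next
    fix a assume a: "a \<in> K"
    interpret a: vec_endo fscale "app a" by (rule vec_endo_app)
    show "\<exists>Z m. finite Z \<and> 0 \<in> Z \<and> 0 < m \<and>
        (\<forall>p. (\<forall>z\<in>Z. [:- z, 1:] ^ m dvd p) \<longrightarrow> vec_endo.pev op_smult ((*) a) p 1 = 0)"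
    proof -
      have "\<exists>Z m. finite Z \<and> 0 \<in> Z \<and> 0 < m \<and> (\<forall>p. (\<forall>z\<in>Z. [:- z, 1:] ^ m dvd p) \<longrightarrow> (\<forall>v. a.pev p v = 0))"
        by (rule a.ex_root_annihilator[OF fin]) (simp add: span_b0 KV a)
      then obtain Z m where Z: "finite Z" "0 \<in> Z" "0 < m"
        and ann: "\<forall>p. (\<forall>z\<in>Z. [:- z, 1:] ^ m dvd p) \<longrightarrow> (\<forall>v. a.pev p v = 0)"
        by (elim exE conjE) (rule that)
      have "vec_endo.pev op_smult ((*) a) p 1 = 0" if "\<forall>z\<in>Z. [:- z, 1:] ^ m dvd p" for p
        by (rule lin_op_eqI) (simp add: app_pev ann[rule_format, OF bspec[OF that]])
      with Z show ?thesis by (intro exI[of _ Z] exI[of _ m] conjI allI impI)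
    qed
    show "tr (op_smult c a) = c * tr a" for c
      using fscale.trace_on_scale[OF b0(2), of "app a" c] KV a
      by (simp add: tr_def span_b0 op_smult.rep_eq)
    show "tr a = 0" if "a ^ n = 0" for n
      unfolding tr_def
      using that KV[OF a] by (intro fscale.trace_on_nilpotent[OF fin b0(2) app_linear, of _ n])
        (simp_all add: span_b0 flip: app_power)
    show "\<exists>n\<le>card b0. tr a = of_nat n \<and> (n = 0 \<longrightarrow> a = 0)" if aa: "a * a = a"
    proof -
      have "app a (app a v) = app a v" for v using aa by (metis app_simps(5))
      then obtain n where n: "n \<le> card b0" "tr a = of_nat n" "n = 0 \<longrightarrow> (\<forall>v\<in>V. app a v = 0)"
        using fscale.trace_on_idempotent[OF fin b0(2) app_linear, of a] KV[OF a]
        by (auto simp: span_b0 tr_def)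
      have "a = 0" if "\<forall>v\<in>V. app a v = 0"
        by (rule lin_op_eqI) (use a that PV in \<open>force simp: K_def\<close>)
      with n show ?thesis by blast
    qed
  qed
  interpret P: Vector_Spaces.linear fscale fscale P by (rule P)
  \<comment> \<open>The laws of a representation hold on \<open>V\<close> only, hence the projection
    in front.\<close>
  define \<pi> where "\<pi> x = Abs_lin_op (\<lambda>v. \<rho> x (P v))" for x
  have app_\<pi>: "app (\<pi> x) v = \<rho> x (P v)" for x v
  proof -
    have "Vector_Spaces.linear fscale fscale (\<lambda>v. \<rho> x (P v))"
      by unfold_locales (simp_all add: P.add P.scale \<rho>.add \<rho>.scale)
    then show ?thesis by (simp add: \<pi>_def Abs_lin_op_inverse)
  qed
  have app_\<pi>_V: "app (\<pi> x) v = \<rho> x v" if "v \<in> V" for x v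
    using that by (simp add: app_\<pi> P(3))
  interpret traced_representation scale bracket B E op_smult K tr "card b0" \<pi>
  proof unfold_locales
    fix x y c
    show "\<pi> (x + y) = \<pi> x + \<pi> y" by (rule lin_op_eqI) (simp add: app_\<pi> add PV)
    show "\<pi> (scale c x) = op_smult c (\<pi> x)" by (rule lin_op_eqI) (simp add: app_\<pi> scl PV)
    show "\<pi> x \<in> K" by (simp add: K_def app_\<pi> stable PV P(3))
    show "\<pi> (bracket x y) = \<pi> x * \<pi> y - \<pi> y * \<pi> x"
      by (rule lin_op_eqI) (simp add: app_\<pi> brk PV P(3) stable)
  qed
  obtain e where e: "e \<in> K" "\<And>x. e * \<pi> x = \<pi> x" "\<And>x. \<pi> x * e = \<pi> x"
    and span1: "e \<in> op_smult.span {\<pi> x * r |x r. r \<in> K}"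
    and span2: "e \<in> op_smult.span {r * \<pi> x |x r. r \<in> K}"
    using range_has_unit by blast
  {
    fix v assume v: "v \<in> V"
    have "\<rho> x (v - app e v) = 0" for x
    proof -
      have "app (\<pi> x) (app e v) = app (\<pi> x) v" using e(3) by (metis app_simps(5))
      then show ?thesis using v KV[OF e(1)] by (simp add: app_\<pi>_V \<rho>.diff)
    qed
    moreover have "app e v \<in> fscale.span {\<rho> x w |x w. w \<in> V}" using span1
    proof (induction rule: op_smult.span_induct_alt)
      case (step c a y)
      then obtain x r where "a = \<pi> x * r" "r \<in> K" by blast
      then have "app a v = \<rho> x (app r v)" "app r v \<in> V" using KV by (auto simp: app_\<pi>_V)
      then have "app a v \<in> fscale.span {\<rho> x w |x w. w \<in> V}" by (intro fscale.span_base) blast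
      then show ?case using step.IH unfolding app_simps by (intro fscale.span_add fscale.span_scale)
    next
      case base
      show ?case unfolding app_simps by (rule fscale.span_zero)
    qed
    ultimately show "\<exists>u\<in>V. (\<forall>x. \<rho> x u = 0) \<and> v - u \<in> fscale.span {\<rho> x w |x w. w \<in> V}"
      using v V(1) KV[OF e(1)] by (intro bexI[of _ "v - app e v"]) (auto intro: fscale.subspace_diff)
  }
  {
    fix w assume w: "w \<in> fscale.span {\<rho> x v |x v. v \<in> V}" "\<And>x. \<rho> x w = 0"
    have "w \<in> V" using w(1) fscale.span_minimal[OF _ V(1), of "{\<rho> x v |x v. v \<in> V}"] stable by blast
    have "app e w = w" using w(1)
    proof (induction rule: fscale.span_induct_alt)
      case (step c z y)
      then obtain x v where z: "z = \<rho> x v" "v \<in> V" by blast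
      have "app e z = z" using e(2)[of x] z by (metis app_simps(5) app_\<pi>_V)
      then show ?case using step.IH by (simp only: app.add app.scale)
    qed (rule app.zero)
    moreover have "app e w = 0" using span2
    proof (induction rule: op_smult.span_induct_alt)
      case (step c a y)
      then obtain x r where "a = r * \<pi> x" by blast
      then have "app a w = 0" using w(2) \<open>w \<in> V\<close> by (simp add: app_\<pi>_V app.zero)
      then show ?case using step.IH by simp
    qed simp
    ultimately show "w = 0" by simp
  }
qed

section \<open>The wedge product by recursion\<close>

lemma map_permutation_Suc:
  assumes "\<tau> permutes {..<n}"
  shows "map_permutation {..<n} Suc \<tau> permutes {1..<Suc n}"
    and "map_permutation {..<n} Suc \<tau> 0 = 0"
    and "i < n \<Longrightarrow> map_permutation {..<n} Suc \<tau> (Suc i) = Suc (\<tau> i)"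
    and "sign (map_permutation {..<n} Suc \<tau>) = sign \<tau>"
proof -
  have "bij_betw Suc {..<n} {1..<Suc n}"
    by (auto simp: bij_betw_def lessThan_atLeast0)
  then show 1: "map_permutation {..<n} Suc \<tau> permutes {1..<Suc n}"
    by (rule map_permutation_permutes) (rule assms)
  show "map_permutation {..<n} Suc \<tau> 0 = 0"
    using permutes_not_in[OF 1, of 0] by simp
  show "map_permutation {..<n} Suc \<tau> (Suc i) = Suc (\<tau> i)" if "i < n"
    using that by (simp add: map_permutation_apply)
  show "sign (map_permutation {..<n} Suc \<tau>) = sign \<tau>"
    using assms by (intro sign_map_permutation) auto
qed

lemma sum_permutes_fixing_0:
  "(\<Sum>\<sigma> | \<sigma> permutes {..<Suc n} \<and> \<sigma> 0 = 0. h \<sigma>)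
    = (\<Sum>\<tau> | \<tau> permutes {..<n}. h (map_permutation {..<n} Suc \<tau>))"
proof (rule sum.reindex_bij_witness[where
    i = "map_permutation {..<n} Suc" and j = "map_permutation {1..<Suc n} (\<lambda>i. i - 1)"])
  have S: "bij_betw Suc {..<n} {1..<Suc n}"
    by (auto simp: bij_betw_def lessThan_atLeast0)
  have P: "bij_betw (\<lambda>i. i - 1) {1..<Suc n} {..<n}"
    by (rule bij_betwI[of _ _ _ Suc]) auto
  fix \<tau> assume "\<tau> \<in> {\<tau>. \<tau> permutes {..<n}}"
  then have \<tau>: "\<tau> permutes {..<n}" by simp
  have "map_permutation {1..<Suc n} (\<lambda>i. i - 1) (map_permutation {..<n} Suc \<tau>)
      = map_permutation {..<n} ((\<lambda>i. i - 1) \<circ> Suc) \<tau>"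
    using P by (intro map_permutation_compose[OF S]) (simp add: bij_betw_def)
  then show "map_permutation {1..<Suc n} (\<lambda>i. i - 1) (map_permutation {..<n} Suc \<tau>) = \<tau>"
    using \<tau> by (simp add: comp_def)
  show "map_permutation {..<n} Suc \<tau> \<in> {\<sigma>. \<sigma> permutes {..<Suc n} \<and> \<sigma> 0 = 0}"
    using permutes_subset[OF map_permutation_Suc(1)[OF \<tau>], of "{..<Suc n}"] map_permutation_Suc(2)[OF \<tau>]
    by force
next
  have S: "bij_betw Suc {..<n} {1..<Suc n}"
    by (auto simp: bij_betw_def lessThan_atLeast0)
  have P: "bij_betw (\<lambda>i. i - 1) {1..<Suc n} {..<n}"
    by (rule bij_betwI[of _ _ _ Suc]) auto
  fix \<sigma> assume "\<sigma> \<in> {\<sigma>. \<sigma> permutes {..<Suc n} \<and> \<sigma> 0 = 0}"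
  then have \<sigma>: "\<sigma> permutes {1..<Suc n}"
    by (auto intro!: permutes_superset[of _ "{..<Suc n}"] simp: not_le less_Suc0)
  show "map_permutation {1..<Suc n} (\<lambda>i. i - 1) \<sigma> \<in> {\<tau>. \<tau> permutes {..<n}}"
    using map_permutation_permutes[OF P \<sigma>] by simp
  have "map_permutation {..<n} Suc (map_permutation {1..<Suc n} (\<lambda>i. i - 1) \<sigma>)
      = map_permutation {1..<Suc n} (Suc \<circ> (\<lambda>i. i - 1)) \<sigma>"
    using S by (intro map_permutation_compose[OF P]) (simp add: bij_betw_def)
  also have "\<dots> = map_permutation {1..<Suc n} id \<sigma>"
    by (rule map_permutation_cong) (use \<sigma> in \<open>auto simp: inj_on_def\<close>)
  also have "\<dots> = \<sigma>" using \<sigma> by simp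
  finally show eq: "map_permutation {..<n} Suc (map_permutation {1..<Suc n} (\<lambda>i. i - 1) \<sigma>) = \<sigma>" .
  show "h (map_permutation {..<n} Suc (map_permutation {1..<Suc n} (\<lambda>i. i - 1) \<sigma>)) = h \<sigma>"
    by (simp only: eq)
qed

text \<open>The cycle that sends \<open>p\<close> to 0 and every \<open>i < p\<close> to
  \<open>Suc i\<close>. Composed on the right with a permutation fixing 0, it puts the first vector
  at position \<open>p\<close> and keeps the order of the others. Its sign is the cost of passing
  \<open>p\<close> arguments.\<close>

primrec cyc :: "nat \<Rightarrow> nat \<Rightarrow> nat" where
  "cyc 0 = id"
| "cyc (Suc p) = cyc p \<circ> Transposition.transpose p (Suc p)"

lemma cyc_apply: "cyc p i = (if i < p then Suc i else if i = p then 0 else i)"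
  by (induction p arbitrary: i) (auto simp: Transposition.transpose_def)

lemma cyc_permutes: "p \<le> n \<Longrightarrow> cyc p permutes {..<Suc n}"
  by (induction p) (auto intro!: permutes_compose permutes_swap_id permutes_id)

lemma sign_cyc: "sign (cyc p) = (-1) ^ p"
proof (induction p)
  case (Suc p)
  have "permutation (cyc p)" using cyc_permutes[of p p] permutation_permutes by blast
  then have "sign (cyc (Suc p)) = sign (cyc p) * sign (Transposition.transpose p (Suc p))"
    unfolding cyc.simps by (rule sign_compose[OF _ permutation_swap_id])
  then show ?case using Suc by (simp add: sign_swap_id del: cyc.simps)
qed simp

lemma sum_permutes_compose_right:
  assumes c: "c permutes S" and "c p = q"
  shows "(\<Sum>\<sigma> | \<sigma> permutes S \<and> \<sigma> p = r. h \<sigma>) = (\<Sum>\<sigma> | \<sigma> permutes S \<and> \<sigma> q = r. h (\<sigma> \<circ> c))"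
  by (rule sum.reindex_bij_witness[where i = "\<lambda>\<sigma>. \<sigma> \<circ> c" and j = "\<lambda>\<sigma>. \<sigma> \<circ> inv c"])
    (use assms in \<open>auto simp: comp_assoc permutes_inv_o permutes_compose permutes_inv permutes_inverses\<close>)

text \<open>Adjacent transpositions generate all others, see \<open>alternating_swap\<close>, and
  splitting the list suits induction better than indices.\<close>

definition alternating :: "('a list \<Rightarrow> 'b::ab_group_add) \<Rightarrow> bool" where
  "alternating f \<longleftrightarrow> (\<forall>xs y z zs. f (xs @ y # z # zs) = - f (xs @ z # y # zs))"

lemma alternatingD: "alternating f \<Longrightarrow> f (xs @ y # z # zs) = - f (xs @ z # y # zs)"
  unfolding alternating_def by blast

lemma alternating_move:
  fixes f :: "'a list \<Rightarrow> complex"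
  assumes "alternating f"
  shows "f (xs @ y # ms @ zs) = (-1) ^ length ms * f (xs @ ms @ y # zs)"
proof (induction ms arbitrary: xs)
  case (Cons m ms)
  have "f (xs @ y # (m # ms) @ zs) = - f ((xs @ [m]) @ y # ms @ zs)"
    using alternatingD[OF assms, of xs y m "ms @ zs"] by simp
  then show ?case by (simp only: Cons) simp
qed simp

text \<open>Move both entries past the block \<open>ms\<close> between them: the two signs cancel,
  and one adjacent exchange remains.\<close>

lemma alternating_swap:
  fixes f :: "'a list \<Rightarrow> complex"
  assumes "alternating f" "i < j" "j < length l"
  shows "f (l[i := l ! j, j := l ! i]) = - f l"
proof -
  define xs ms zs where "xs = take i l" "ms = take (j - Suc i) (drop (Suc i) l)" "zs = drop (Suc j) l"
  define y z where "y = l ! i" "z = l ! j"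
  have "drop (Suc i) l = ms @ z # zs"
    using assms(2,3) id_take_nth_drop[of "j - Suc i" "drop (Suc i) l"]
    by (simp add: xs_ms_zs_def y_z_def)
  then have l: "l = xs @ y # ms @ z # zs"
    using assms(2,3) id_take_nth_drop[of i l] by (simp add: xs_ms_zs_def y_z_def)
  have len: "length xs = i" "length ms = j - Suc i" using assms(2,3) by (auto simp: xs_ms_zs_def)
  have "l[i := z] = (xs @ z # ms) @ z # zs"
    using list_update_length[of xs y "ms @ z # zs" z] len(1) by (simp add: l)
  moreover have "j = length (xs @ z # ms)" using assms(2) len by simp
  ultimately have "l[i := z, j := y] = xs @ z # ms @ y # zs"
    using list_update_length[of "xs @ z # ms" z zs y] by simp
  moreover have "f (xs @ z # ms @ y # zs) = (-1) ^ length ms * f (xs @ ms @ z # y # zs)"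
    by (rule alternating_move[OF assms(1)])
  moreover have "f (xs @ ms @ z # y # zs) = - f (xs @ ms @ y # z # zs)"
    using alternatingD[OF assms(1), of "xs @ ms" z y zs] by simp
  moreover have "f (xs @ y # ms @ z # zs) = (-1) ^ length ms * f (xs @ ms @ y # z # zs)"
    using alternating_move[OF assms(1), of xs y ms "z # zs"] by simp
  ultimately show ?thesis unfolding y_z_def[symmetric] using l by simp
qed

text \<open>The grading automorphism. It carries the sign of superderivation rules for forms that
  are not homogeneous.\<close>

definition grade_sign :: "('a list \<Rightarrow> complex) \<Rightarrow> 'a list \<Rightarrow> complex" where
  "grade_sign f = (\<lambda>zs. (-1) ^ length zs * f zs)"

context
  fixes \<alpha> \<beta> :: "'a list \<Rightarrow> complex" and Y :: "'a list"
  assumes \<alpha>: "alternating \<alpha>" and \<beta>: "alternating \<beta>"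
begin

definition wedge_term :: "nat \<Rightarrow> (nat \<Rightarrow> nat) \<Rightarrow> complex" where
  "wedge_term p \<sigma> = of_int (sign \<sigma>) * \<alpha> (map (\<lambda>i. Y ! \<sigma> i) [0..<p]) * \<beta> (map (\<lambda>i. Y ! \<sigma> i) [p..<length Y])"

text \<open>Exchanging two positions inside one factor changes the sign of the permutation and the
  value of that factor.\<close>

lemma wedge_term_transpose:
  assumes \<sigma>: "\<sigma> permutes {..<length Y}" and ij: "i < j"
    and "j < p \<or> p \<le> i" "j < length Y" "p \<le> length Y"
  shows "wedge_term p (\<sigma> \<circ> Transposition.transpose i j) = wedge_term p \<sigma>"
proof -
  let ?t = "Transposition.transpose i j"
  have "permutation \<sigma>" using \<sigma> permutation_permutes by blast
  then have sgn: "sign (\<sigma> \<circ> ?t) = - sign \<sigma>"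
    using ij by (simp add: sign_compose permutation_swap_id sign_swap_id)
  consider "j < p" | "p \<le> i" using assms(3) by blast
  then show ?thesis
  proof cases
    case 1
    define l where "l = map (\<lambda>i. Y ! \<sigma> i) [0..<p]"
    have e1: "map (\<lambda>k. Y ! (\<sigma> \<circ> ?t) k) [0..<p] = l[i := l ! j, j := l ! i]"
      using 1 ij by (intro nth_equalityI) (auto simp: l_def Transposition.transpose_def nth_list_update)
    have e2: "map (\<lambda>k. Y ! (\<sigma> \<circ> ?t) k) [p..<length Y] = map (\<lambda>k. Y ! \<sigma> k) [p..<length Y]"
      using 1 ij by (intro map_cong) (auto simp: Transposition.transpose_def)
    have e3: "\<alpha> (l[i := l ! j, j := l ! i]) = - \<alpha> l"
      by (rule alternating_swap[OF \<alpha> ij]) (use 1 in \<open>simp add: l_def\<close>)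
    show ?thesis unfolding wedge_term_def sgn e1 e2 e3 by (simp add: l_def)
  next
    case 2
    define l where "l = map (\<lambda>i. Y ! \<sigma> i) [p..<length Y]"
    have e1: "map (\<lambda>k. Y ! (\<sigma> \<circ> ?t) k) [p..<length Y] = l[i - p := l ! (j - p), j - p := l ! (i - p)]"
      using 2 ij assms by (intro nth_equalityI) (auto simp: l_def Transposition.transpose_def nth_list_update)
    have e2: "map (\<lambda>k. Y ! (\<sigma> \<circ> ?t) k) [0..<p] = map (\<lambda>k. Y ! \<sigma> k) [0..<p]"
      using 2 ij by (intro map_cong) (auto simp: Transposition.transpose_def)
    have e3: "\<beta> (l[i - p := l ! (j - p), j - p := l ! (i - p)]) = - \<beta> l"
      by (rule alternating_swap[OF \<beta>]) (use 2 ij assms in \<open>auto simp: l_def\<close>)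
    show ?thesis unfolding wedge_term_def sgn e1 e2 e3 by (simp add: l_def)
  qed
qed

text \<open>The permutations are sorted according to the position of the first vector.\<close>

lemma sum_wedge_term:
  assumes p: "p \<le> length Y" and len: "length Y = Suc n"
  shows "(\<Sum>\<sigma> | \<sigma> permutes {..<length Y}. wedge_term p \<sigma>)
    = of_nat p * (\<Sum>\<sigma> | \<sigma> permutes {..<length Y} \<and> \<sigma> 0 = 0. wedge_term p \<sigma>)
    + of_nat (length Y - p) * (\<Sum>\<sigma> | \<sigma> permutes {..<length Y} \<and> \<sigma> p = 0. wedge_term p \<sigma>)"
proof -
  let ?S = "{..<length Y}"
  define A where "A j = (\<Sum>\<sigma> | \<sigma> permutes ?S \<and> \<sigma> j = 0. wedge_term p \<sigma>)" for j
  \<comment> \<open>Positions in the same factor are interchangeable, so \<open>A\<close> has one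
    value on the \<open>p\<close> positions of \<alpha> and one on the positions of \<beta>.\<close>
  have A_eq: "A j = A i" if "i \<le> j" "j < p \<or> p \<le> i" "j < length Y" for i j
  proof (cases "i = j")
    case False
    have "A j = (\<Sum>\<sigma> | \<sigma> permutes ?S \<and> \<sigma> i = 0. wedge_term p (\<sigma> \<circ> Transposition.transpose i j))"
      unfolding A_def using that by (intro sum_permutes_compose_right permutes_swap_id) auto
    also have "\<dots> = A i"
      unfolding A_def using that False p by (intro sum.cong refl wedge_term_transpose) auto
    finally show ?thesis .
  qed simp
  have fin: "finite {\<sigma>. \<sigma> permutes ?S}" by (rule finite_permutations) simp
  have "(\<Sum>\<sigma> | \<sigma> permutes ?S. wedge_term p \<sigma>) = (\<Sum>j\<in>?S. \<Sum>\<sigma> | \<sigma> \<in> {\<sigma>. \<sigma> permutes ?S} \<and> inv \<sigma> 0 = j. wedge_term p \<sigma>)"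
  proof (rule sum.group[symmetric, OF fin])
    have "inv \<sigma> 0 < length Y" if "\<sigma> permutes ?S" for \<sigma>
      using permutes_in_image[OF permutes_inv[OF that], of 0] len by simp
    then show "(\<lambda>\<sigma>. inv \<sigma> 0) ` {\<sigma>. \<sigma> permutes ?S} \<subseteq> ?S" by auto
  qed simp
  also have "\<dots> = (\<Sum>j\<in>?S. A j)"
  proof (intro sum.cong refl)
    fix j
    have "inv \<sigma> 0 = j \<longleftrightarrow> \<sigma> j = 0" if "\<sigma> permutes ?S" for \<sigma>
      by (rule permutes_inv_eq[OF that])
    then have "{\<sigma>. \<sigma> \<in> {\<sigma>. \<sigma> permutes ?S} \<and> inv \<sigma> 0 = j} = {\<sigma>. \<sigma> permutes ?S \<and> \<sigma> j = 0}" by auto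
    then show "(\<Sum>\<sigma> | \<sigma> \<in> {\<sigma>. \<sigma> permutes ?S} \<and> inv \<sigma> 0 = j. wedge_term p \<sigma>) = A j" by (simp only: A_def)
  qed
  also have "\<dots> = (\<Sum>j\<in>{..<p} \<union> {p..<length Y}. A j)"
    using p by (intro sum.cong) auto
  also have "\<dots> = (\<Sum>j<p. A j) + (\<Sum>j = p..<length Y. A j)"
    by (intro sum.union_disjoint) auto
  also have "(\<Sum>j<p. A j) = (\<Sum>j<p. A 0)" 
    using p by (intro sum.cong[OF refl] A_eq) auto
  also have "(\<Sum>j = p..<length Y. A j) = (\<Sum>j = p..<length Y. A p)"
    by (intro sum.cong[OF refl] A_eq) auto
  finally show ?thesis by (simp add: A_def)
qed

end

lemma wedge_Nil: "wedge \<alpha> \<beta> [] = \<alpha> [] * \<beta> []"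
  by (simp add: wedge_def)

text \<open>The superderivation rule for \<open>\<iota> y\<close>. If \<open>y\<close> lands in
  \<alpha>, the multiplicity \<open>p\<close> from \<open>sum_wedge_term\<close> reduces
  \<open>fact p\<close>; if it lands in \<beta>, the multiplicity \<open>Suc n - p\<close> reduces
  the other factorial, and \<open>cyc p\<close> brings \<open>y\<close> to the front of \<beta> at
  the cost of \<open>(-1) ^ p\<close>, which becomes \<open>grade_sign\<close>.\<close>

theorem wedge_Cons:
  assumes \<alpha>: "alternating \<alpha>" and \<beta>: "alternating \<beta>"
  shows "wedge \<alpha> \<beta> (y # ys)
    = wedge (interior_product y \<alpha>) \<beta> ys + wedge (grade_sign \<alpha>) (interior_product y \<beta>) ys"
proof -
  define n where "n = length ys"
  let ?Y = "y # ys"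
  define trm where "trm = wedge_term \<alpha> \<beta> ?Y"
  have trm_def: "trm p \<sigma> = of_int (sign \<sigma>) * \<alpha> (map (\<lambda>i. ?Y ! \<sigma> i) [0..<p]) * \<beta> (map (\<lambda>i. ?Y ! \<sigma> i) [p..<Suc n])" for p \<sigma>
    unfolding \<open>trm = _\<close> wedge_term_def[OF \<alpha> \<beta>] by (simp add: n_def del: upt_Suc)
  define G where "G p = (\<Sum>\<tau> | \<tau> permutes {..<n}. of_int (sign \<tau>) *
      interior_product y \<alpha> (map (\<lambda>i. ys ! \<tau> i) [0..<p]) * \<beta> (map (\<lambda>i. ys ! \<tau> i) [p..<n]))" for p
  define H where "H p = (\<Sum>\<tau> | \<tau> permutes {..<n}. of_int (sign \<tau>) *
      grade_sign \<alpha> (map (\<lambda>i. ys ! \<tau> i) [0..<p]) * interior_product y \<beta> (map (\<lambda>i. ys ! \<tau> i) [p..<n]))" for p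
  have G: "(\<Sum>\<sigma> | \<sigma> permutes {..<Suc n} \<and> \<sigma> 0 = 0. trm (Suc p) \<sigma>) = G p" if "p \<le> n" for p
    unfolding sum_permutes_fixing_0 G_def
  proof (intro sum.cong refl)
    fix \<tau> assume "\<tau> \<in> {\<tau>. \<tau> permutes {..<n}}"
    then have \<tau>: "\<tau> permutes {..<n}" by simp
    let ?s = "map_permutation {..<n} Suc \<tau>"
    have "map (\<lambda>i. ?Y ! ?s i) [0..<Suc p] = y # map (\<lambda>i. ys ! \<tau> i) [0..<p]"
      using that map_permutation_Suc[OF \<tau>] by (intro nth_equalityI) (auto simp: nth_Cons' gr0_conv_Suc simp del: upt_Suc)
    moreover have "map (\<lambda>i. ?Y ! ?s i) [Suc p..<Suc n] = map (\<lambda>i. ys ! \<tau> i) [p..<n]"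
      using that map_permutation_Suc[OF \<tau>] by (intro nth_equalityI) (auto simp del: upt_Suc)
    ultimately show "trm (Suc p) ?s = of_int (sign \<tau>) * interior_product y \<alpha> (map (\<lambda>i. ys ! \<tau> i) [0..<p])
        * \<beta> (map (\<lambda>i. ys ! \<tau> i) [p..<n])"
      unfolding trm_def by (simp add: map_permutation_Suc(4)[OF \<tau>] interior_product_def del: upt_Suc)
  qed
  have H: "(\<Sum>\<sigma> | \<sigma> permutes {..<Suc n} \<and> \<sigma> p = 0. trm p \<sigma>) = H p" if "p \<le> n" for p
  proof -
    have "(\<Sum>\<sigma> | \<sigma> permutes {..<Suc n} \<and> \<sigma> p = 0. trm p \<sigma>)
        = (\<Sum>\<sigma> | \<sigma> permutes {..<Suc n} \<and> \<sigma> 0 = 0. trm p (\<sigma> \<circ> cyc p))"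
      by (rule sum_permutes_compose_right) (use that in \<open>auto simp: cyc_permutes cyc_apply\<close>)
    also have "\<dots> = H p"
      unfolding sum_permutes_fixing_0 H_def
    proof (intro sum.cong refl)
      fix \<tau> assume "\<tau> \<in> {\<tau>. \<tau> permutes {..<n}}"
      then have \<tau>: "\<tau> permutes {..<n}" by simp
      let ?s = "map_permutation {..<n} Suc \<tau>"
      have e1: "map (\<lambda>i. ?Y ! (?s \<circ> cyc p) i) [0..<p] = map (\<lambda>i. ys ! \<tau> i) [0..<p]"
        using that map_permutation_Suc[OF \<tau>] by (intro nth_equalityI) (auto simp: cyc_apply)
      have e2: "map (\<lambda>i. ?Y ! (?s \<circ> cyc p) i) [p..<Suc n] = y # map (\<lambda>i. ys ! \<tau> i) [p..<n]"
        using that map_permutation_Suc[OF \<tau>]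
        by (intro nth_equalityI) (auto simp: cyc_apply nth_Cons' gr0_conv_Suc Suc_diff_le simp del: upt_Suc)
      have e3: "sign (?s \<circ> cyc p) = (-1) ^ p * sign \<tau>"
      proof -
        have "permutation ?s" using map_permutation_Suc(1)[OF \<tau>] permutation_permutes by blast
        moreover have "permutation (cyc p)" using cyc_permutes[of p p] permutation_permutes by blast
        ultimately show ?thesis by (simp add: sign_compose sign_cyc map_permutation_Suc(4)[OF \<tau>])
      qed
      show "trm p (?s \<circ> cyc p) = of_int (sign \<tau>) * grade_sign \<alpha> (map (\<lambda>i. ys ! \<tau> i) [0..<p])
          * interior_product y \<beta> (map (\<lambda>i. ys ! \<tau> i) [p..<n])"
        unfolding trm_def e1 e2 e3 by (simp add: interior_product_def grade_sign_def del: upt_Suc)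
    qed
    finally show ?thesis .
  qed
  have split: "(\<Sum>\<sigma> | \<sigma> permutes {..<Suc n}. trm p \<sigma>)
      = of_nat p * (\<Sum>\<sigma> | \<sigma> permutes {..<Suc n} \<and> \<sigma> 0 = 0. trm p \<sigma>)
      + of_nat (Suc n - p) * (\<Sum>\<sigma> | \<sigma> permutes {..<Suc n} \<and> \<sigma> p = 0. trm p \<sigma>)" if "p \<le> Suc n" for p
    using sum_wedge_term[OF \<alpha> \<beta>, of p ?Y n] that by (simp add: \<open>trm = _\<close> n_def)
  have "wedge \<alpha> \<beta> ?Y = (\<Sum>p\<le>Suc n. (\<Sum>\<sigma> | \<sigma> permutes {..<Suc n}. trm p \<sigma>) / (fact p * fact (Suc n - p)))"
    by (simp add: wedge_def trm_def n_def del: sum.atMost_Suc upt_Suc)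
  also have "\<dots> = (\<Sum>p\<le>Suc n. of_nat p * (\<Sum>\<sigma> | \<sigma> permutes {..<Suc n} \<and> \<sigma> 0 = 0. trm p \<sigma>) / (fact p * fact (Suc n - p)))
      + (\<Sum>p\<le>Suc n. of_nat (Suc n - p) * (\<Sum>\<sigma> | \<sigma> permutes {..<Suc n} \<and> \<sigma> p = 0. trm p \<sigma>) / (fact p * fact (Suc n - p)))"
    by (simp add: split add_divide_distrib sum.distrib del: sum.atMost_Suc)
  also have "(\<Sum>p\<le>Suc n. of_nat p * (\<Sum>\<sigma> | \<sigma> permutes {..<Suc n} \<and> \<sigma> 0 = 0. trm p \<sigma>) / (fact p * fact (Suc n - p)))
      = (\<Sum>p\<le>n. G p / (fact p * fact (n - p)))"
    by (subst sum.atMost_Suc_shift) (auto intro!: sum.cong simp: G simp del: of_nat_Suc)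
  also have "(\<Sum>p\<le>Suc n. of_nat (Suc n - p) * (\<Sum>\<sigma> | \<sigma> permutes {..<Suc n} \<and> \<sigma> p = 0. trm p \<sigma>) / (fact p * fact (Suc n - p)))
      = (\<Sum>p\<le>n. H p / (fact p * fact (n - p)))"
    by (subst sum.atMost_Suc) (auto intro!: sum.cong simp: H Suc_diff_le simp del: of_nat_Suc)
  also have "(\<Sum>p\<le>n. G p / (fact p * fact (n - p))) = wedge (interior_product y \<alpha>) \<beta> ys"
    by (simp add: wedge_def Let_def G_def n_def)
  also have "(\<Sum>p\<le>n. H p / (fact p * fact (n - p))) = wedge (grade_sign \<alpha>) (interior_product y \<beta>) ys"
    by (simp add: wedge_def Let_def H_def n_def)
  finally show ?thesis .
qed

section \<open>Calculus of forms as functions on lists\<close>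

abbreviation \<iota> :: "'a \<Rightarrow> ('a list \<Rightarrow> complex) \<Rightarrow> 'a list \<Rightarrow> complex" where
  "\<iota> \<equiv> interior_product"

lemma interior_product_apply: "\<iota> x \<Omega> ys = \<Omega> (x # ys)"
  by (simp add: interior_product_def)

lemma grade_sign_apply: "grade_sign \<Omega> ys = (-1) ^ length ys * \<Omega> ys"
  by (simp add: grade_sign_def)

lemmas form_ops_apply = interior_product_apply grade_sign_apply

lemma grade_sign_grade_sign [simp]: "grade_sign (grade_sign \<Omega>) = \<Omega>"
  by (rule ext) (simp add: grade_sign_apply flip: power_mult_distrib mult.assoc)

lemma alternatingI:
  "(\<And>xs y z zs. f (xs @ y # z # zs) = - f (xs @ z # y # zs)) \<Longrightarrow> alternating f"
  unfolding alternating_def by blast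

lemma alternating_interior_product:
  assumes "alternating \<Omega>"
  shows "alternating (\<iota> x \<Omega>)"
proof (rule alternatingI)
  show "\<iota> x \<Omega> (xs @ y # z # zs) = - \<iota> x \<Omega> (xs @ z # y # zs)" for xs y z zs
    using alternatingD[OF assms, of "x # xs" y z zs] by (simp add: form_ops_apply)
qed

lemma alternating_grade_sign:
  assumes "alternating \<Omega>"
  shows "alternating (grade_sign \<Omega>)"
proof (rule alternatingI)
  show "grade_sign \<Omega> (xs @ y # z # zs) = - grade_sign \<Omega> (xs @ z # y # zs)" for xs y z zs
    using alternatingD[OF assms, of xs y z zs] by (simp add: form_ops_apply)
qed

text \<open>The superderivation rule taken as a definition, so that identities of products follow by
  induction on the argument list. Agreement with \<open>wedge\<close> is only claimed for
  alternating factors.\<close>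

fun rec_wedge :: "('a list \<Rightarrow> complex) \<Rightarrow> ('a list \<Rightarrow> complex) \<Rightarrow> 'a list \<Rightarrow> complex" where
  "rec_wedge \<alpha> \<beta> [] = \<alpha> [] * \<beta> []"
| "rec_wedge \<alpha> \<beta> (y # ys) = rec_wedge (\<iota> y \<alpha>) \<beta> ys + rec_wedge (grade_sign \<alpha>) (\<iota> y \<beta>) ys"

lemma wedge_eq_rec_wedge: "alternating \<alpha> \<Longrightarrow> alternating \<beta> \<Longrightarrow> wedge \<alpha> \<beta> ys = rec_wedge \<alpha> \<beta> ys"
  by (induction ys arbitrary: \<alpha> \<beta>)
    (simp_all add: wedge_Nil wedge_Cons alternating_interior_product alternating_grade_sign)

lemma rec_wedge_lincomb_left:
  assumes "\<And>zs. \<gamma> zs = a * \<alpha> zs + b * \<beta> zs"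
  shows "rec_wedge \<gamma> \<delta> ys = a * rec_wedge \<alpha> \<delta> ys + b * rec_wedge \<beta> \<delta> ys"
  using assms
proof (induction ys arbitrary: \<alpha> \<beta> \<gamma> \<delta>)
  case (Cons y ys)
  have "rec_wedge (\<iota> y \<gamma>) \<delta> ys = a * rec_wedge (\<iota> y \<alpha>) \<delta> ys + b * rec_wedge (\<iota> y \<beta>) \<delta> ys"
    by (rule Cons.IH) (simp add: form_ops_apply Cons.prems)
  moreover have "rec_wedge (grade_sign \<gamma>) (\<iota> y \<delta>) ys
      = a * rec_wedge (grade_sign \<alpha>) (\<iota> y \<delta>) ys + b * rec_wedge (grade_sign \<beta>) (\<iota> y \<delta>) ys"
    by (rule Cons.IH) (simp add: form_ops_apply Cons.prems algebra_simps)
  ultimately show ?case by (simp add: algebra_simps)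
qed (simp add: algebra_simps)

lemma rec_wedge_lincomb_right:
  assumes "\<And>zs. \<gamma> zs = a * \<alpha> zs + b * \<beta> zs"
  shows "rec_wedge \<delta> \<gamma> ys = a * rec_wedge \<delta> \<alpha> ys + b * rec_wedge \<delta> \<beta> ys"
  using assms
proof (induction ys arbitrary: \<alpha> \<beta> \<gamma> \<delta>)
  case (Cons y ys)
  have "rec_wedge (grade_sign \<delta>) (\<iota> y \<gamma>) ys
      = a * rec_wedge (grade_sign \<delta>) (\<iota> y \<alpha>) ys + b * rec_wedge (grade_sign \<delta>) (\<iota> y \<beta>) ys"
    by (rule Cons.IH) (simp add: form_ops_apply Cons.prems algebra_simps)
  then show ?case using Cons.IH[OF Cons.prems] by (simp add: algebra_simps)
qed (simp add: algebra_simps)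

lemma rec_wedge_0_left: "(\<And>zs. \<alpha> zs = 0) \<Longrightarrow> rec_wedge \<alpha> \<beta> ys = 0"
  using rec_wedge_lincomb_left[of \<alpha> 0 \<alpha> 0 \<alpha> \<beta> ys] by simp

lemma rec_wedge_0_right: "(\<And>zs. \<beta> zs = 0) \<Longrightarrow> rec_wedge \<alpha> \<beta> ys = 0"
  using rec_wedge_lincomb_right[of \<beta> 0 \<beta> 0 \<beta> \<alpha> ys] by simp

lemma rec_wedge_sum_left:
  assumes "\<And>zs. \<gamma> zs = (\<Sum>i\<in>I. \<alpha> i zs)"
  shows "rec_wedge \<gamma> \<delta> ys = (\<Sum>i\<in>I. rec_wedge (\<alpha> i) \<delta> ys)"
  using assms
proof (induction I arbitrary: \<gamma> rule: infinite_finite_induct)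
  case (insert i I)
  have "rec_wedge \<gamma> \<delta> ys = 1 * rec_wedge (\<alpha> i) \<delta> ys + 1 * rec_wedge (\<lambda>zs. \<Sum>i\<in>I. \<alpha> i zs) \<delta> ys"
    by (rule rec_wedge_lincomb_left) (simp add: insert)
  moreover have "rec_wedge (\<lambda>zs. \<Sum>i\<in>I. \<alpha> i zs) \<delta> ys = (\<Sum>i\<in>I. rec_wedge (\<alpha> i) \<delta> ys)"
    by (rule insert.IH) simp
  ultimately show ?case using insert.hyps by simp
qed (auto intro: rec_wedge_0_left)

lemma rec_wedge_sum_right:
  assumes "\<And>zs. \<gamma> zs = (\<Sum>i\<in>I. \<alpha> i zs)"
  shows "rec_wedge \<delta> \<gamma> ys = (\<Sum>i\<in>I. rec_wedge \<delta> (\<alpha> i) ys)"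
  using assms
proof (induction I arbitrary: \<gamma> rule: infinite_finite_induct)
  case (insert i I)
  have "rec_wedge \<delta> \<gamma> ys = 1 * rec_wedge \<delta> (\<alpha> i) ys + 1 * rec_wedge \<delta> (\<lambda>zs. \<Sum>i\<in>I. \<alpha> i zs) ys"
    by (rule rec_wedge_lincomb_right) (simp add: insert)
  moreover have "rec_wedge \<delta> (\<lambda>zs. \<Sum>i\<in>I. \<alpha> i zs) ys = (\<Sum>i\<in>I. rec_wedge \<delta> (\<alpha> i) ys)"
    by (rule insert.IH) simp
  ultimately show ?case using insert.hyps by simp
qed (auto intro: rec_wedge_0_right)

context complex_space
begin

definition multilinear :: "('v list \<Rightarrow> complex) \<Rightarrow> bool" where
  "multilinear f \<longleftrightarrow> (\<forall>xs y z ys c. f (xs @ (y + z) # ys) = f (xs @ y # ys) + f (xs @ z # ys) \<and>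
     f (xs @ scale c y # ys) = c * f (xs @ y # ys))"

text \<open>The conditions are imposed in all degrees at once and no bound on the degree is asked
  for: in finite dimension it is automatic, by \<open>form_bounded\<close>.\<close>

definition form :: "('v list \<Rightarrow> complex) \<Rightarrow> bool" where
  "form f \<longleftrightarrow> multilinear f \<and> alternating f"

lemma multilinear_add: "multilinear f \<Longrightarrow> f (xs @ (y + z) # ys) = f (xs @ y # ys) + f (xs @ z # ys)"
  and multilinear_scale: "multilinear f \<Longrightarrow> f (xs @ scale c y # ys) = c * f (xs @ y # ys)"
  unfolding multilinear_def by blast+

lemma multilinearI:
  assumes "\<And>xs y z ys. f (xs @ (y + z) # ys) = f (xs @ y # ys) + f (xs @ z # ys)"
    and "\<And>xs c y ys. f (xs @ scale c y # ys) = c * f (xs @ y # ys)"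
  shows "multilinear f"
  using assms unfolding multilinear_def by blast

lemma multilinear_interior_product:
  assumes "multilinear f"
  shows "multilinear (\<iota> x f)"
proof (rule multilinearI)
  fix xs y z ys c
  show "\<iota> x f (xs @ (y + z) # ys) = \<iota> x f (xs @ y # ys) + \<iota> x f (xs @ z # ys)"
    using multilinear_add[OF assms, of "x # xs"] by (simp add: form_ops_apply)
  show "\<iota> x f (xs @ scale c y # ys) = c * \<iota> x f (xs @ y # ys)"
    using multilinear_scale[OF assms, of "x # xs"] by (simp add: form_ops_apply)
qed

lemma form_interior_product: "form f \<Longrightarrow> form (\<iota> x f)"
  by (simp add: form_def multilinear_interior_product alternating_interior_product)

lemma multilinear_grade_sign: "multilinear f \<Longrightarrow> multilinear (grade_sign f)"
  by (rule multilinearI) (simp_all add: grade_sign_apply multilinear_add multilinear_scale algebra_simps)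

lemma form_grade_sign: "form f \<Longrightarrow> form (grade_sign f)"
  by (simp add: form_def multilinear_grade_sign alternating_grade_sign)

lemma formI:
  assumes "\<And>xs y z ys. f (xs @ (y + z) # ys) = f (xs @ y # ys) + f (xs @ z # ys)"
    and "\<And>xs c y ys. f (xs @ scale c y # ys) = c * f (xs @ y # ys)"
    and "\<And>xs y z zs. f (xs @ y # z # zs) = - f (xs @ z # y # zs)"
  shows "form f"
  unfolding form_def using assms by (intro conjI multilinearI alternatingI)

lemma form_add: "form f \<Longrightarrow> f (xs @ (y + z) # ys) = f (xs @ y # ys) + f (xs @ z # ys)"
  and form_scale: "form f \<Longrightarrow> f (xs @ scale c y # ys) = c * f (xs @ y # ys)"
  and form_swap: "form f \<Longrightarrow> f (xs @ y # z # zs) = - f (xs @ z # y # zs)"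
  unfolding form_def by (blast intro: multilinear_add multilinear_scale alternatingD)+

lemma form_lincomb:
  assumes "form f" "form g"
  shows "form (\<lambda>ys. a * f ys + b * g ys)"
proof (rule formI)
  fix xs y z ys c
  show "a * f (xs @ y # z # ys) + b * g (xs @ y # z # ys) = - (a * f (xs @ z # y # ys) + b * g (xs @ z # y # ys))"
    using form_swap[OF assms(1), of xs y z ys] form_swap[OF assms(2), of xs y z ys] by simp
qed (simp_all add: form_add form_scale assms algebra_simps)

lemma form_0: "form (\<lambda>ys. 0)"
  by (rule formI) simp_all

lemma form_sum: "(\<And>i. i \<in> I \<Longrightarrow> form (f i)) \<Longrightarrow> form (\<lambda>ys. \<Sum>i\<in>I. f i ys)"
proof (induction I rule: infinite_finite_induct)
  case (insert i I)
  then show ?case using form_lincomb[of "f i" "\<lambda>ys. \<Sum>i\<in>I. f i ys" 1 1] by simp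
qed (simp_all add: form_0)

lemma form_head_add: "form f \<Longrightarrow> f ((y + z) # ys) = f (y # ys) + f (z # ys)"
  using multilinear_add[of f "[]"] by (simp add: form_def)

lemma form_head_scale: "form f \<Longrightarrow> f (scale c y # ys) = c * f (y # ys)"
  using multilinear_scale[of f "[]"] by (simp add: form_def)

lemma form_head_minus: "form f \<Longrightarrow> f (- y # ys) = - f (y # ys)"
  using form_head_scale[of f "- 1" y ys] by simp

lemma form_head_swap: "form f \<Longrightarrow> f (y # z # ys) = - f (z # y # ys)"
  using form_swap[of f "[]" y z ys] by simp

lemma form_rec_wedge:
  assumes "form \<alpha>" "form \<beta>"
  shows "form (rec_wedge \<alpha> \<beta>)"
proof (rule formI)
  fix xs y z ys c
  show "rec_wedge \<alpha> \<beta> (xs @ (y + z) # ys) = rec_wedge \<alpha> \<beta> (xs @ y # ys) + rec_wedge \<alpha> \<beta> (xs @ z # ys)"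
    using assms
  proof (induction xs arbitrary: \<alpha> \<beta>)
    case Nil
    have "rec_wedge (\<iota> (y + z) \<alpha>) \<beta> ys = 1 * rec_wedge (\<iota> y \<alpha>) \<beta> ys + 1 * rec_wedge (\<iota> z \<alpha>) \<beta> ys"
      by (rule rec_wedge_lincomb_left) (simp add: form_ops_apply form_head_add Nil)
    moreover have "rec_wedge (grade_sign \<alpha>) (\<iota> (y + z) \<beta>) ys
        = 1 * rec_wedge (grade_sign \<alpha>) (\<iota> y \<beta>) ys + 1 * rec_wedge (grade_sign \<alpha>) (\<iota> z \<beta>) ys"
      by (rule rec_wedge_lincomb_right) (simp add: form_ops_apply form_head_add Nil)
    ultimately show ?case by simp
  qed (simp add: form_interior_product form_grade_sign)
  show "rec_wedge \<alpha> \<beta> (xs @ scale c y # ys) = c * rec_wedge \<alpha> \<beta> (xs @ y # ys)"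
    using assms
  proof (induction xs arbitrary: \<alpha> \<beta>)
    case Nil
    have "rec_wedge (\<iota> (scale c y) \<alpha>) \<beta> ys = c * rec_wedge (\<iota> y \<alpha>) \<beta> ys + 0 * rec_wedge (\<iota> y \<alpha>) \<beta> ys"
      by (rule rec_wedge_lincomb_left) (simp add: form_ops_apply form_head_scale Nil)
    moreover have "rec_wedge (grade_sign \<alpha>) (\<iota> (scale c y) \<beta>) ys
        = c * rec_wedge (grade_sign \<alpha>) (\<iota> y \<beta>) ys + 0 * rec_wedge (grade_sign \<alpha>) (\<iota> y \<beta>) ys"
      by (rule rec_wedge_lincomb_right) (simp add: form_ops_apply form_head_scale Nil)
    ultimately show ?case by (simp add: algebra_simps)
  qed (simp add: form_interior_product form_grade_sign algebra_simps)
next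
  fix xs y z zs
  show "rec_wedge \<alpha> \<beta> (xs @ y # z # zs) = - rec_wedge \<alpha> \<beta> (xs @ z # y # zs)"
    using assms
  proof (induction xs arbitrary: \<alpha> \<beta>)
    case Nil
    have 1: "rec_wedge (\<iota> z (\<iota> y \<alpha>)) \<beta> zs = - 1 * rec_wedge (\<iota> y (\<iota> z \<alpha>)) \<beta> zs + 0 * rec_wedge \<alpha> \<beta> zs"
      by (rule rec_wedge_lincomb_left) (simp add: form_ops_apply form_head_swap[OF Nil(1), of y z])
    have 2: "rec_wedge \<alpha> (\<iota> z (\<iota> y \<beta>)) zs = - 1 * rec_wedge \<alpha> (\<iota> y (\<iota> z \<beta>)) zs + 0 * rec_wedge \<alpha> \<beta> zs"
      by (rule rec_wedge_lincomb_right) (simp add: form_ops_apply form_head_swap[OF Nil(2), of y z])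
    \<comment> \<open>Interior products anticommute with \<open>grade_sign\<close>, so the two mixed
      terms of the expansion are exchanged with a sign.\<close>
    have 3: "rec_wedge (\<iota> z (grade_sign \<alpha>)) \<delta> zs = - 1 * rec_wedge (grade_sign (\<iota> z \<alpha>)) \<delta> zs + 0 * rec_wedge \<alpha> \<delta> zs" for z \<delta>
      by (rule rec_wedge_lincomb_left) (simp add: form_ops_apply)
    show ?case by (simp add: 1 2 3)
  qed (simp add: form_interior_product form_grade_sign)
qed

lemma skew_multilinear_slot:
  assumes "skew_multilinear scale s p f" "length xs + length ys + 1 = p"
  shows "Vector_Spaces.linear scale s (\<lambda>y. f (xs @ y # ys))"
proof -
  have "length (xs @ 0 # ys) = p \<and> length xs < p" using assms(2) by simp
  then have "Vector_Spaces.linear scale s (\<lambda>y. f ((xs @ 0 # ys)[length xs := y]))"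
    using assms(1) unfolding skew_multilinear_def by blast
  then show ?thesis by simp
qed

lemma skew_multilinear_swap:
  assumes "skew_multilinear scale s p f" "length xs + length zs + 2 = p"
  shows "f (xs @ y # z # zs) = - f (xs @ z # y # zs)"
proof -
  let ?l = "xs @ z # y # zs"
  have "length ?l = p \<and> length xs < Suc (length xs) \<and> Suc (length xs) < p" using assms(2) by simp
  then have "f (?l[length xs := ?l ! Suc (length xs), Suc (length xs) := ?l ! length xs]) = - f ?l"
    using assms(1) unfolding skew_multilinear_def by blast
  moreover have "?l ! Suc (length xs) = y" "?l ! length xs = z" by (simp_all add: nth_append)
  moreover have "?l[length xs := y] = (xs @ [y]) @ y # zs" by simp
  then have "?l[length xs := y, Suc (length xs) := z] = xs @ y # z # zs"
    using list_update_length[of "xs @ [y]" y zs z] by simp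
  ultimately show ?thesis by (simp only:)
qed

lemma form_skew_multilinear:
  assumes "form f"
  shows "skew_multilinear scale (*) p f"
  unfolding skew_multilinear_def
proof (intro conjI allI impI; elim conjE)
  fix ys :: "'v list" and i j
  assume "length ys = p" "i < p"
  then have "ys[i := y] = take i ys @ y # drop (Suc i) ys" for y by (simp add: upd_conv_take_nth_drop)
  then show "Vector_Spaces.linear scale (*) (\<lambda>y. f (ys[i := y]))"
    using assms unfolding form_def
    by (unfold_locales) (simp_all add: multilinear_add multilinear_scale algebra_simps)
qed (use assms in \<open>auto simp: form_def intro!: alternating_swap\<close>)

end

section \<open>Finite dimensionality of the space of forms\<close>

context quadratic_lie_algebra
begin

text \<open>For the complex numbers as a vector space over themselves, this simplification rule is
  associativity of multiplication in the direction opposite to \<open>algebra_simps\<close>.\<close>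

declare B_left.vs2.scale_scale [simp del]

lemma multilinear_zeroI:
  assumes "multilinear f" "\<And>l. set l \<subseteq> E \<Longrightarrow> f l = 0"
  shows "f ys = 0"
  using assms
proof (induction ys arbitrary: f)
  case (Cons y ys)
  have "Vector_Spaces.linear scale (*) (\<lambda>y. f (y # ys))"
    using multilinear_add[OF Cons.prems(1), of "[]"] multilinear_scale[OF Cons.prems(1), of "[]"]
    by unfold_locales (simp_all add: algebra_simps)
  then have "f (y # ys) = (\<Sum>e\<in>E. B y e * \<iota> e f ys)"
    unfolding interior_product_apply by (rule linear_expand_E)
  also have "\<dots> = 0"
  proof (intro sum.neutral ballI)
    fix e assume "e \<in> E"
    then have "\<iota> e f l = 0" if "set l \<subseteq> E" for l
      using Cons.prems(2)[of "e # l"] that by (simp add: interior_product_apply)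
    then have "\<iota> e f ys = 0"
      by (rule Cons.IH[OF multilinear_interior_product[OF Cons.prems(1)]])
    then show "B y e * \<iota> e f ys = 0" by simp
  qed
  finally show ?case .
qed simp

text \<open>Multilinearity reduces to lists of basis vectors, and a list with a repetition gives
  \<open>f l = - f l\<close>. Distinct lists are no longer than \<open>card E\<close>, so finitely
  many test lists remain.\<close>

lemma form_zeroI:
  assumes f: "form f" and zero: "\<And>l. set l \<subseteq> E \<Longrightarrow> length l \<le> card E \<Longrightarrow> f l = 0"
  shows "f ys = 0"
proof (rule multilinear_zeroI)
  show "multilinear f" using f by (simp add: form_def)
  fix l assume l: "set l \<subseteq> E"
  show "f l = 0"
  proof (cases "distinct l")
    case True
    then have "length l \<le> card E" using l finite_E by (metis card_mono distinct_card)
    then show ?thesis by (rule zero[OF l])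
  next
    case False
    then obtain i j where ij: "i < j" "j < length l" "l ! i = l ! j"
      unfolding distinct_conv_nth by (metis linorder_neqE_nat)
    have "f (l[i := l ! j, j := l ! i]) = - f l"
      using f ij by (intro alternating_swap) (auto simp: form_def)
    moreover have "l[i := l ! j, j := l ! i] = l" by (metis ij(3) list_update_id)
    ultimately show ?thesis by simp
  qed
qed

text \<open>The laws of a form only compare lists of equal length, so dropping the components of
  degree at most \<open>card E\<close> leaves a form. It is zero on all test lists of
  \<open>form_zeroI\<close>.\<close>

lemma form_bounded:
  assumes "form f" "card E < length ys"
  shows "f ys = 0"
proof -
  define g where "g zs = (if card E < length zs then f zs else 0)" for zs
  have "form g"
  proof (rule formI)
    show "g (xs @ y # z # zs) = - g (xs @ z # y # zs)" for xs y z zs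
      using form_swap[OF assms(1), of xs y z zs] by (simp add: g_def)
  qed (simp_all add: g_def form_add[OF assms(1)] form_scale[OF assms(1)])
  then have "g ys = 0" by (rule form_zeroI) (simp add: g_def)
  then show ?thesis using assms(2) by (simp add: g_def)
qed

lemma ext_forms_iff: "\<Omega> \<in> ext_forms scale \<longleftrightarrow> form \<Omega>"
proof
  assume "\<Omega> \<in> ext_forms scale"
  then have \<Omega>: "skew_multilinear scale (*) p \<Omega>" for p by (simp add: ext_forms_def)
  show "form \<Omega>"
  proof (rule formI)
    fix xs y z ys c
    interpret l: Vector_Spaces.linear scale "(*)" "\<lambda>y. \<Omega> (xs @ y # ys)"
      by (rule skew_multilinear_slot[OF \<Omega> refl])
    show "\<Omega> (xs @ (y + z) # ys) = \<Omega> (xs @ y # ys) + \<Omega> (xs @ z # ys)" by (rule l.add)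
    show "\<Omega> (xs @ scale c y # ys) = c * \<Omega> (xs @ y # ys)" by (rule l.scale)
    show "\<Omega> (xs @ y # z # ys) = - \<Omega> (xs @ z # y # ys)"
      by (rule skew_multilinear_swap[OF \<Omega> refl])
  qed
next
  assume "form \<Omega>"
  then show "\<Omega> \<in> ext_forms scale"
    unfolding ext_forms_def using form_skew_multilinear form_bounded by blast
qed

text \<open>Restriction to the finitely many test lists of \<open>form_zeroI\<close> is linear and
  injective on forms, so it carries a basis to an independent set in a finite-dimensional
  space.\<close>

lemma ext_forms_finite_dimensional:
  "fscale.subspace (ext_forms scale)" "\<exists>b. finite b \<and> ext_forms scale \<subseteq> fscale.span b"
proof -
  show sub: "fscale.subspace (ext_forms scale)"
  proof (rule fscale.subspaceI)
    show "0 \<in> ext_forms scale" using form_0 by (simp add: ext_forms_iff zero_fun_def)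
    fix x y c assume "x \<in> ext_forms scale" "y \<in> ext_forms scale"
    then show "x + y \<in> ext_forms scale" "fscale c x \<in> ext_forms scale"
      using form_lincomb[of x y 1 1] form_lincomb[of x x c 0]
      by (simp_all add: ext_forms_iff plus_fun_def fscale_def)
  qed
  obtain b where b: "b \<subseteq> ext_forms scale" "fscale.independent b" "ext_forms scale \<subseteq> fscale.span b"
    by (rule fscale.maximal_independent_subset)
  have span_b: "fscale.span b \<subseteq> ext_forms scale" using b(1) sub by (rule fscale.span_minimal)
  define \<Lambda> where "\<Lambda> = {l. set l \<subseteq> E \<and> length l \<le> card E}"
  define r where "r f = (\<lambda>l. if l \<in> \<Lambda> then f l else 0)" for f :: "'a list \<Rightarrow> complex"
  have fin: "finite \<Lambda>" unfolding \<Lambda>_def by (rule finite_lists_length_le[OF finite_E])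
  interpret r: Vector_Spaces.linear fscale fscale r
    by unfold_locales (auto simp: r_def fscale_def fun_eq_iff)
  have inj: "inj_on r (fscale.span b)"
  proof (rule inj_onI)
    fix f g assume fg: "f \<in> fscale.span b" "g \<in> fscale.span b" and eq: "r f = r g"
    have "form (\<lambda>ys. 1 * f ys + (- 1) * g ys)"
      using fg span_b by (intro form_lincomb) (auto simp: ext_forms_iff)
    moreover have "1 * f l + (- 1) * g l = 0" if "set l \<subseteq> E" "length l \<le> card E" for l
      using fun_cong[OF eq, of l] that by (simp add: r_def \<Lambda>_def)
    ultimately have "1 * f ys + (- 1) * g ys = 0" for ys by (rule form_zeroI)
    then show "f = g" by (simp add: fun_eq_iff)
  qed
  have "fscale.independent (r ` b)"
    using b(2) inj by (rule r.independent_injective_image)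
  moreover define \<delta> where "\<delta> l = (\<lambda>l'. if l' = l then 1 else 0 :: complex)" for l :: "'a list"
  have "r f \<in> fscale.span (\<delta> ` \<Lambda>)" for f
  proof -
    have "r f = (\<Sum>l\<in>\<Lambda>. fscale (f l) (\<delta> l))"
    proof
      fix l'
      have "(\<Sum>l\<in>\<Lambda>. fscale (f l) (\<delta> l)) l' = (\<Sum>l\<in>\<Lambda>. if l' = l then f l else 0)"
        unfolding fscale_def \<delta>_def by (induction \<Lambda> rule: infinite_finite_induct) auto
      then show "r f l' = (\<Sum>l\<in>\<Lambda>. fscale (f l) (\<delta> l)) l'" using fin by (simp add: r_def)
    qed
    also have "\<dots> \<in> fscale.span (\<delta> ` \<Lambda>)"
      by (intro fscale.span_sum fscale.span_scale fscale.span_base imageI)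
    finally show ?thesis .
  qed
  ultimately have "finite (r ` b)"
    using fscale.independent_span_bound[of "\<delta> ` \<Lambda>" "r ` b"] fin by blast
  then have "finite b"
    using inj_on_subset[OF inj fscale.span_superset] finite_imageD by blast
  then show "\<exists>b. finite b \<and> ext_forms scale \<subseteq> fscale.span b" using b(3) by blast
qed

section \<open>The action on forms and the Chevalley--Eilenberg differential\<close>

text \<open>Minus the natural action of \<open>x\<close> on forms, which keeps signs out of the
  slots. The price is the reversed order in \<open>act_bracket\<close>.\<close>

fun act :: "'a \<Rightarrow> ('a list \<Rightarrow> complex) \<Rightarrow> 'a list \<Rightarrow> complex" where
  "act x \<Omega> [] = 0"
| "act x \<Omega> (y # ys) = \<Omega> (bracket x y # ys) + act x (\<iota> y \<Omega>) ys"

text \<open>Exterior multiplication from the left by the one-form \<open>B c\<close>.\<close>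

fun ext_mult :: "'a \<Rightarrow> ('a list \<Rightarrow> complex) \<Rightarrow> 'a list \<Rightarrow> complex" where
  "ext_mult c \<Omega> [] = 0"
| "ext_mult c \<Omega> (y # ys) = B c y * \<Omega> ys - ext_mult c (\<iota> y \<Omega>) ys"

text \<open>This is -2 times the usual Chevalley--Eilenberg differential, which is half the sum of
  the dual one-forms times the Lie derivatives; \<open>act\<close> is minus the Lie
  derivative.\<close>

definition ce_diff :: "('a list \<Rightarrow> complex) \<Rightarrow> 'a list \<Rightarrow> complex" where
  "ce_diff \<Omega> ys = (\<Sum>c\<in>E. ext_mult c (act c \<Omega>) ys)"

lemma act_eq_sum: "act x \<Omega> ys = (\<Sum>i<length ys. \<Omega> (ys[i := bracket x (ys ! i)]))"
  by (induction ys arbitrary: \<Omega>) (simp_all del: sum.lessThan_Suc add: sum.lessThan_Suc_shift interior_product_apply)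

lemma invariant_forms_iff: "\<Omega> \<in> invariant_forms scale bracket \<longleftrightarrow> form \<Omega> \<and> (\<forall>x ys. act x \<Omega> ys = 0)"
  by (simp add: invariant_forms_def ext_forms_iff act_eq_sum)

lemma act_lincomb:
  assumes "\<And>zs. \<gamma> zs = a * \<alpha> zs + b * \<beta> zs"
  shows "act x \<gamma> ys = a * act x \<alpha> ys + b * act x \<beta> ys"
  using assms
proof (induction ys arbitrary: \<alpha> \<beta> \<gamma>)
  case (Cons y ys)
  have *: "act x (\<iota> y \<gamma>) ys = a * act x (\<iota> y \<alpha>) ys + b * act x (\<iota> y \<beta>) ys"
    by (rule Cons.IH) (simp add: form_ops_apply Cons.prems)
  show ?case by (simp only: act.simps * Cons.prems[of "bracket x y # ys"]) (simp add: algebra_simps)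
qed simp

lemma ext_mult_lincomb:
  assumes "\<And>zs. \<gamma> zs = a * \<alpha> zs + b * \<beta> zs"
  shows "ext_mult c \<gamma> ys = a * ext_mult c \<alpha> ys + b * ext_mult c \<beta> ys"
  using assms
proof (induction ys arbitrary: \<alpha> \<beta> \<gamma>)
  case (Cons y ys)
  have *: "ext_mult c (\<iota> y \<gamma>) ys = a * ext_mult c (\<iota> y \<alpha>) ys + b * ext_mult c (\<iota> y \<beta>) ys"
    by (rule Cons.IH) (simp add: form_ops_apply Cons.prems)
  show ?case by (simp only: ext_mult.simps * Cons.prems[of ys]) (simp add: algebra_simps)
qed simp

lemma act_0: "(\<And>zs. \<Omega> zs = 0) \<Longrightarrow> act x \<Omega> ys = 0"
  using act_lincomb[of \<Omega> 0 \<Omega> 0 \<Omega>] by simp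

lemma act_sum:
  assumes "\<And>zs. \<gamma> zs = (\<Sum>i\<in>I. \<alpha> i zs)"
  shows "act x \<gamma> ys = (\<Sum>i\<in>I. act x (\<alpha> i) ys)"
  using assms
proof (induction I arbitrary: \<gamma> rule: infinite_finite_induct)
  case (insert i I)
  have "act x \<gamma> ys = 1 * act x (\<alpha> i) ys + 1 * act x (\<lambda>zs. \<Sum>i\<in>I. \<alpha> i zs) ys"
    by (rule act_lincomb) (simp add: insert)
  moreover have "act x (\<lambda>zs. \<Sum>i\<in>I. \<alpha> i zs) ys = (\<Sum>i\<in>I. act x (\<alpha> i) ys)"
    by (rule insert.IH) simp
  ultimately show ?case using insert.hyps by simp
qed (simp_all add: act_0)

lemma ext_mult_0: "(\<And>zs. \<Omega> zs = 0) \<Longrightarrow> ext_mult c \<Omega> ys = 0"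
  using ext_mult_lincomb[of \<Omega> 0 \<Omega> 0 \<Omega>] by simp

lemma ce_diff_lincomb:
  assumes "\<And>zs. \<gamma> zs = a * \<alpha> zs + b * \<beta> zs"
  shows "ce_diff \<gamma> ys = a * ce_diff \<alpha> ys + b * ce_diff \<beta> ys"
  unfolding ce_diff_def using ext_mult_lincomb[OF act_lincomb[OF assms]]
  by (simp add: sum.distrib sum_distrib_left)

lemma act_linear:
  assumes "form \<Omega>"
  shows "Vector_Spaces.linear scale (*) (\<lambda>x. act x \<Omega> ys)"
proof -
  have "act (x + y) \<Omega> ys = act x \<Omega> ys + act y \<Omega> ys" for x y
    using assms by (induction ys arbitrary: \<Omega>)
      (simp_all add: bracket_left.add form_head_add form_interior_product)
  moreover have "act (scale c x) \<Omega> ys = c * act x \<Omega> ys" for c x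
    using assms by (induction ys arbitrary: \<Omega>)
      (simp_all add: bracket_left.scale form_head_scale form_interior_product algebra_simps)
  ultimately show ?thesis by unfold_locales (simp_all add: algebra_simps)
qed

lemma form_act:
  assumes "form \<Omega>"
  shows "form (act x \<Omega>)"
proof (rule formI)
  fix xs y z ys c
  show "act x \<Omega> (xs @ (y + z) # ys) = act x \<Omega> (xs @ y # ys) + act x \<Omega> (xs @ z # ys)"
    using assms
  proof (induction xs arbitrary: \<Omega>)
    case Nil
    have "act x (\<iota> (y + z) \<Omega>) ys = 1 * act x (\<iota> y \<Omega>) ys + 1 * act x (\<iota> z \<Omega>) ys"
      by (rule act_lincomb) (simp add: form_ops_apply form_head_add Nil)
    then show ?case using Nil by (simp add: bracket_right.add form_head_add)
  next
    case (Cons w xs)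
    then show ?case
      using form_add[OF Cons.prems, of "bracket x w # xs"] by (simp add: form_interior_product)
  qed
  show "act x \<Omega> (xs @ scale c y # ys) = c * act x \<Omega> (xs @ y # ys)"
    using assms
  proof (induction xs arbitrary: \<Omega>)
    case Nil
    have "act x (\<iota> (scale c y) \<Omega>) ys = c * act x (\<iota> y \<Omega>) ys + 0 * act x (\<iota> y \<Omega>) ys"
      by (rule act_lincomb) (simp add: form_ops_apply form_head_scale Nil)
    then show ?case using Nil by (simp add: bracket_right.scale form_head_scale algebra_simps)
  next
    case (Cons w xs)
    then show ?case
      using form_scale[OF Cons.prems, of "bracket x w # xs"]
      by (simp add: form_interior_product algebra_simps)
  qed
next
  fix xs y z zs
  show "act x \<Omega> (xs @ y # z # zs) = - act x \<Omega> (xs @ z # y # zs)"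
    using assms
  proof (induction xs arbitrary: \<Omega>)
    case Nil
    have "act x (\<iota> z (\<iota> y \<Omega>)) zs = - 1 * act x (\<iota> y (\<iota> z \<Omega>)) zs + 0 * act x \<Omega> zs"
      by (rule act_lincomb) (simp add: form_ops_apply form_head_swap[OF Nil, of y z])
    then show ?case
      using form_head_swap[OF Nil, of "bracket x y" z] form_head_swap[OF Nil, of y "bracket x z"]
      by (simp add: interior_product_apply)
  next
    case (Cons w xs)
    then show ?case
      using form_swap[OF Cons.prems, of "bracket x w # xs" y z zs] by (simp add: form_interior_product)
  qed
qed

lemma form_ext_mult:
  assumes "form \<Omega>"
  shows "form (ext_mult c \<Omega>)"
proof (rule formI)
  fix xs y z ys a
  show "ext_mult c \<Omega> (xs @ (y + z) # ys) = ext_mult c \<Omega> (xs @ y # ys) + ext_mult c \<Omega> (xs @ z # ys)"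
    using assms
  proof (induction xs arbitrary: \<Omega>)
    case Nil
    have "ext_mult c (\<iota> (y + z) \<Omega>) ys = 1 * ext_mult c (\<iota> y \<Omega>) ys + 1 * ext_mult c (\<iota> z \<Omega>) ys"
      by (rule ext_mult_lincomb) (simp add: form_ops_apply form_head_add Nil)
    then show ?case by (simp add: B_right.add algebra_simps)
  next
    case (Cons w xs)
    then show ?case
      using form_add[OF Cons.prems, of xs] by (simp add: form_interior_product algebra_simps)
  qed
  show "ext_mult c \<Omega> (xs @ scale a y # ys) = a * ext_mult c \<Omega> (xs @ y # ys)"
    using assms
  proof (induction xs arbitrary: \<Omega>)
    case Nil
    have "ext_mult c (\<iota> (scale a y) \<Omega>) ys = a * ext_mult c (\<iota> y \<Omega>) ys + 0 * ext_mult c (\<iota> y \<Omega>) ys"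
      by (rule ext_mult_lincomb) (simp add: form_ops_apply form_head_scale Nil)
    then show ?case by (simp add: B_right.scale algebra_simps)
  next
    case (Cons w xs)
    then show ?case
      using form_scale[OF Cons.prems, of xs] by (simp add: form_interior_product algebra_simps)
  qed
next
  fix xs y z zs
  show "ext_mult c \<Omega> (xs @ y # z # zs) = - ext_mult c \<Omega> (xs @ z # y # zs)"
    using assms
  proof (induction xs arbitrary: \<Omega>)
    case Nil
    have "ext_mult c (\<iota> z (\<iota> y \<Omega>)) zs = - 1 * ext_mult c (\<iota> y (\<iota> z \<Omega>)) zs + 0 * ext_mult c \<Omega> zs"
      by (rule ext_mult_lincomb) (simp add: form_ops_apply form_head_swap[OF Nil, of y z])
    then show ?case by (simp add: interior_product_apply)
  next
    case (Cons w xs)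
    then show ?case
      using form_swap[OF Cons.prems, of xs y z zs] Cons.IH[OF form_interior_product[OF Cons.prems], of w]
      by simp
  qed
qed

lemma act_grade_sign: "act x (grade_sign \<Omega>) ys = grade_sign (act x \<Omega>) ys"
proof (induction ys arbitrary: \<Omega>)
  case (Cons y ys)
  have 1: "act x (\<iota> y (grade_sign \<Omega>)) ys = - 1 * act x (grade_sign (\<iota> y \<Omega>)) ys + 0 * act x \<Omega> ys"
    by (rule act_lincomb) (simp add: form_ops_apply)
  show ?case
    unfolding act.simps grade_sign_apply[of \<Omega> "bracket x y # ys"] grade_sign_apply[of "act x \<Omega>" "y # ys"]
      1 Cons grade_sign_apply[of "act x (\<iota> y \<Omega>)" ys]
    by (simp add: algebra_simps)
qed (simp add: grade_sign_apply)

lemma ext_mult_grade_sign: "grade_sign (ext_mult c \<Omega>) ys = - ext_mult c (grade_sign \<Omega>) ys"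
proof -
  have "ext_mult c (grade_sign \<Omega>) ys = - grade_sign (ext_mult c \<Omega>) ys"
  proof (induction ys arbitrary: \<Omega>)
    case (Cons y ys)
    have 1: "ext_mult c (\<iota> y (grade_sign \<Omega>)) ys = - 1 * ext_mult c (grade_sign (\<iota> y \<Omega>)) ys + 0 * ext_mult c \<Omega> ys"
      by (rule ext_mult_lincomb) (simp add: form_ops_apply)
    show ?case
      unfolding ext_mult.simps grade_sign_apply[of \<Omega> ys] grade_sign_apply[of "ext_mult c \<Omega>" "y # ys"]
        1 Cons grade_sign_apply[of "ext_mult c (\<iota> y \<Omega>)" ys]
      by (simp add: algebra_simps)
  qed (simp add: grade_sign_apply)
  then show ?thesis by simp
qed

lemma act_rec_wedge: "act x (rec_wedge \<alpha> \<beta>) ys = rec_wedge (act x \<alpha>) \<beta> ys + rec_wedge \<alpha> (act x \<beta>) ys"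
proof (induction ys arbitrary: \<alpha> \<beta>)
  case Nil
  show ?case by simp
next
  case (Cons y ys)
  have "act x (\<iota> y (rec_wedge \<alpha> \<beta>)) ys
      = 1 * act x (rec_wedge (\<iota> y \<alpha>) \<beta>) ys + 1 * act x (rec_wedge (grade_sign \<alpha>) (\<iota> y \<beta>)) ys"
    by (rule act_lincomb) (simp add: form_ops_apply)
  moreover have "rec_wedge (\<iota> y (act x \<alpha>)) \<beta> ys = 1 * rec_wedge (\<iota> (bracket x y) \<alpha>) \<beta> ys + 1 * rec_wedge (act x (\<iota> y \<alpha>)) \<beta> ys"
    by (rule rec_wedge_lincomb_left) (simp add: form_ops_apply)
  moreover have "rec_wedge (grade_sign \<alpha>) (\<iota> y (act x \<beta>)) ys
      = 1 * rec_wedge (grade_sign \<alpha>) (\<iota> (bracket x y) \<beta>) ys + 1 * rec_wedge (grade_sign \<alpha>) (act x (\<iota> y \<beta>)) ys"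
    by (rule rec_wedge_lincomb_right) (simp add: form_ops_apply)
  moreover have "act x (grade_sign \<alpha>) = grade_sign (act x \<alpha>)"
    by (rule ext) (rule act_grade_sign)
  ultimately show ?case by (simp add: Cons)
qed

lemma act_ext_mult: "act x (ext_mult c \<Omega>) ys = ext_mult (bracket c x) \<Omega> ys + ext_mult c (act x \<Omega>) ys"
proof (induction ys arbitrary: \<Omega>)
  case (Cons y ys)
  have "act x (\<iota> y (ext_mult c \<Omega>)) ys = B c y * act x \<Omega> ys + (- 1) * act x (ext_mult c (\<iota> y \<Omega>)) ys"
    by (rule act_lincomb) (simp add: form_ops_apply)
  moreover have "ext_mult c (\<iota> y (act x \<Omega>)) ys = 1 * ext_mult c (\<iota> (bracket x y) \<Omega>) ys + 1 * ext_mult c (act x (\<iota> y \<Omega>)) ys"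
    by (rule ext_mult_lincomb) (simp add: form_ops_apply)
  ultimately show ?case by (simp add: Cons B_invariant algebra_simps)
qed simp

lemma rec_wedge_ext_mult_left: "rec_wedge (ext_mult c \<alpha>) \<beta> ys = ext_mult c (rec_wedge \<alpha> \<beta>) ys"
proof (induction ys arbitrary: \<alpha> \<beta>)
  case (Cons y ys)
  have "rec_wedge (\<iota> y (ext_mult c \<alpha>)) \<beta> ys = B c y * rec_wedge \<alpha> \<beta> ys + (- 1) * rec_wedge (ext_mult c (\<iota> y \<alpha>)) \<beta> ys"
    by (rule rec_wedge_lincomb_left) (simp add: form_ops_apply)
  moreover have "rec_wedge (grade_sign (ext_mult c \<alpha>)) (\<iota> y \<beta>) ys
      = - 1 * rec_wedge (ext_mult c (grade_sign \<alpha>)) (\<iota> y \<beta>) ys + 0 * rec_wedge \<alpha> (\<iota> y \<beta>) ys"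
    by (rule rec_wedge_lincomb_left) (simp add: ext_mult_grade_sign)
  moreover have "ext_mult c (\<iota> y (rec_wedge \<alpha> \<beta>)) ys
      = 1 * ext_mult c (rec_wedge (\<iota> y \<alpha>) \<beta>) ys + 1 * ext_mult c (rec_wedge (grade_sign \<alpha>) (\<iota> y \<beta>)) ys"
    by (rule ext_mult_lincomb) (simp add: form_ops_apply)
  ultimately show ?case by (simp add: Cons)
qed simp

lemma rec_wedge_ext_mult_right: "rec_wedge \<alpha> (ext_mult c \<beta>) ys = ext_mult c (rec_wedge (grade_sign \<alpha>) \<beta>) ys"
proof (induction ys arbitrary: \<alpha> \<beta>)
  case (Cons y ys)
  have "rec_wedge (grade_sign \<alpha>) (\<iota> y (ext_mult c \<beta>)) ys
      = B c y * rec_wedge (grade_sign \<alpha>) \<beta> ys + (- 1) * rec_wedge (grade_sign \<alpha>) (ext_mult c (\<iota> y \<beta>)) ys"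
    by (rule rec_wedge_lincomb_right) (simp add: form_ops_apply)
  moreover have "ext_mult c (\<iota> y (rec_wedge (grade_sign \<alpha>) \<beta>)) ys
      = - 1 * ext_mult c (rec_wedge (grade_sign (\<iota> y \<alpha>)) \<beta>) ys + 1 * ext_mult c (rec_wedge \<alpha> (\<iota> y \<beta>)) ys"
  proof (rule ext_mult_lincomb)
    fix zs
    have "rec_wedge (\<iota> y (grade_sign \<alpha>)) \<beta> zs = - 1 * rec_wedge (grade_sign (\<iota> y \<alpha>)) \<beta> zs + 0 * rec_wedge \<alpha> \<beta> zs"
      by (rule rec_wedge_lincomb_left) (simp add: form_ops_apply)
    then show "\<iota> y (rec_wedge (grade_sign \<alpha>) \<beta>) zs
        = - 1 * rec_wedge (grade_sign (\<iota> y \<alpha>)) \<beta> zs + 1 * rec_wedge \<alpha> (\<iota> y \<beta>) zs"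
      by (simp add: interior_product_apply)
  qed
  ultimately show ?case by (simp add: Cons)
qed simp

text \<open>\<open>act c\<close> and \<open>ext_mult c\<close> commute because
  \<open>bracket c c = 0\<close>. This is why exact forms are moved forms.\<close>

lemma ce_diff_eq_sum_act: "ce_diff \<Omega> ys = (\<Sum>c\<in>E. act c (ext_mult c \<Omega>) ys)"
proof -
  have "ext_mult 0 \<Omega> ys = 0" for \<Omega> ys
    by (induction ys arbitrary: \<Omega>) (simp_all add: B_left.zero)
  then show ?thesis by (simp add: ce_diff_def act_ext_mult bracket_self)
qed

lemma ce_diff_rec_wedge: "ce_diff (rec_wedge \<alpha> \<beta>) ys = rec_wedge (ce_diff \<alpha>) \<beta> ys + rec_wedge (grade_sign \<alpha>) (ce_diff \<beta>) ys"
proof -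
  have "ext_mult c (act c (rec_wedge \<alpha> \<beta>)) ys = rec_wedge (ext_mult c (act c \<alpha>)) \<beta> ys + rec_wedge (grade_sign \<alpha>) (ext_mult c (act c \<beta>)) ys" for c
  proof -
    have "ext_mult c (act c (rec_wedge \<alpha> \<beta>)) ys = 1 * ext_mult c (rec_wedge (act c \<alpha>) \<beta>) ys + 1 * ext_mult c (rec_wedge \<alpha> (act c \<beta>)) ys"
      by (rule ext_mult_lincomb) (simp add: form_ops_apply act_rec_wedge)
    then show ?thesis by (simp add: rec_wedge_ext_mult_left rec_wedge_ext_mult_right)
  qed
  then have "ce_diff (rec_wedge \<alpha> \<beta>) ys = (\<Sum>c\<in>E. rec_wedge (ext_mult c (act c \<alpha>)) \<beta> ys) + (\<Sum>c\<in>E. rec_wedge (grade_sign \<alpha>) (ext_mult c (act c \<beta>)) ys)"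
    by (simp add: ce_diff_def sum.distrib)
  moreover have "rec_wedge (ce_diff \<alpha>) \<beta> ys = (\<Sum>c\<in>E. rec_wedge (ext_mult c (act c \<alpha>)) \<beta> ys)"
    by (rule rec_wedge_sum_left) (simp add: ce_diff_def)
  moreover have "rec_wedge (grade_sign \<alpha>) (ce_diff \<beta>) ys = (\<Sum>c\<in>E. rec_wedge (grade_sign \<alpha>) (ext_mult c (act c \<beta>)) ys)"
    by (rule rec_wedge_sum_right) (simp add: ce_diff_def)
  ultimately show ?thesis by simp
qed

text \<open>A derivation that comes from an endomorphism of the vectors, here
  \<open>bracket y\<close>, is the sum of the dual one-forms times the contractions with the images
  of the basis.\<close>

lemma act_eq_sum_ext_mult:
  assumes "form \<Omega>"
  shows "(\<Sum>c\<in>E. ext_mult c (\<iota> (bracket y c) \<Omega>) ys) = act y \<Omega> ys"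
  using assms
proof (induction ys arbitrary: \<Omega>)
  case (Cons z zs)
  have "Vector_Spaces.linear scale (*) (\<lambda>v. \<Omega> (bracket y v # zs))"
    using Cons.prems
    by unfold_locales (simp_all add: bracket_right.add bracket_right.scale form_head_add form_head_scale algebra_simps)
  then have 1: "\<Omega> (bracket y z # zs) = (\<Sum>c\<in>E. B c z * \<Omega> (bracket y c # zs))"
    using linear_expand_E by (simp only: B_sym[of _ z])
  have "ext_mult c (\<iota> z (\<iota> (bracket y c) \<Omega>)) zs = - 1 * ext_mult c (\<iota> (bracket y c) (\<iota> z \<Omega>)) zs + 0 * ext_mult c \<Omega> zs" for c
    by (rule ext_mult_lincomb) (simp add: form_ops_apply form_head_swap[OF Cons.prems, of "bracket y c" z])
  then have 2: "(\<Sum>c\<in>E. ext_mult c (\<iota> z (\<iota> (bracket y c) \<Omega>)) zs) = - act y (\<iota> z \<Omega>) zs"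
    using Cons.IH[of "\<iota> z \<Omega>"] Cons.prems by (simp add: sum_negf form_interior_product)
  show ?case unfolding ext_mult.simps sum_subtractf 2 by (simp add: 1 interior_product_apply)
qed simp

text \<open>Cartan's homotopy formula. One copy of \<open>act y\<close> comes from contracting the
  one-form \<open>B c\<close> with \<open>y\<close>, the other from commuting
  \<open>\<iota> y\<close> past \<open>act c\<close>; hence the factor 2.\<close>

lemma ce_diff_Cons:
  assumes "form \<Omega>"
  shows "ce_diff \<Omega> (y # ys) = 2 * act y \<Omega> ys - ce_diff (\<iota> y \<Omega>) ys"
proof -
  have "ext_mult c (\<iota> y (act c \<Omega>)) ys = - 1 * ext_mult c (\<iota> (bracket y c) \<Omega>) ys + 1 * ext_mult c (act c (\<iota> y \<Omega>)) ys" for c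
    by (rule ext_mult_lincomb) (simp add: form_ops_apply bracket_skew[of c y] form_head_minus assms)
  then have "ce_diff \<Omega> (y # ys) = (\<Sum>c\<in>E. B c y * act c \<Omega> ys) + (\<Sum>c\<in>E. ext_mult c (\<iota> (bracket y c) \<Omega>) ys)
      - ce_diff (\<iota> y \<Omega>) ys"
    by (simp add: ce_diff_def sum.distrib sum_subtractf)
  also have "(\<Sum>c\<in>E. B c y * act c \<Omega> ys) = act y \<Omega> ys"
    using linear_expand_E[OF act_linear[OF assms, of ys], of y] by (simp only: B_sym[of _ y])
  also have "(\<Sum>c\<in>E. ext_mult c (\<iota> (bracket y c) \<Omega>) ys) = act y \<Omega> ys" by (rule act_eq_sum_ext_mult[OF assms])
  finally show ?thesis by simp
qed

lemma act_bracket: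
  assumes "form \<Omega>"
  shows "act (bracket x y) \<Omega> ys = act y (act x \<Omega>) ys - act x (act y \<Omega>) ys"
  using assms
proof (induction ys arbitrary: \<Omega>)
  case (Cons z zs)
  have *: "act u (\<iota> z (act v \<Omega>)) zs = 1 * act u (\<iota> (bracket v z) \<Omega>) zs + 1 * act u (act v (\<iota> z \<Omega>)) zs" for u v
    by (rule act_lincomb) (simp add: form_ops_apply)
  have "bracket (bracket x y) z = bracket x (bracket y z) + - bracket y (bracket x z)"
  proof -
    have "bracket y (bracket z x) = - bracket y (bracket x z)"
      by (subst bracket_skew[of z x]) (simp add: bracket_right.neg)
    then show ?thesis
      using jacobi[of x y z] bracket_skew[of z "bracket x y"]
      by (metis add.commute add_diff_cancel_right' diff_0 eq_neg_iff_add_eq_0 minus_diff_eq uminus_add_conv_diff)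
  qed
  then have "\<Omega> (bracket (bracket x y) z # zs) = \<Omega> (bracket x (bracket y z) # zs) - \<Omega> (bracket y (bracket x z) # zs)"
    by (simp only: form_head_add[OF Cons.prems] form_head_minus[OF Cons.prems] diff_conv_add_uminus)
  then show ?case using Cons.IH[of "\<iota> z \<Omega>"] Cons.prems by (simp add: * form_interior_product)
qed simp

end

lemma sum_fun_apply: "(\<Sum>i\<in>I. f i) x = (\<Sum>i\<in>I. f i x)"
  by (induction I rule: infinite_finite_induct) simp_all

section \<open>Invariant forms, moved forms and the contraction\<close>

context quadratic_lie_algebra
begin

abbreviation moved_forms :: "('a list \<Rightarrow> complex) set" where
  "moved_forms \<equiv> fscale.span {act x \<Psi> |x \<Psi>. form \<Psi>}"

lemma invariants_decomposition:
  shows "form \<Omega> \<Longrightarrow> \<exists>\<Phi>. form \<Phi> \<and> (\<forall>x ys. act x \<Phi> ys = 0) \<and> \<Omega> - \<Phi> \<in> moved_forms"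
    and "\<Omega> \<in> moved_forms \<Longrightarrow> (\<And>x ys. act x \<Omega> ys = 0) \<Longrightarrow> \<Omega> = 0"
proof -
  \<comment> \<open>The sign undoes the reversal in \<open>act_bracket\<close> and makes this a
    representation.\<close>
  define \<rho> where "\<rho> x \<Psi> = - act x \<Psi>" for x \<Psi>
  have lie: "quadratic_lie_algebra scale bracket B E" by unfold_locales
  obtain b where b: "finite b" "ext_forms scale \<subseteq> fscale.span b"
    using ext_forms_finite_dimensional(2) by blast
  have lin: "Vector_Spaces.linear fscale fscale (\<rho> x)" for x
  proof unfold_locales
    fix f g :: "'a list \<Rightarrow> complex" and c
    have "act x (f + g) ys = 1 * act x f ys + 1 * act x g ys" for ys by (rule act_lincomb) simp
    then show "\<rho> x (f + g) = \<rho> x f + \<rho> x g" by (simp add: \<rho>_def fun_eq_iff)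
    have "act x (fscale c f) ys = c * act x f ys + 0 * act x f ys" for ys
      by (rule act_lincomb) (simp add: fscale_def)
    then show "\<rho> x (fscale c f) = fscale c (\<rho> x f)" by (simp add: \<rho>_def fun_eq_iff fscale_def)
  qed
  have stable: "\<rho> x f \<in> ext_forms scale" if "f \<in> ext_forms scale" for x f
  proof -
    have "form (\<lambda>ys. (- 1) * act x f ys + 0 * act x f ys)"
      using that by (intro form_lincomb form_act) (simp_all add: ext_forms_iff)
    then show ?thesis by (simp add: ext_forms_iff \<rho>_def fun_Compl_def)
  qed
  have add: "\<rho> (x + y) f = \<rho> x f + \<rho> y f" if "f \<in> ext_forms scale" for x y f
  proof
    fix ys
    interpret l: Vector_Spaces.linear scale "(*)" "\<lambda>x. act x f ys"
      using that by (intro act_linear) (simp add: ext_forms_iff)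
    show "\<rho> (x + y) f ys = (\<rho> x f + \<rho> y f) ys" by (simp add: \<rho>_def l.add)
  qed
  have scl: "\<rho> (scale c x) f = fscale c (\<rho> x f)" if "f \<in> ext_forms scale" for c x f
  proof
    fix ys
    interpret l: Vector_Spaces.linear scale "(*)" "\<lambda>x. act x f ys"
      using that by (intro act_linear) (simp add: ext_forms_iff)
    show "\<rho> (scale c x) f ys = fscale c (\<rho> x f) ys" by (simp add: \<rho>_def l.scale fscale_def)
  qed
  have brk: "\<rho> (bracket x y) f = \<rho> x (\<rho> y f) - \<rho> y (\<rho> x f)" if "f \<in> ext_forms scale" for x y f
  proof
    fix ys
    have "act u (- act v f) ys = - 1 * act u (act v f) ys + 0 * act u f ys" for u v
      by (rule act_lincomb) simp
    then show "\<rho> (bracket x y) f ys = (\<rho> x (\<rho> y f) - \<rho> y (\<rho> x f)) ys"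
      using that by (simp add: \<rho>_def act_bracket ext_forms_iff)
  qed
  note red = complete_reducibility[OF lie ext_forms_finite_dimensional(1) b(2,1) lin stable add scl brk]
  have sub1: "fscale.span {\<rho> x \<Psi> |x \<Psi>. \<Psi> \<in> ext_forms scale} \<subseteq> moved_forms"
  proof (rule fscale.span_minimal[OF _ fscale.subspace_span], safe)
    fix x \<Psi> assume "\<Psi> \<in> ext_forms scale"
    then have "act x \<Psi> \<in> moved_forms" by (intro fscale.span_base) (auto simp: ext_forms_iff)
    then show "\<rho> x \<Psi> \<in> moved_forms" unfolding \<rho>_def by (rule fscale.span_neg)
  qed
  have sub2: "moved_forms \<subseteq> fscale.span {\<rho> x \<Psi> |x \<Psi>. \<Psi> \<in> ext_forms scale}"
  proof (rule fscale.span_minimal[OF _ fscale.subspace_span], safe)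
    fix x \<Psi> assume "form \<Psi>"
    then have "\<rho> x \<Psi> \<in> fscale.span {\<rho> x \<Psi> |x \<Psi>. \<Psi> \<in> ext_forms scale}"
      by (intro fscale.span_base) (auto simp: ext_forms_iff)
    then have "- \<rho> x \<Psi> \<in> fscale.span {\<rho> x \<Psi> |x \<Psi>. \<Psi> \<in> ext_forms scale}" by (rule fscale.span_neg)
    then show "act x \<Psi> \<in> fscale.span {\<rho> x \<Psi> |x \<Psi>. \<Psi> \<in> ext_forms scale}" by (simp add: \<rho>_def)
  qed
  {
    assume "form \<Omega>"
    then obtain \<Phi> where \<Phi>: "form \<Phi>" "\<And>x. \<rho> x \<Phi> = 0" "\<Omega> - \<Phi> \<in> moved_forms"
      using red(1)[of \<Omega>] sub1 by (auto simp: ext_forms_iff)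
    have "act x \<Phi> ys = 0" for x ys using fun_cong[OF \<Phi>(2)[of x], of ys] by (simp add: \<rho>_def)
    with \<Phi> show "\<exists>\<Phi>. form \<Phi> \<and> (\<forall>x ys. act x \<Phi> ys = 0) \<and> \<Omega> - \<Phi> \<in> moved_forms" by blast
  next
    assume "\<Omega> \<in> moved_forms" and z: "\<And>x ys. act x \<Omega> ys = 0"
    then have "\<Omega> \<in> fscale.span {\<rho> x \<Psi> |x \<Psi>. \<Psi> \<in> ext_forms scale}" using sub2 by blast
    moreover have "\<rho> x \<Omega> = 0" for x by (rule ext) (simp add: \<rho>_def z)
    ultimately show "\<Omega> = 0" using red(2)[of \<Omega>] by blast
  }
qed

text \<open>An invariant form is closed and killed by \<open>act b\<close>, so Cartan's formula
  leaves only this term.\<close>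

lemma ce_diff_interior_invariant:
  assumes "form \<Omega>" "\<And>x ys. act x \<Omega> ys = 0"
  shows "ce_diff (\<iota> b \<Omega>) ys = 0"
proof -
  have "ce_diff \<Omega> (b # ys) = 0" unfolding ce_diff_def by (intro sum.neutral ballI ext_mult_0 assms(2))
  then show ?thesis using ce_diff_Cons[OF assms(1), of b ys] by (simp add: assms(2))
qed

lemma interior_invariant_exact:
  assumes \<Omega>: "form \<Omega>" "\<And>x ys. act x \<Omega> ys = 0"
  shows "\<exists>\<psi>. form \<psi> \<and> (\<forall>ys. \<Omega> (x # ys) = ce_diff \<psi> ys)"
proof -
  have "x \<in> span {bracket x y |x y. True}" unfolding perfect by simp
  then show ?thesis
  proof (induction rule: span_induct_alt)
    case base
    have "\<Omega> (0 # ys) = ce_diff (\<lambda>ys. 0) ys" for ys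
    proof -
      have "ce_diff (\<lambda>ys. 0) ys = 0" unfolding ce_diff_def by (intro sum.neutral ballI ext_mult_0 act_0 refl)
      then show ?thesis using form_head_scale[OF \<Omega>(1), of 0 0 ys] by simp
    qed
    then show ?case using form_0 by blast
  next
    case (step c z y)
    then obtain a b where z: "z = bracket a b" by blast
    obtain \<psi> where \<psi>: "form \<psi>" "\<And>ys. \<Omega> (y # ys) = ce_diff \<psi> ys" using step.IH by blast
    define \<phi> where "\<phi> = \<iota> a (\<iota> b \<Omega>)"
    have \<phi>: "form \<phi>" unfolding \<phi>_def by (intro form_interior_product \<Omega>)
    \<comment> \<open>Invariance of \<Omega> under \<open>a\<close> turns the bracket into
      \<open>- act a (\<iota> b \<Omega>)\<close>; Cartan's formula for the closed form
      \<open>\<iota> b \<Omega>\<close> gives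
      \<open>2 * act a (\<iota> b \<Omega>) ys = ce_diff \<phi> ys\<close>. Hence the constant
      -1/2.\<close>
    have \<Omega>z: "\<Omega> (z # ys) = - (1 / 2) * ce_diff \<phi> ys" for ys
    proof -
      have "\<Omega> (bracket a b # ys) = - act a (\<iota> b \<Omega>) ys"
        using \<Omega>(2)[of a "b # ys"] by (simp add: eq_neg_iff_add_eq_0)
      moreover have "ce_diff (\<iota> b \<Omega>) (a # ys) = 2 * act a (\<iota> b \<Omega>) ys - ce_diff \<phi> ys"
        unfolding \<phi>_def by (intro ce_diff_Cons form_interior_product \<Omega>)
      then have "ce_diff \<phi> ys = 2 * act a (\<iota> b \<Omega>) ys"
        using ce_diff_interior_invariant[OF \<Omega>, of b "a # ys"] by simp
      ultimately show ?thesis by (simp add: z)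
    qed
    have "\<Omega> ((scale c z + y) # ys) = ce_diff (\<lambda>ys. (- (c / 2)) * \<phi> ys + 1 * \<psi> ys) ys" for ys
    proof -
      have "ce_diff (\<lambda>ys. (- (c / 2)) * \<phi> ys + 1 * \<psi> ys) ys = (- (c / 2)) * ce_diff \<phi> ys + 1 * ce_diff \<psi> ys"
        by (rule ce_diff_lincomb) simp
      then show ?thesis by (simp add: form_head_add form_head_scale \<Omega>(1) \<Omega>z \<psi>(2))
    qed
    moreover have "form (\<lambda>ys. (- (c / 2)) * \<phi> ys + 1 * \<psi> ys)" by (intro form_lincomb \<phi> \<psi>)
    ultimately show ?case by blast
  qed
qed

definition contraction :: "('a list \<Rightarrow> complex) \<Rightarrow> ('a list \<Rightarrow> complex) \<Rightarrow> 'a list \<Rightarrow> complex" where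
  "contraction I \<Omega> ys = (\<Sum>e\<in>E. rec_wedge (\<iota> e I) (\<iota> e \<Omega>) ys)"

lemma form_contraction: "form I \<Longrightarrow> form \<Omega> \<Longrightarrow> form (contraction I \<Omega>)"
  unfolding contraction_def by (intro form_sum form_rec_wedge form_interior_product)

lemma contraction_lincomb:
  assumes "\<And>zs. \<gamma> zs = a * \<alpha> zs + b * \<beta> zs"
  shows "contraction I \<gamma> ys = a * contraction I \<alpha> ys + b * contraction I \<beta> ys"
proof -
  have "rec_wedge (\<iota> e I) (\<iota> e \<gamma>) ys = a * rec_wedge (\<iota> e I) (\<iota> e \<alpha>) ys + b * rec_wedge (\<iota> e I) (\<iota> e \<beta>) ys" for e
    by (rule rec_wedge_lincomb_right) (simp add: interior_product_apply assms)
  then show ?thesis by (simp add: contraction_def sum.distrib sum_distrib_left)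
qed

lemma rec_wedge_interior_linear:
  assumes "form \<alpha>" "form \<beta>"
  shows "Vector_Spaces.linear scale (*) (\<lambda>x. rec_wedge (\<iota> x \<alpha>) \<gamma> ys)"
    and "Vector_Spaces.linear scale (*) (\<lambda>x. rec_wedge \<gamma> (\<iota> x \<beta>) ys)"
proof -
  have "rec_wedge (\<iota> (x + y) \<alpha>) \<gamma> ys = 1 * rec_wedge (\<iota> x \<alpha>) \<gamma> ys + 1 * rec_wedge (\<iota> y \<alpha>) \<gamma> ys"
       "rec_wedge \<gamma> (\<iota> (x + y) \<beta>) ys = 1 * rec_wedge \<gamma> (\<iota> x \<beta>) ys + 1 * rec_wedge \<gamma> (\<iota> y \<beta>) ys" for x y
    by (rule rec_wedge_lincomb_left rec_wedge_lincomb_right; simp add: interior_product_apply form_head_add assms)+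
  moreover have "rec_wedge (\<iota> (scale c x) \<alpha>) \<gamma> ys = c * rec_wedge (\<iota> x \<alpha>) \<gamma> ys + 0 * rec_wedge (\<iota> x \<alpha>) \<gamma> ys"
       "rec_wedge \<gamma> (\<iota> (scale c x) \<beta>) ys = c * rec_wedge \<gamma> (\<iota> x \<beta>) ys + 0 * rec_wedge \<gamma> (\<iota> x \<beta>) ys" for c x
    by (rule rec_wedge_lincomb_left rec_wedge_lincomb_right; simp add: interior_product_apply form_head_scale assms)+
  ultimately show "Vector_Spaces.linear scale (*) (\<lambda>x. rec_wedge (\<iota> x \<alpha>) \<gamma> ys)"
    "Vector_Spaces.linear scale (*) (\<lambda>x. rec_wedge \<gamma> (\<iota> x \<beta>) ys)"
    by (unfold_locales; simp add: algebra_simps)+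
qed

text \<open>Commuting \<open>act x\<close> past \<open>\<iota> e\<close> produces
  \<open>\<iota> (bracket x e)\<close> in either factor; summed over \<open>E\<close>, these
  corrections cancel by \<open>casimir_tensor_invariant\<close>.\<close>

lemma act_contraction:
  assumes I: "form I" "\<And>x ys. act x I ys = 0" and \<Omega>: "form \<Omega>"
  shows "act x (contraction I \<Omega>) ys = contraction I (act x \<Omega>) ys"
proof -
  have act_\<iota>: "act x (\<iota> e \<Psi>) zs = 1 * \<iota> e (act x \<Psi>) zs + (- 1) * \<iota> (bracket x e) \<Psi> zs" for e \<Psi> zs
    by (simp add: interior_product_apply)
  have "act x (rec_wedge (\<iota> e I) (\<iota> e \<Omega>)) ys = rec_wedge (\<iota> e I) (\<iota> e (act x \<Omega>)) ys
      - (rec_wedge (\<iota> (bracket x e) I) (\<iota> e \<Omega>) ys + rec_wedge (\<iota> e I) (\<iota> (bracket x e) \<Omega>) ys)" for e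
  proof -
    have "rec_wedge (act x (\<iota> e I)) (\<iota> e \<Omega>) ys = 0 * rec_wedge I (\<iota> e \<Omega>) ys + (- 1) * rec_wedge (\<iota> (bracket x e) I) (\<iota> e \<Omega>) ys"
    proof (rule rec_wedge_lincomb_left)
      show "act x (\<iota> e I) zs = 0 * I zs + (- 1) * \<iota> (bracket x e) I zs" for zs
        unfolding act_\<iota> interior_product_apply I(2) by simp
    qed
    moreover have "rec_wedge (\<iota> e I) (act x (\<iota> e \<Omega>)) ys
        = 1 * rec_wedge (\<iota> e I) (\<iota> e (act x \<Omega>)) ys + (- 1) * rec_wedge (\<iota> e I) (\<iota> (bracket x e) \<Omega>) ys"
      by (rule rec_wedge_lincomb_right) (rule act_\<iota>)
    ultimately show ?thesis by (simp add: act_rec_wedge)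
  qed
  moreover have "act x (contraction I \<Omega>) ys = (\<Sum>e\<in>E. act x (rec_wedge (\<iota> e I) (\<iota> e \<Omega>)) ys)"
    by (rule act_sum) (simp add: contraction_def)
  moreover have "(\<Sum>e\<in>E. rec_wedge (\<iota> (bracket x e) I) (\<iota> e \<Omega>) ys) + (\<Sum>e\<in>E. rec_wedge (\<iota> e I) (\<iota> (bracket x e) \<Omega>) ys) = 0"
    by (rule casimir_tensor_invariant[of "(*)" "\<lambda>a b. rec_wedge (\<iota> a I) (\<iota> b \<Omega>) ys"])
      (rule rec_wedge_interior_linear[OF I(1) \<Omega>])+
  ultimately show ?thesis by (simp add: contraction_def sum_subtractf sum.distrib)
qed

text \<open>The contraction is exact for the Chevalley--Eilenberg differential, as \<open>\<iota> e I\<close> is closed and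
  \<open>\<iota> e \<Omega>\<close> exact; and exact forms are sums of forms \<open>act c \<Psi>\<close>.\<close>

lemma contraction_invariant_moved:
  assumes I: "form I" "\<And>x ys. act x I ys = 0" and odd: "\<And>ys. even (length ys) \<Longrightarrow> I ys = 0"
    and \<Omega>: "form \<Omega>" "\<And>x ys. act x \<Omega> ys = 0"
  shows "contraction I \<Omega> \<in> moved_forms"
proof -
  have "\<forall>x. \<exists>\<psi>. form \<psi> \<and> (\<forall>ys. \<Omega> (x # ys) = ce_diff \<psi> ys)"
    using interior_invariant_exact[OF \<Omega>] by blast
  then obtain \<psi> where \<psi>: "\<And>x. form (\<psi> x)" "\<And>x ys. \<Omega> (x # ys) = ce_diff (\<psi> x) ys" by metis
  have "rec_wedge (\<iota> e I) (\<iota> e \<Omega>) ys = (\<Sum>c\<in>E. act c (ext_mult c (rec_wedge (\<iota> e I) (\<psi> e))) ys)" for e ys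
  proof -
    \<comment> \<open>\<open>I\<close> has components of odd degree only, so
      \<open>\<iota> e I\<close> is even and the product rule has no sign.\<close>
    have "grade_sign (\<iota> e I) = \<iota> e I"
    proof
      fix zs
      show "grade_sign (\<iota> e I) zs = \<iota> e I zs"
        using odd[of "e # zs"] by (cases "even (length zs)") (simp_all add: form_ops_apply)
    qed
    then have "ce_diff (rec_wedge (\<iota> e I) (\<psi> e)) ys = rec_wedge (ce_diff (\<iota> e I)) (\<psi> e) ys + rec_wedge (\<iota> e I) (ce_diff (\<psi> e)) ys"
      by (simp add: ce_diff_rec_wedge)
    moreover have "rec_wedge (ce_diff (\<iota> e I)) (\<psi> e) ys = 0"
      by (rule rec_wedge_0_left) (rule ce_diff_interior_invariant[OF I])
    moreover have "\<iota> e \<Omega> = ce_diff (\<psi> e)" by (rule ext) (simp add: interior_product_apply \<psi>)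
    ultimately show ?thesis by (simp add: ce_diff_eq_sum_act)
  qed
  then have "contraction I \<Omega> = (\<Sum>e\<in>E. \<Sum>c\<in>E. act c (ext_mult c (rec_wedge (\<iota> e I) (\<psi> e))))"
    by (simp add: contraction_def fun_eq_iff sum_fun_apply)
  also have "\<dots> \<in> moved_forms"
  proof (intro fscale.span_sum fscale.span_base)
    fix e c
    have "form (ext_mult c (rec_wedge (\<iota> e I) (\<psi> e)))" by (intro form_ext_mult form_rec_wedge form_interior_product I \<psi>)
    then show "act c (ext_mult c (rec_wedge (\<iota> e I) (\<psi> e))) \<in> {act x \<Psi> |x \<Psi>. form \<Psi>}" by blast
  qed
  finally show ?thesis .
qed

lemma contraction_invariant_zero:
  assumes I: "form I" "\<And>x ys. act x I ys = 0" and odd: "\<And>ys. even (length ys) \<Longrightarrow> I ys = 0"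
    and \<Omega>: "form \<Omega>" "\<And>x ys. act x \<Omega> ys = 0"
  shows "contraction I \<Omega> ys = 0"
proof -
  have "act x (contraction I \<Omega>) zs = 0" for x zs
  proof -
    have "contraction I (act x \<Omega>) zs = 0 * contraction I \<Omega> zs + 0 * contraction I \<Omega> zs"
      by (rule contraction_lincomb) (simp add: \<Omega>(2))
    then show ?thesis by (simp add: act_contraction[OF I \<Omega>(1)])
  qed
  then have "contraction I \<Omega> = 0"
    using contraction_invariant_moved[OF assms] by (intro invariants_decomposition(2))
  then show ?thesis by simp
qed

lemma contraction_invariant_image_zero:
  assumes I: "form I" "\<And>x ys. act x I ys = 0" and odd: "\<And>ys. even (length ys) \<Longrightarrow> I ys = 0"
    and \<Omega>: "form \<Omega>" and inv: "\<And>x ys. act x (contraction I \<Omega>) ys = 0"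
  shows "contraction I \<Omega> ys = 0"
proof -
  obtain \<Phi> where \<Phi>: "form \<Phi>" "\<And>x ys. act x \<Phi> ys = 0" "\<Omega> - \<Phi> \<in> moved_forms"
    using invariants_decomposition(1)[OF \<Omega>] by blast
  \<comment> \<open>By \<open>act_contraction\<close>, the contraction maps each generator
    \<open>act x \<Psi>\<close> to another one.\<close>
  have "contraction I \<Xi> \<in> moved_forms" if "\<Xi> \<in> moved_forms" for \<Xi>
    using that
  proof (induction rule: fscale.span_induct_alt)
    case base
    have "contraction I 0 zs = 0 * contraction I \<Omega> zs + 0 * contraction I \<Omega> zs" for zs
      by (rule contraction_lincomb) simp
    then have "contraction I 0 = 0" by (simp add: fun_eq_iff)
    then show ?case by (simp only: fscale.span_zero)
  next
    case (step c f g)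
    then obtain x \<Psi> where f: "f = act x \<Psi>" "form \<Psi>" by blast
    have "contraction I f = act x (contraction I \<Psi>)"
      by (rule ext) (simp add: f act_contraction[OF I])
    then have "contraction I f \<in> moved_forms"
      using form_contraction[OF I(1) f(2)] by (auto intro!: fscale.span_base)
    moreover have "contraction I (fscale c f + g) zs = c * contraction I f zs + 1 * contraction I g zs" for zs
      by (rule contraction_lincomb) (simp add: fscale_def)
    then have "contraction I (fscale c f + g) = fscale c (contraction I f) + contraction I g"
      by (simp add: fun_eq_iff fscale_def)
    ultimately show ?case using step.IH by (simp only: fscale.span_add fscale.span_scale)
  qed
  then have "contraction I (\<Omega> - \<Phi>) \<in> moved_forms" using \<Phi>(3) by blast
  moreover have "contraction I (\<Omega> - \<Phi>) = contraction I \<Omega>"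
  proof
    fix zs
    have "contraction I (\<Omega> - \<Phi>) zs = 1 * contraction I \<Omega> zs + (- 1) * contraction I \<Phi> zs"
      by (rule contraction_lincomb) simp
    then show "contraction I (\<Omega> - \<Phi>) zs = contraction I \<Omega> zs"
      by (simp add: contraction_invariant_zero[OF I odd \<Phi>(1,2)])
  qed
  ultimately have "contraction I \<Omega> = 0" using inv by (intro invariants_decomposition(2)) simp_all
  then show ?thesis by simp
qed

section \<open>The form associated with a cyclic cochain\<close>

lemma associated_form_cyclic:
  assumes "cyclic_cochain scale B (2 * k) F"
  shows "associated_form B k F (xs @ [y]) = associated_form B k F (y # xs)"
  using assms unfolding cyclic_cochain_def associated_form_def
  by (auto dest!: spec[of _ "xs @ [y]"])

lemma associated_form_snoc:
  "length xs = 2 * k \<Longrightarrow> associated_form B k F (xs @ [y]) = B (F xs) y"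
  by (simp add: associated_form_def hat_def)

text \<open>Exchanges among the first \<open>2 * k\<close> arguments are skew because
  \<open>F\<close> is. An exchange involving the last argument is brought to the front by two
  rotations, which carry no sign as \<open>2 * k\<close> is even.\<close>

lemma form_associated_form:
  assumes k: "k \<ge> 1" and cyc: "cyclic_cochain scale B (2 * k) F"
  shows "form (associated_form B k F)"
proof -
  define I where "I = associated_form B k F"
  have skew: "skew_multilinear scale scale (2 * k) F" using cyc by (simp add: cyclic_cochain_def)
  have I_cyc: "I (xs @ [y]) = I (y # xs)" for xs y unfolding I_def by (rule associated_form_cyclic[OF cyc])
  have I_0: "I ys = 0" if "length ys \<noteq> 2 * k + 1" for ys using that by (simp add: I_def associated_form_def)
  have I_snoc: "I (xs @ [y]) = B (F xs) y" if "length xs = 2 * k" for xs y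
    unfolding I_def by (rule associated_form_snoc[OF that])
  have swap: "I (xs @ y # z # zs @ [w]) = - I (xs @ z # y # zs @ [w])" for xs y z zs w
  proof (cases "length xs + length zs + 2 = 2 * k")
    case True
    then have "I ((xs @ y # z # zs) @ [w]) = - I ((xs @ z # y # zs) @ [w])"
      using skew_multilinear_swap[OF skew True, of y z]
      by (subst (1 2) I_snoc) (simp_all add: B_left.neg)
    then show ?thesis by simp
  qed (simp add: I_0)
  show ?thesis unfolding I_def[symmetric]
  proof (rule formI)
    fix xs y z ys c
    show "I (xs @ (y + z) # ys) = I (xs @ y # ys) + I (xs @ z # ys)"
         "I (xs @ scale c y # ys) = c * I (xs @ y # ys)"
    proof -
      have "I (xs @ (y + z) # ys) = I (xs @ y # ys) + I (xs @ z # ys) \<and>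
        I (xs @ scale c y # ys) = c * I (xs @ y # ys)"
      proof (cases "length (xs @ y # ys) = 2 * k + 1")
        case False
        then show ?thesis by (simp add: I_0)
      next
        case True
        show ?thesis
        proof (cases ys rule: rev_cases)
          case Nil
          then show ?thesis using True by (simp add: I_snoc B_right.add B_right.scale)
        next
          case (snoc zs w)
          then have len: "length xs + length zs + 1 = 2 * k" using True by simp
          interpret F: Vector_Spaces.linear scale scale "\<lambda>y. F (xs @ y # zs)"
            by (rule skew_multilinear_slot[OF skew len])
          have "I (xs @ v # ys) = B (F (xs @ v # zs)) w" for v
            using I_snoc[of "xs @ v # zs" w] len snoc by simp
          then show ?thesis by (simp add: F.add F.scale B_left.add B_left.scale)
        qed
      qed
      then show "I (xs @ (y + z) # ys) = I (xs @ y # ys) + I (xs @ z # ys)"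
         "I (xs @ scale c y # ys) = c * I (xs @ y # ys)" by blast+
    qed
  next
    fix xs y z zs
    show "I (xs @ y # z # zs) = - I (xs @ z # y # zs)"
    proof (cases zs rule: rev_cases)
      case (snoc ws w)
      then show ?thesis using swap[of xs y z ws w] by simp
    next
      case Nil
      have rot: "I (xs @ [u, v]) = I (u # v # xs)" for u v
        using I_cyc[of "xs @ [u]" v] I_cyc[of "v # xs" u] by simp
      show ?thesis
      proof (cases xs rule: rev_cases)
        case Nil
        then show ?thesis using \<open>zs = []\<close> k by (simp add: I_0)
      next
        case (snoc vs v)
        then show ?thesis using \<open>zs = []\<close> rot swap[of "[]" y z vs v] by simp
      qed
    qed
  qed
qed

text \<open>Invariance of \<open>F\<close> collects the first \<open>2 * k\<close> slots into
  \<open>B (bracket x (F zs)) z\<close>, which the last slot cancels by invariance of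
  \<open>B\<close>.\<close>

lemma associated_form_invariant:
  assumes inv: "invariant_cochain bracket (2 * k) F"
  shows "act x (associated_form B k F) ys = 0"
proof (cases "length ys = 2 * k + 1")
  case False
  then show ?thesis by (simp add: act_eq_sum associated_form_def)
next
  case True
  then obtain zs z where ys: "ys = zs @ [z]" "length zs = 2 * k"
    by (cases ys rule: rev_cases) auto
  have "act x (associated_form B k F) ys
      = (\<Sum>i<2 * k. associated_form B k F (zs[i := bracket x (zs ! i)] @ [z])) + associated_form B k F (zs @ [bracket x z])"
    unfolding act_eq_sum True ys(1) using ys(2)
    by (auto simp: list_update_append nth_append intro!: sum.cong arg_cong2[of _ _ _ _ "(+)"])
  also have "\<dots> = (\<Sum>i<2 * k. B (F (zs[i := bracket x (zs ! i)])) z) + B (F zs) (bracket x z)"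
    using ys(2) by (simp add: associated_form_snoc)
  also have "(\<Sum>i<2 * k. B (F (zs[i := bracket x (zs ! i)])) z) = B (bracket x (F zs)) z"
    using inv ys(2) by (simp add: invariant_cochain_def B_left.sum)
  also have "\<dots> + B (F zs) (bracket x z) = 0" by (simp add: B_skew)
  finally show ?thesis .
qed

text \<open>The factors -1/2 and 2 leave -1, and the degree sign of the bracket is 1 in the odd
  degree \<open>2 * k + 1\<close>.\<close>

lemma cochain_diff_eq_contraction:
  assumes I: "form (associated_form B k F)" and \<Omega>: "form \<Omega>"
  shows "cochain_diff B E k F \<Omega> ys = - contraction (associated_form B k F) \<Omega> ys"
proof -
  define I where "I = associated_form B k F"
  have "(\<lambda>zs. (- 1) ^ (length zs + 1) * I zs) = I"
    by (rule ext) (simp add: I_def associated_form_def)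
  moreover have "wedge (\<iota> e I) (\<iota> e \<Omega>) ys = rec_wedge (\<iota> e I) (\<iota> e \<Omega>) ys" for e
    using I \<Omega> by (intro wedge_eq_rec_wedge alternating_interior_product) (simp_all add: form_def I_def)
  ultimately show ?thesis
    by (simp add: cochain_diff_def super_poisson_def contraction_def flip: I_def)
qed

end

theorem proposition9p2p4:
  fixes scale :: "complex \<Rightarrow> 'a::ab_group_add \<Rightarrow> 'a"
    and bracket :: "'a \<Rightarrow> 'a \<Rightarrow> 'a"
    and B :: "'a \<Rightarrow> 'a \<Rightarrow> complex"
    and F :: "'a list \<Rightarrow> 'a"
    and k :: nat
    and E :: "'a set"
  assumes "lie_algebra scale bracket"
    and "finite_dimensional scale"
    and "semisimple scale bracket"
    and "bilinear_form scale B"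
    and "symmetric_form B"
    and "nondegenerate_form B"
    and "invariant_form bracket B"
    and "k \<ge> 1"
    and "cyclic_cochain scale B (2 * k) F"
    and "invariant_cochain bracket (2 * k) F"
    and "orthonormal_basis scale B E"
  shows "invariant_forms scale bracket \<subseteq> form_kernel scale (cochain_diff B E k F) \<and>
         cohomology_class scale (cochain_diff B E k F) ` invariant_forms scale bracket
           \<subseteq> cohomology scale (cochain_diff B E k F) \<and>
         inj_on (cohomology_class scale (cochain_diff B E k F)) (invariant_forms scale bracket)"
proof -
  interpret quadratic_lie_algebra scale bracket B E
    using assms by (simp add: quadratic_lie_algebra_def quadratic_lie_algebra_axioms_def)
  define I where "I = associated_form B k F"
  let ?D = "cochain_diff B E k F"
  have I: "form I" "\<And>x ys. act x I ys = 0"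
    unfolding I_def by (rule form_associated_form[OF assms(8,9)], rule associated_form_invariant[OF assms(10)])
  have odd: "I ys = 0" if "even (length ys)" for ys
    using that by (auto simp: I_def associated_form_def)
  have D: "?D \<Omega> ys = - contraction I \<Omega> ys" if "form \<Omega>" for \<Omega> ys
    using cochain_diff_eq_contraction[of k F \<Omega> ys] I(1) that by (simp add: I_def)
  have ker: "invariant_forms scale bracket \<subseteq> form_kernel scale ?D"
  proof
    fix \<Omega> assume "\<Omega> \<in> invariant_forms scale bracket"
    then have \<Omega>: "form \<Omega>" "\<And>x ys. act x \<Omega> ys = 0" by (simp_all add: invariant_forms_iff)
    then have "?D \<Omega> = (\<lambda>ys. 0)"
      by (intro ext) (simp add: D contraction_invariant_zero[OF I odd])
    then show "\<Omega> \<in> form_kernel scale ?D" using \<Omega> by (simp add: form_kernel_def ext_forms_iff)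
  qed
  have "inj_on (cohomology_class scale ?D) (invariant_forms scale bracket)"
  proof (rule inj_onI)
    fix \<Omega> \<Omega>' assume inv: "\<Omega> \<in> invariant_forms scale bracket" "\<Omega>' \<in> invariant_forms scale bracket"
      and eq: "cohomology_class scale ?D \<Omega> = cohomology_class scale ?D \<Omega>'"
    have \<Omega>: "form \<Omega>" "\<And>x ys. act x \<Omega> ys = 0" and \<Omega>': "form \<Omega>'" "\<And>x ys. act x \<Omega>' ys = 0"
      using inv by (simp_all add: invariant_forms_iff)
    \<comment> \<open>Zero is a coboundary, so \<Omega> belongs to its own class and equality of
      classes exhibits it as \<open>\<Omega>'\<close> plus a coboundary.\<close>
    have "?D (\<lambda>ys. 0) = (\<lambda>ys. 0)"
    proof
      fix ys
      have "contraction I (\<lambda>ys. 0) ys = 0 * contraction I I ys + 0 * contraction I I ys"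
        by (rule contraction_lincomb) simp
      then show "?D (\<lambda>ys. 0) ys = 0" using D[OF form_0] by simp
    qed
    then have "(\<lambda>ys. 0) \<in> form_image scale ?D"
      unfolding form_image_def
      by (intro image_eqI[of _ _ "\<lambda>ys. 0"]) (simp_all add: ext_forms_iff form_0)
    then have "(\<lambda>ys. \<Omega> ys + (\<lambda>ys. 0) ys) \<in> cohomology_class scale ?D \<Omega>"
      unfolding cohomology_class_def by (intro CollectI exI[of _ "\<lambda>ys. 0"] conjI refl)
    then have "\<Omega> \<in> cohomology_class scale ?D \<Omega>'" by (simp add: eq)
    then obtain \<Xi> where \<Xi>: "form \<Xi>" "\<Omega> = (\<lambda>ys. \<Omega>' ys + ?D \<Xi> ys)"
      by (auto simp: cohomology_class_def form_image_def ext_forms_iff)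
    then have diff: "contraction I \<Xi> ys = (- 1) * \<Omega> ys + 1 * \<Omega>' ys" for ys
      using D[OF \<Xi>(1), of ys] fun_cong[OF \<Xi>(2), of ys] by simp
    have "act x (contraction I \<Xi>) ys = (- 1) * act x \<Omega> ys + 1 * act x \<Omega>' ys" for x ys
      by (rule act_lincomb) (rule diff)
    then have "contraction I \<Xi> ys = 0" for ys
      by (intro contraction_invariant_image_zero[OF I odd \<Xi>(1)]) (simp_all add: \<Omega> \<Omega>')
    then show "\<Omega> = \<Omega>'" using diff by (intro ext) simp
  qed
  moreover have "cohomology_class scale ?D ` invariant_forms scale bracket \<subseteq> cohomology scale ?D"
    unfolding cohomology_def using ker by (rule image_mono)
  ultimately show ?thesis using ker by blast
qed

end
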